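(* Let $[a,b]$ be a non-trivial segment of $\mathbb{T}$, let $\omega=(-1,1)\times(\mathbb{T}\setminus[a,b])$ and let $T>0$. There exists a sequence $(f_{k,0})_{k\in\mathbb{N}}$ in $L^2(\Omega)$ such that, denoting for every $k\in\mathbb{N}$ by $f_k$ the solution of the Grushin equation $$(\partial_t-\partial_x^2-x^2\partial_y^2)f_k=0 \text{ on } [0,T]\times\Omega,\qquad f_k=0 \text{ on } [0,T]\times\partial\Omega,\qquad f_k(0,\cdot,\cdot)=f_{k,0},$$ one has $\sup_k\|f_k\|_{L^2([0,T]\times\omega)}<+\infty$ and $\|f_k(T,\cdot,\cdot)\|_{L^2(\Omega)}\to+\infty$ as $k\to+\infty$.
   Context: $\mathbb{T}=\mathbb{R}/2\pi\mathbb{Z}$ and $\Omega=(-1,1)\times\mathbb{T}$, with variables $(x,y)$. A segment of $\mathbb{T}$ is non-trivial if it is not empty or reduced to a point. *)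

theory Defs
  imports "HOL-Analysis.Analysis"
begin

(* Functions on (-1,1) x R/2piZ are represented by functions on R x R that are 2pi-periodic in the
   second variable; norms and integrals are taken over the fundamental domain Omega. *)

definition Omega :: "(real \<times> real) set" where
  "Omega = {-1<..<1} \<times> {0..<2 * pi}"

(* The segment [a,b] of R/2piZ is the image of the real interval [a,b] under the projection. *)
definition omega :: "real \<Rightarrow> real \<Rightarrow> (real \<times> real) set" where
  "omega a b = {(x, y) \<in> Omega. \<forall>n::int. y + 2 * pi * of_int n \<notin> {a..b}}"

definition square_integrable_on :: "'a::euclidean_space set \<Rightarrow> ('a \<Rightarrow> complex) \<Rightarrow> bool" where
  "square_integrable_on S f \<longleftrightarrow>
     set_borel_measurable lborel S f \<and> set_integrable lborel S (\<lambda>p. (cmod (f p))\<^sup>2)"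

definition l2norm :: "'a::euclidean_space set \<Rightarrow> ('a \<Rightarrow> complex) \<Rightarrow> real" where
  "l2norm S f = sqrt (LINT p:S|lborel. (cmod (f p))\<^sup>2)"

definition l2inner :: "'a::euclidean_space set \<Rightarrow> ('a \<Rightarrow> complex) \<Rightarrow> ('a \<Rightarrow> complex) \<Rightarrow> complex" where
  "l2inner S f g = (LINT p:S|lborel. f p * cnj (g p))"

definition L2_Omega :: "(real \<times> real \<Rightarrow> complex) set" where
  "L2_Omega = {f. (\<forall>x\<in>{-1<..<1}. \<forall>y. f (x, y + 2 * pi) = f (x, y)) \<and> square_integrable_on Omega f}"

definition partial_x :: "(real \<times> real \<Rightarrow> complex) \<Rightarrow> real \<times> real \<Rightarrow> complex" where
  "partial_x f = (\<lambda>(x, y). vector_derivative (\<lambda>s. f (s, y)) (at x))"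

definition partial_y :: "(real \<times> real \<Rightarrow> complex) \<Rightarrow> real \<times> real \<Rightarrow> complex" where
  "partial_y f = (\<lambda>(x, y). vector_derivative (\<lambda>s. f (x, s)) (at y))"

primrec C_k :: "nat \<Rightarrow> (real \<times> real \<Rightarrow> complex) \<Rightarrow> bool" where
  "C_k 0 f \<longleftrightarrow> continuous_on UNIV f"
| "C_k (Suc k) f \<longleftrightarrow> (\<forall>p. f differentiable (at p)) \<and> C_k k (partial_x f) \<and> C_k k (partial_y f)"

(* Smooth functions with compact support in the open set (-1,1) x R/2piZ, extended by 0 to |x| >= 1. *)
definition test_functions :: "(real \<times> real \<Rightarrow> complex) set" where
  "test_functions = {\<phi>. (\<forall>k. C_k k \<phi>) \<and> (\<forall>x y. \<phi> (x, y + 2 * pi) = \<phi> (x, y)) \<and>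
     (\<exists>r<1. \<forall>x y. \<bar>x\<bar> \<ge> r \<longrightarrow> \<phi> (x, y) = 0)}"

definition grushin_y :: "(real \<times> real \<Rightarrow> complex) \<Rightarrow> real \<times> real \<Rightarrow> complex" where
  "grushin_y f = (\<lambda>(x, y). of_real x * partial_y f (x, y))"

(* f belongs to the form domain V, the completion of the test functions for the norm of the Dirichlet
   form |f_x|^2 + |x f_y|^2, and g = f_x, h = x f_y.  The L2-norm of f is controlled by that of f_x
   (Poincare), so V is a space of L2 functions; the condition f = 0 on the boundary is contained in
   membership in V. *)
definition grushin_V ::
  "(real \<times> real \<Rightarrow> complex) \<Rightarrow> (real \<times> real \<Rightarrow> complex) \<Rightarrow> (real \<times> real \<Rightarrow> complex) \<Rightarrow> bool" where
  "grushin_V f g h \<longleftrightarrow> f \<in> L2_Omega \<and> g \<in> L2_Omega \<and> h \<in> L2_Omega \<and>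
     (\<exists>\<phi>::nat \<Rightarrow> real \<times> real \<Rightarrow> complex. (\<forall>n. \<phi> n \<in> test_functions) \<and>
        (\<lambda>n. l2norm Omega (\<lambda>p. \<phi> n p - f p)) \<longlonglongrightarrow> 0 \<and>
        (\<lambda>n. l2norm Omega (\<lambda>p. partial_x (\<phi> n) p - g p)) \<longlonglongrightarrow> 0 \<and>
        (\<lambda>n. l2norm Omega (\<lambda>p. grushin_y (\<phi> n) p - h p)) \<longlonglongrightarrow> 0)"

(* The weak solution, in C([0,T]; L2(Omega)) and L2(0,T; V), of the Grushin equation with homogeneous
   Dirichlet boundary condition and initial value f0.  The equation is d/dt <f,phi> + a(f,phi) = 0,
   integrated over [0,t], where a(f,phi) = <f_x, phi_x> + <x f_y, x phi_y>.  For each f0 in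
   L2(Omega) such an f exists, and its values f t are unique up to null sets. *)
definition grushin_solution ::
  "real \<Rightarrow> (real \<times> real \<Rightarrow> complex) \<Rightarrow> (real \<Rightarrow> real \<times> real \<Rightarrow> complex) \<Rightarrow> bool" where
  "grushin_solution T f0 f \<longleftrightarrow>
     (\<forall>t\<in>{0..T}. f t \<in> L2_Omega) \<and>
     (\<forall>t\<in>{0..T}. ((\<lambda>s. l2norm Omega (\<lambda>p. f s p - f t p)) \<longlongrightarrow> 0) (at t within {0..T})) \<and>
     (AE p in lborel. p \<in> Omega \<longrightarrow> f 0 p = f0 p) \<and>
     (\<exists>g h. square_integrable_on ({0..T} \<times> Omega) (\<lambda>(t, p). f t p) \<and>
        square_integrable_on ({0..T} \<times> Omega) (\<lambda>(t, p). g t p) \<and>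
        square_integrable_on ({0..T} \<times> Omega) (\<lambda>(t, p). h t p) \<and>
        (AE t in lborel. t \<in> {0..T} \<longrightarrow> grushin_V (f t) (g t) (h t)) \<and>
        (\<forall>\<phi>\<in>test_functions. \<forall>t\<in>{0..T}.
           l2inner Omega (f t) \<phi> - l2inner Omega f0 \<phi> =
           - (LINT s:{0..t}|lborel.
                l2inner Omega (g s) (partial_x \<phi>) + l2inner Omega (h s) (grushin_y \<phi>))))"

end

theory Submission
  imports
    "HOL-Complex_Analysis.Complex_Analysis"
    "HOL-Real_Asymp.Real_Asymp"
    Defs
begin

text \<open>
  Let \<open>n + \<rho> n\<close> be the first Dirichlet eigenvalue of \<open>- d\<^sup>2/dx\<^sup>2 + n\<^sup>2 x\<^sup>2\<close> on \<open>(- 1, 1)\<close> and \<open>v n\<close> its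
  eigenfunction, so that \<open>exp (- (n + \<rho> n) t) v n x exp (i n y)\<close> solves the Grushin equation. Both \<open>\<rho> n\<close>
  and \<open>v n\<close> extend to bounded holomorphic functions of \<open>n\<close> in the part \<open>Re n > \<sigma>\<close> of any sector
  \<open>\<bar>Im n\<bar> < K Re n\<close>. Take a linear combination of these modes with coefficients
  \<open>exp ((T + 1) n - \<epsilon> n ln n - i n c)\<close>, where \<open>c\<close> is the midpoint of \<open>[a, b]\<close>. By the residue theorem it
  is an integral along the boundary of the sector; if \<open>y - c\<close> stays away from \<open>2 \<pi> \<int>\<close> and the sector
  is wide enough, the decay of \<open>exp (i n (y - c))\<close> off the real axis beats \<open>exp ((T + 1) n)\<close>, whence a
  bound which is uniform in \<open>\<epsilon>\<close>. But as \<open>\<epsilon> \<rightarrow> 0\<close>, the \<open>n\<close>-th Fourier coefficient at time \<open>T\<close> tends to a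
  limit which grows at least like \<open>exp n / n\<close>.
\<close>

section \<open>Eigenfunctions of the harmonic oscillator on an interval\<close>

text \<open>There the oscillator with complex \<open>s\<close> is far from self-adjoint and no
  spectral theorem locates its eigenvalue. The substitute is a family of ODE estimates with weight
  \<open>exp (Re s * x^2)\<close>. The delicate point is the lower bound for
  \<open>herm s 0 1\<close>, where oscillation could cause cancellation; losing powers of
  \<open>s\<close> is harmless there, losing an exponential is not. The damping is dictated by the
  sector as well. Undamped, the sums diverge; a factor such as \<open>exp (- \<epsilon> n^2)\<close>
  would grow in wide sectors, where \<open>Re (s^2)\<close> becomes negative, whereas
  \<open>Re (s Ln s)\<close> is positive for large \<open>s\<close> in each of them. The summand
  \<open>1\<close> in \<open>T + 1\<close> is the growth that survives the decay up to time
  \<open>T\<close>; any positive number would do. All data are finite sums of modes, so the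
  solutions are explicit and no existence theory enters.\<close>

text \<open>
  The function \<open>herm s r\<close> below is the even solution of \<open>y'' - 2 s x y' + r y = 1\<close>, \<open>y 0 = 0\<close>, expanded in
  powers of \<open>x\<^sup>2\<close>. Then \<open>v = exp (- s x\<^sup>2 / 2) (1 - r y)\<close> solves \<open>- v'' + s\<^sup>2 x\<^sup>2 v = (s + r) v\<close>, and
  the Dirichlet condition at \<open>x = 1\<close> and \<open>x = - 1\<close> becomes \<open>r * herm s r 1 = 1\<close>.
\<close>

fun herm_coeff :: "complex \<Rightarrow> complex \<Rightarrow> nat \<Rightarrow> complex" where
  "herm_coeff s r 0 = 0"
| "herm_coeff s r (Suc m) =
     ((4 * s * of_nat m - r) * herm_coeff s r m + of_bool (m = 0)) / of_nat ((2 * m + 1) * (2 * m + 2))"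

definition herm_series :: "complex \<Rightarrow> complex \<Rightarrow> complex \<Rightarrow> complex" where
  "herm_series s r z = (\<Sum>m. herm_coeff s r m * z ^ m)"

definition herm_series' :: "complex \<Rightarrow> complex \<Rightarrow> complex \<Rightarrow> complex" where
  "herm_series' s r z = (\<Sum>m. diffs (herm_coeff s r) m * z ^ m)"

definition herm :: "complex \<Rightarrow> complex \<Rightarrow> complex \<Rightarrow> complex" where
  "herm s r x = herm_series s r (x\<^sup>2)"

definition herm' :: "complex \<Rightarrow> complex \<Rightarrow> complex \<Rightarrow> complex" where
  "herm' s r x = 2 * x * herm_series' s r (x\<^sup>2)"

text \<open>For \<open>m > 0\<close> the numerator of the recursion is at most
  \<open>A * (2 * m + 1)\<close>, so a step costs at most \<open>A / (m + 1)\<close> and the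
  coefficients are dominated by those of an exponential series. The point is uniformity: one
  \<open>A\<close> serves all \<open>s\<close> and \<open>r\<close> in a bounded set.\<close>

lemma norm_herm_coeff_le:
  assumes "1 + 2 * norm s + norm r \<le> A"
  shows "norm (herm_coeff s r m) \<le> A ^ m / fact m"
proof (induction m)
  case (Suc m)
  have A1: "A \<ge> 1" using assms norm_ge_zero[of s] norm_ge_zero[of r] by linarith
  show ?case
  proof (cases "m = 0")
    case False
    have "norm (4 * s * of_nat m - r) \<le> norm (4 * s * of_nat m) + norm r"
      by (rule norm_triangle_ineq4)
    also have "\<dots> = 4 * norm s * m + norm r" by (simp add: norm_mult)
    also have "\<dots> \<le> (2 * norm s + norm r) * (2 * m + 1)" by (simp add: algebra_simps)
    also have "\<dots> \<le> A * (2 * m + 1)"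
      using assms by (intro mult_right_mono) auto
    finally have 1: "norm (4 * s * of_nat m - r) \<le> A * (2 * m + 1)" .
    have "norm (herm_coeff s r (Suc m))
        = norm (4 * s * of_nat m - r) * norm (herm_coeff s r m) / ((2 * m + 1) * (2 * m + 2))"
      using False by (simp add: norm_mult norm_divide del: of_nat_Suc of_nat_mult of_nat_add)
    also have "\<dots> \<le> (A * (2 * m + 1)) * (A ^ m / fact m) / ((2 * m + 1) * (2 * m + 2))"
      using 1 Suc.IH A1 by (intro divide_right_mono mult_mono) auto
    also have "\<dots> = A ^ Suc m / fact m / (2 * m + 2)"
    proof -
      have "a * p * (b / c) / (p * q) = a * b / c / q" if "p \<noteq> 0" for a b c p q :: real
        using that by simp
      moreover have "real (2 * m + 1) \<noteq> 0" by simp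
      ultimately show ?thesis by (simp only: of_nat_mult[of "2 * m + 1"] power_Suc)
    qed
    also have "\<dots> \<le> A ^ Suc m / fact m / (m + 1)"
      using A1 by (intro divide_left_mono) auto
    also have "\<dots> = A ^ Suc m / fact (Suc m)" by (simp add: field_simps)
    finally show ?thesis .
  qed (use A1 in simp)
qed simp

lemma summable_herm_coeff: "summable (\<lambda>m. herm_coeff s r m * z ^ m)"
proof (rule summable_comparison_test')
  show "summable (\<lambda>m. ((1 + 2 * norm s + norm r) * norm z) ^ m /\<^sub>R fact m)"
    using summable_exp_generic[of "(1 + 2 * norm s + norm r) * norm z"] .
  fix m :: nat
  have "norm (herm_coeff s r m) \<le> (1 + 2 * norm s + norm r) ^ m / fact m"
    by (rule norm_herm_coeff_le) simp
  from mult_right_mono[OF this, of "norm z ^ m"]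
  show "norm (herm_coeff s r m * z ^ m) \<le> ((1 + 2 * norm s + norm r) * norm z) ^ m /\<^sub>R fact m"
    by (simp only: norm_mult norm_power power_mult_distrib scaleR_conv_of_real) (simp add: field_simps)
qed

lemma herm_series_has_field_derivative: "(herm_series s r has_field_derivative herm_series' s r z) (at z)"
  unfolding herm_series_def herm_series'_def by (rule termdiffs_strong_converges_everywhere[OF summable_herm_coeff])

lemma summable_diffs_herm_coeff: "summable (\<lambda>m. diffs (herm_coeff s r) m * z ^ m)"
  by (rule termdiff_converges_all[OF summable_herm_coeff])

lemma summable_diffs2_herm_coeff: "summable (\<lambda>m. diffs (diffs (herm_coeff s r)) m * z ^ m)"
  by (rule termdiff_converges_all[OF summable_diffs_herm_coeff])

text \<open>With \<open>y x = Y (x^2)\<close> the equation \<open>y'' - 2 s x y' + r y = 1\<close>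
  becomes this one for \<open>Y\<close> at \<open>z = x^2\<close>. Comparing coefficients of
  \<open>z ^ m\<close> gives back the recursion, with the inhomogeneity at
  \<open>m = 0\<close>.\<close>

lemma herm_series_ode:
  "4 * z * (\<Sum>m. diffs (diffs (herm_coeff s r)) m * z ^ m) + 2 * herm_series' s r z - 4 * s * z * herm_series' s r z
     + r * herm_series s r z = 1"
proof -
  let ?e = "herm_coeff s r"
  \<comment> \<open>Multiplication by \<open>z\<close> as an index shift, so that all series run
    over the same powers.\<close>
  have shift: "z * (\<Sum>m. c m * z ^ m) = (\<Sum>m. (case m of 0 \<Rightarrow> 0 | Suc k \<Rightarrow> c k) * z ^ m)"
    "summable (\<lambda>m. (case m of 0 \<Rightarrow> 0 | Suc k \<Rightarrow> c k) * z ^ m)"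
    if c: "summable (\<lambda>m. c m * z ^ m)" for c :: "nat \<Rightarrow> complex"
  proof -
    have *: "(\<lambda>m. z * (c m * z ^ m)) = (\<lambda>m. (case Suc m of 0 \<Rightarrow> 0 | Suc k \<Rightarrow> c k) * z ^ Suc m)"
      by (auto simp: mult_ac)
    have "summable (\<lambda>m. z * (c m * z ^ m))" using c by (rule summable_mult)
    then show S: "summable (\<lambda>m. (case m of 0 \<Rightarrow> 0 | Suc k \<Rightarrow> c k) * z ^ m)"
      unfolding * by (subst (asm) summable_Suc_iff)
    show "z * (\<Sum>m. c m * z ^ m) = (\<Sum>m. (case m of 0 \<Rightarrow> 0 | Suc k \<Rightarrow> c k) * z ^ m)"
      using suminf_split_head[OF S] suminf_mult[OF c, of z] unfolding * by simp
  qed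
  note S = summable_herm_coeff[of s r z] summable_diffs_herm_coeff[of s r z]
    shift[OF summable_diffs_herm_coeff[of s r]] shift[OF summable_diffs2_herm_coeff[of s r]]
  let ?a = "\<lambda>m. case m of 0 \<Rightarrow> 0 | Suc k \<Rightarrow> diffs ?e k"
  let ?b = "\<lambda>m. case m of 0 \<Rightarrow> 0 | Suc k \<Rightarrow> diffs (diffs ?e) k"
  have coef: "4 * ?b m + 2 * diffs ?e m - 4 * s * ?a m + r * ?e m = of_bool (m = 0)" for m
  proof (cases m)
    case (Suc k)
    have ne: "(of_nat ((2 * m + 1) * (2 * m + 2)) :: complex) \<noteq> 0"
      by (simp only: of_nat_eq_0_iff) simp
    have e: "of_nat ((2 * m + 1) * (2 * m + 2)) * ?e (Suc m) = (4 * s * of_nat m - r) * ?e m"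
      using Suc ne by (simp del: of_nat_mult of_nat_add of_nat_Suc)
    have "4 * ?b m + 2 * diffs ?e m = of_nat ((2 * m + 1) * (2 * m + 2)) * ?e (Suc m)"
      by (simp add: Suc diffs_def algebra_simps del: herm_coeff.simps)
    moreover have "?a m = of_nat m * ?e m" by (simp add: Suc diffs_def del: herm_coeff.simps)
    ultimately show ?thesis using Suc unfolding e by (simp add: algebra_simps del: herm_coeff.simps)
  qed (simp add: diffs_def)
  have "4 * z * (\<Sum>m. diffs (diffs (herm_coeff s r)) m * z ^ m) + 2 * herm_series' s r z
          - 4 * s * z * herm_series' s r z + r * herm_series s r z
      = 4 * (\<Sum>m. ?b m * z ^ m) + 2 * (\<Sum>m. diffs ?e m * z ^ m) - 4 * s * (\<Sum>m. ?a m * z ^ m)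
          + r * (\<Sum>m. ?e m * z ^ m)"
    using S(3,5) unfolding herm_series_def herm_series'_def by (simp add: mult.assoc)
  also have "\<dots> = (\<Sum>m. 4 * (?b m * z ^ m) + 2 * (diffs ?e m * z ^ m) - 4 * s * (?a m * z ^ m)
          + r * (?e m * z ^ m))"
    by (intro sums_unique sums_add sums_diff sums_mult summable_sums S)
  also have "\<dots> = (\<Sum>m. of_bool (m = 0) * z ^ m)"
    by (intro suminf_cong, subst coef[symmetric]) (simp add: algebra_simps)
  also have "\<dots> = 1" by (subst suminf_finite[of "{0}"]) auto
  finally show ?thesis .
qed

lemma herm_has_field_derivative: "(herm s r has_field_derivative herm' s r x) (at x)"
proof -
  have "((\<lambda>x. herm_series s r (x\<^sup>2)) has_field_derivative herm_series' s r (x\<^sup>2) * (2 * x)) (at x)"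
    by (rule DERIV_chain2[OF herm_series_has_field_derivative]) (auto intro!: derivative_eq_intros)
  then show ?thesis by (simp add: herm'_def herm_def[abs_def] mult_ac)
qed

lemma herm'_has_field_derivative:
  "(herm' s r has_field_derivative (1 + 2 * s * x * herm' s r x - r * herm s r x)) (at x)"
proof -
  let ?d2 = "\<lambda>z. \<Sum>m. diffs (diffs (herm_coeff s r)) m * z ^ m"
  have d: "(herm_series' s r has_field_derivative ?d2 z) (at z)" for z
    unfolding herm_series'_def by (rule termdiffs_strong_converges_everywhere[OF summable_diffs_herm_coeff])
  have "((\<lambda>x. 2 * x * herm_series' s r (x\<^sup>2)) has_field_derivative
          2 * herm_series' s r (x\<^sup>2) + ?d2 (x\<^sup>2) * (2 * x) * (2 * x)) (at x)"
    by (rule derivative_eq_intros DERIV_chain2[OF d] refl | simp)+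
  moreover have "2 * herm_series' s r (x\<^sup>2) + ?d2 (x\<^sup>2) * (2 * x) * (2 * x)
      = 1 + 2 * s * x * herm' s r x - r * herm s r x"
    using herm_series_ode[of "x\<^sup>2" s r]
    by (simp add: herm'_def herm_def algebra_simps power2_eq_square)
  ultimately show ?thesis by (simp add: herm'_def[abs_def])
qed

lemma herm_0 [simp]: "herm s r 0 = 0"
proof -
  have "(\<Sum>m. herm_coeff s r m * 0 ^ m) = (\<Sum>m. herm_coeff s r m * of_bool (m = 0))"
    by (intro suminf_cong) auto
  then show ?thesis unfolding herm_def herm_series_def by (simp add: powser_zero)
qed

lemma herm'_0 [simp]: "herm' s r 0 = 0" by (simp add: herm'_def)

lemma herm_minus [simp]: "herm s r (- x) = herm s r x" by (simp add: herm_def)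

text \<open>A bootstrap in the norm with weight \<open>exp (- Re s * x^2)\<close>, the modulus of
  the integrating factor that removes \<open>2 s x y'\<close>. If \<open>m\<close> is the maximum of
  the weighted \<open>y\<close>, then \<open>F - r y\<close> has weighted size at most
  \<open>c = B + \<sigma> * m\<close>. One integration gives \<open>c * x\<close>, and integrating
  \<open>c * x * exp (\<sigma> * x^2)\<close> gives the factor \<open>c / (2 * \<sigma>)\<close>;
  the \<open>2\<close> lets the argument close.\<close>

lemma hermite_inhomogeneous_bound:
  fixes y y' F :: "real \<Rightarrow> complex" and s r :: complex and B x :: real
  assumes s: "Re s > 0" and r: "norm r \<le> Re s"
    and y: "\<And>x. (y has_vector_derivative y' x) (at x)"
    and y': "\<And>x. (y' has_vector_derivative (F x + 2 * s * x * y' x - r * y x)) (at x)"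
    and init: "y 0 = 0" "y' 0 = 0"
    and F: "\<And>x. x \<in> {0..1} \<Longrightarrow> norm (F x) \<le> B * exp (Re s * x\<^sup>2)"
    and x: "x \<in> {0..1}"
  shows "norm (y x) \<le> B / Re s * exp (Re s * x\<^sup>2)"
proof -
  define \<sigma> where "\<sigma> = Re s"
  have \<sigma>: "\<sigma> > 0" using s by (simp add: \<sigma>_def)
  have cont_y: "continuous_on A y" for A
    using y by (meson continuous_at_imp_continuous_on has_vector_derivative_continuous)
  have "continuous_on {0..1} (\<lambda>x. norm (y x) * exp (- \<sigma> * x\<^sup>2))"
    by (intro continuous_intros cont_y)
  from continuous_attains_sup[OF _ _ this] obtain x0 where x0: "x0 \<in> {0..1}"
    and sup: "\<And>x. x \<in> {0..1} \<Longrightarrow>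
      norm (y x) * exp (- \<sigma> * x\<^sup>2) \<le> norm (y x0) * exp (- \<sigma> * x0\<^sup>2)"
    by auto
  define m where "m = norm (y x0) * exp (- \<sigma> * x0\<^sup>2)"
  have ym: "norm (y x) \<le> m * exp (\<sigma> * x\<^sup>2)" if "x \<in> {0..1}" for x
    using sup[OF that] by (simp add: m_def exp_minus field_simps)
  define c where "c = B + \<sigma> * m"
  have "norm (F 0) \<le> B" using F[of 0] by simp
  then have "B \<ge> 0" by (rule order_trans[OF norm_ge_zero])
  moreover have "m \<ge> 0" by (simp add: m_def)
  ultimately have c: "c \<ge> 0" using \<sigma> by (simp add: c_def)
  define P where "P = (\<lambda>x::real. exp (- s * x\<^sup>2) * y' x)"
  have P: "(P has_vector_derivative exp (- s * x\<^sup>2) * (F x - r * y x)) (at x)" for x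
  proof -
    have "((\<lambda>z. exp (- s * z\<^sup>2)) has_field_derivative exp (- s * x\<^sup>2) * (- s * (2 * of_real x)))
        (at (complex_of_real x))"
      by (auto intro!: derivative_eq_intros)
    then have "((\<lambda>x::real. exp (- s * x\<^sup>2)) has_vector_derivative
        exp (- s * x\<^sup>2) * (- s * (2 * of_real x))) (at x)"
      using has_vector_derivative_real_field[of "\<lambda>z. exp (- s * z\<^sup>2)"] by fastforce
    from has_vector_derivative_mult[OF this y'[of x]] show ?thesis
      by (simp add: P_def algebra_simps)
  qed
  have Pb: "norm (exp (- s * x\<^sup>2) * (F x - r * y x)) \<le> c" if "x \<in> {0..1}" for x :: real
  proof -
    have "norm (F x - r * y x) \<le> norm (F x) + norm r * norm (y x)"
      using norm_triangle_ineq4[of "F x" "r * y x"] by (simp add: norm_mult)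
    also have "\<dots> \<le> B * exp (\<sigma> * x\<^sup>2) + \<sigma> * (m * exp (\<sigma> * x\<^sup>2))"
      using F[OF that] ym[OF that] r \<sigma> by (intro add_mono mult_mono) (auto simp: \<sigma>_def)
    also have "\<dots> = c * exp (\<sigma> * x\<^sup>2)" by (simp add: c_def algebra_simps)
    finally have "norm (exp (- s * x\<^sup>2) * (F x - r * y x)) \<le> exp (- (\<sigma> * x\<^sup>2)) * (c * exp (\<sigma> * x\<^sup>2))"
      unfolding norm_mult by (simp add: \<sigma>_def flip: of_real_power)
    also have "\<dots> = c" by (simp add: exp_minus field_simps)
    finally show ?thesis .
  qed
  have Px: "norm (P x) \<le> c * x" if "x \<in> {0..1}" for x
  proof (cases "x = 0")
    case False
    have "norm (P x - P 0) \<le> c * x - c * 0"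
    proof (rule differentiable_bound_general)
      show "continuous_on {0..x} P"
        using P by (meson continuous_at_imp_continuous_on has_vector_derivative_continuous)
      show "((\<lambda>x. c * x) has_vector_derivative c) (at u)" for u :: real
        by (auto intro!: derivative_eq_intros)
    qed (use False that P Pb in \<open>auto intro!: continuous_intros\<close>)
    then show ?thesis by (simp add: P_def init)
  qed (simp add: P_def init)
  have y'b: "norm (y' x) \<le> c * x * exp (\<sigma> * x\<^sup>2)" if "x \<in> {0..1}" for x
  proof -
    have "norm (P x) = exp (- (\<sigma> * x\<^sup>2)) * norm (y' x)"
      by (simp add: P_def norm_mult \<sigma>_def flip: of_real_power)
    with Px[OF that] show ?thesis by (simp add: exp_minus field_simps)
  qed
  have yb: "norm (y x) \<le> c / (2 * \<sigma>) * exp (\<sigma> * x\<^sup>2)" if "x \<in> {0..1}" for x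
  proof (cases "x = 0")
    case False
    have "norm (y x - y 0) \<le> c / (2 * \<sigma>) * exp (\<sigma> * x\<^sup>2) - c / (2 * \<sigma>) * exp (\<sigma> * 0\<^sup>2)"
    proof (rule differentiable_bound_general)
      show "((\<lambda>x. c / (2 * \<sigma>) * exp (\<sigma> * x\<^sup>2)) has_vector_derivative c * u * exp (\<sigma> * u\<^sup>2)) (at u)" for u :: real
        using \<sigma> by (auto intro!: derivative_eq_intros simp: has_real_derivative_iff_has_vector_derivative[symmetric])
    qed (use False that y y'b \<sigma> in \<open>auto intro!: continuous_intros cont_y\<close>)
    also have "\<dots> \<le> c / (2 * \<sigma>) * exp (\<sigma> * x\<^sup>2)" using \<sigma> c by simp
    finally show ?thesis by (simp add: init)
  qed (use c \<sigma> in \<open>simp add: init\<close>)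
  \<comment> \<open>At the maximum point this reads
    \<open>m \<le> B / (2 * \<sigma>) + m / 2\<close>, and \<open>m / 2\<close> is absorbed on the
    left.\<close>
  have "m \<le> c / (2 * \<sigma>)"
    using yb[OF x0] by (simp add: m_def exp_minus field_simps)
  then have "m \<le> B / \<sigma>" using \<sigma> by (simp add: c_def field_simps)
  then have "m * exp (\<sigma> * x\<^sup>2) \<le> B / \<sigma> * exp (\<sigma> * x\<^sup>2)"
    by (rule mult_right_mono) simp
  with ym[OF x] show ?thesis by (simp add: \<sigma>_def)
qed

lemma herm_has_vector_derivative:
  "((\<lambda>x::real. herm s r x) has_vector_derivative herm' s r x) (at x)"
  by (rule has_vector_derivative_real_field[OF herm_has_field_derivative])

lemma herm'_has_vector_derivative:
  "((\<lambda>x::real. herm' s r x) has_vector_derivative (1 + 2 * s * x * herm' s r x - r * herm s r x)) (at x)"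
  by (rule has_vector_derivative_real_field[OF herm'_has_field_derivative])

lemma norm_herm_le:
  assumes "Re s > 0" "norm r \<le> Re s" "x \<in> {0..1}"
  shows "norm (herm s r (of_real x)) \<le> exp (Re s * x\<^sup>2) / Re s"
proof -
  have "norm (herm s r (of_real x)) \<le> 1 / Re s * exp (Re s * x\<^sup>2)"
    by (rule hermite_inhomogeneous_bound[of s r "\<lambda>x. herm s r (of_real x)" "\<lambda>x. herm' s r (of_real x)" "\<lambda>_. 1"])
      (use assms in \<open>auto intro: herm_has_vector_derivative herm'_has_vector_derivative\<close>)
  then show ?thesis by simp
qed

text \<open>The difference solves the equation for \<open>r1\<close> with right-hand side
  \<open>(r2 - r1) * herm s r2\<close>, which \<open>norm_herm_le\<close> controls; hence the second
  power of \<open>Re s\<close>. This is the Lipschitz estimate behind the contraction.\<close>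

lemma norm_herm_diff_le:
  assumes s: "Re s > 0" and r: "norm r1 \<le> Re s" "norm r2 \<le> Re s" and x: "x \<in> {0..1}"
  shows "norm (herm s r1 (of_real x) - herm s r2 (of_real x)) \<le> norm (r1 - r2) / (Re s)\<^sup>2 * exp (Re s * x\<^sup>2)"
proof -
  let ?y = "\<lambda>x::real. herm s r1 x - herm s r2 x"
  let ?y' = "\<lambda>x::real. herm' s r1 x - herm' s r2 x"
  let ?F = "\<lambda>x::real. (r2 - r1) * herm s r2 x"
  have "norm (?y x) \<le> (norm (r1 - r2) / Re s) / Re s * exp (Re s * x\<^sup>2)"
  proof (rule hermite_inhomogeneous_bound[of s r1 ?y ?y' ?F])
    show "(?y' has_vector_derivative ?F x + 2 * s * x * ?y' x - r1 * ?y x) (at x)" for x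
      using has_vector_derivative_diff[OF herm'_has_vector_derivative[of s r1 x] herm'_has_vector_derivative[of s r2 x]]
      by (rule has_vector_derivative_eq_rhs) (simp add: algebra_simps)
    show "norm (?F x) \<le> norm (r1 - r2) / Re s * exp (Re s * x\<^sup>2)" if "x \<in> {0..1}" for x
      using mult_left_mono[OF norm_herm_le[OF s r(2) that], of "norm (r1 - r2)"]
      by (simp add: norm_mult norm_minus_commute)
  qed (use assms in \<open>auto intro!: has_vector_derivative_diff herm_has_vector_derivative\<close>)
  then show ?thesis by (simp add: power2_eq_square)
qed

text \<open>The parameter varies with \<open>s\<close> because the lemma is applied to the iterates
  and to the fixed point of the Dirichlet condition. The partial sums are polynomials in
  \<open>s\<close> and \<open>f s\<close> and converge uniformly on closed discs.\<close>

lemma herm_holomorphic: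
  assumes S: "open S" and f: "f holomorphic_on S"
  shows "(\<lambda>s. herm s (f s) x) holomorphic_on S"
proof (rule holomorphic_uniform_sequence[OF S])
  have coef: "(\<lambda>s. herm_coeff s (f s) m) holomorphic_on S" for m
    by (induction m) (auto intro!: holomorphic_intros f)
  show "(\<lambda>s. \<Sum>i<n. herm_coeff s (f s) i * (x\<^sup>2) ^ i) holomorphic_on S" for n
    by (intro holomorphic_intros coef)
  fix s0 assume "s0 \<in> S"
  then obtain d where d: "d > 0" "cball s0 d \<subseteq> S"
    using S open_contains_cball by blast
  have "continuous_on (cball s0 d) (\<lambda>s. 1 + 2 * norm s + norm (f s))"
    using holomorphic_on_imp_continuous_on[OF f] d(2)
    by (intro continuous_intros) (auto intro: continuous_on_subset)
  from continuous_attains_sup[OF _ _ this] d obtain A where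
    A: "\<And>s. s \<in> cball s0 d \<Longrightarrow> 1 + 2 * norm s + norm (f s) \<le> A"
    by fastforce
  have "uniform_limit (cball s0 d) (\<lambda>n s. \<Sum>i<n. herm_coeff s (f s) i * (x\<^sup>2) ^ i)
          (\<lambda>s. herm s (f s) x) sequentially"
    unfolding herm_def herm_series_def
  proof (rule Weierstrass_m_test)
    show "summable (\<lambda>i. (A * norm (x\<^sup>2)) ^ i /\<^sub>R fact i)"
      by (rule summable_exp_generic)
    fix i s assume "s \<in> cball s0 d"
    from mult_right_mono[OF norm_herm_coeff_le[OF A[OF this], of i], of "norm (x\<^sup>2) ^ i"]
    show "norm (herm_coeff s (f s) i * (x\<^sup>2) ^ i) \<le> (A * norm (x\<^sup>2)) ^ i /\<^sub>R fact i"
      by (simp only: norm_mult norm_power power_mult_distrib scaleR_conv_of_real) (simp add: field_simps)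
  qed
  with d show "\<exists>d>0. cball s0 d \<subseteq> S \<and> uniform_limit (cball s0 d)
      (\<lambda>n s. \<Sum>i<n. herm_coeff s (f s) i * (x\<^sup>2) ^ i) (\<lambda>s. herm s (f s) x) sequentially"
    by blast
qed

section \<open>A lower bound for \<open>herm s 0 1\<close> in a sector\<close>

lemma norm_one_minus_exp_le:
  assumes "Re w \<ge> 0"
  shows "norm (1 - exp (- w)) \<le> norm w"
proof -
  have "norm (exp (- w) - exp (- 0)) \<le> 1 * norm (w - 0)"
  proof (rule field_differentiable_bound[where S = "{z. Re z \<ge> 0}"])
    show "((\<lambda>w. exp (- w)) has_field_derivative - exp (- z)) (at z within {z. 0 \<le> Re z})" for z :: complex
      by (auto intro!: derivative_eq_intros)
  qed (use assms in \<open>auto intro: convex_halfspace_Re_ge\<close>)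
  then show ?thesis by (simp add: norm_minus_commute)
qed

text \<open>
  Multiplying by \<open>2 s\<close> and integrating by parts turns \<open>exp (- s x\<^sup>2)\<close> into \<open>(1 - exp (- s x\<^sup>2)) / x\<^sup>2\<close>, whose real
  part is at least its value at \<open>Re s\<close>: this excludes cancellations in the Gaussian integral.
\<close>

lemma norm_weighted_herm'_ge:
  assumes \<sigma>: "Re s \<ge> 1"
  shows "norm (exp (- s) * herm' s 0 1) \<ge> (sqrt (Re s) - 1) / (4 * norm s)"
    and "x \<in> {0..1} \<Longrightarrow> norm (herm' s 0 (of_real x)) \<le> x * exp (Re s * x\<^sup>2)"
proof -
  define \<sigma> where "\<sigma> = Re s"
  have \<sigma>1: "\<sigma> \<ge> 1" using assms by (simp add: \<sigma>_def)
  have s0: "s \<noteq> 0" using assms by auto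
  define E where "E = (\<lambda>x::real. exp (- s * (of_real x)\<^sup>2) * herm' s 0 x)"
  have De: "((\<lambda>x::real. exp (- s * (of_real x)\<^sup>2)) has_vector_derivative
        exp (- s * (of_real x)\<^sup>2) * (- s * (2 * of_real x))) (at x)" for x
  proof -
    have "((\<lambda>z. exp (- s * z\<^sup>2)) has_field_derivative exp (- s * (of_real x)\<^sup>2) * (- s * (2 * of_real x)))
        (at (complex_of_real x))"
      by (auto intro!: derivative_eq_intros)
    then show ?thesis
      using has_vector_derivative_real_field[of "\<lambda>z. exp (- s * z\<^sup>2)"] by fastforce
  qed
  have E: "(E has_vector_derivative exp (- s * (of_real x)\<^sup>2)) (at x)" for x
    using has_vector_derivative_mult[OF De[of x] herm'_has_vector_derivative[of s 0 x]]
    by (simp add: E_def algebra_simps)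
  have norm_exp: "norm (exp (- s * (of_real x)\<^sup>2)) = exp (- (\<sigma> * x\<^sup>2))" for x :: real
    by (simp add: \<sigma>_def flip: of_real_power)
  have Ele: "norm (E x) \<le> x" if "0 \<le> x" for x
  proof (cases "x = 0")
    case False
    have "norm (E x - E 0) \<le> x - 0"
    proof (rule differentiable_bound_general)
      show "continuous_on {0..x} E"
        using E by (meson continuous_at_imp_continuous_on has_vector_derivative_continuous)
      show "((\<lambda>x. x) has_vector_derivative 1) (at u)" for u :: real
        by (auto intro!: derivative_eq_intros)
      show "norm (exp (- s * (of_real u)\<^sup>2)) \<le> 1" for u :: real
        unfolding norm_exp using \<sigma>1 by simp
    qed (use False that E in \<open>auto intro!: continuous_intros\<close>)
    then show ?thesis by (simp add: E_def)
  qed (simp add: E_def)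
  show "norm (herm' s 0 (of_real x)) \<le> x * exp (Re s * x\<^sup>2)" if "x \<in> {0..1}"
  proof -
    have "norm (E x) = exp (- (\<sigma> * x\<^sup>2)) * norm (herm' s 0 x)"
      unfolding E_def norm_mult norm_exp ..
    with Ele[of x] that show ?thesis by (simp add: exp_minus field_simps \<sigma>_def)
  qed
  \<comment> \<open>For \<open>x > 0\<close> the derivative of \<open>Q\<close> is
    \<open>(1 - Re (exp (- s x^2))) / x^2\<close>, which is nonnegative whatever the phase of the
    exponential.\<close>
  define Q where "Q = (\<lambda>x::real. Re (2 * s * E x - (1 - exp (- s * (of_real x)\<^sup>2)) / x))"
  have Q: "(Q has_real_derivative (1 - Re (exp (- s * (of_real x)\<^sup>2))) / x\<^sup>2) (at x)" if "x > 0" for x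
  proof -
    have 1: "((\<lambda>x::real. 1 - exp (- s * (of_real x)\<^sup>2)) has_vector_derivative
        0 - exp (- s * (of_real x)\<^sup>2) * (- s * (2 * of_real x))) (at x)"
      by (intro has_vector_derivative_diff De has_vector_derivative_const)
    have "((\<lambda>z. inverse z) has_field_derivative - (1 / (of_real x)\<^sup>2)) (at (complex_of_real x))"
      using that by (auto intro!: derivative_eq_intros simp: field_simps power2_eq_square)
    then have 2: "((\<lambda>x::real. inverse (complex_of_real x)) has_vector_derivative
        - (1 / (of_real x)\<^sup>2)) (at x)"
      by (rule has_vector_derivative_real_field)
    have "((\<lambda>x. 2 * s * E x - (1 - exp (- s * (of_real x)\<^sup>2)) / x) has_vector_derivative
        2 * s * exp (- s * (of_real x)\<^sup>2) - ((1 - exp (- s * (of_real x)\<^sup>2)) * (- (1 / (of_real x)\<^sup>2))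
          + (0 - exp (- s * (of_real x)\<^sup>2) * (- s * (2 * of_real x))) * inverse (of_real x))) (at x)"
      unfolding divide_inverse[of "1 - _"]
      by (intro has_vector_derivative_diff has_vector_derivative_mult_right E has_vector_derivative_mult 1 2)
    also have "2 * s * exp (- s * (of_real x)\<^sup>2) - ((1 - exp (- s * (of_real x)\<^sup>2)) * (- (1 / (of_real x)\<^sup>2))
          + (0 - exp (- s * (of_real x)\<^sup>2) * (- s * (2 * of_real x))) * inverse (of_real x)) = (1 - exp (- s * (of_real x)\<^sup>2)) / of_real (x\<^sup>2)"
      using that by (simp add: field_simps power2_eq_square)
    finally have "(Q has_vector_derivative Re ((1 - exp (- s * (of_real x)\<^sup>2)) / of_real (x\<^sup>2))) (at x)"
      unfolding Q_def by (rule bounded_linear.has_vector_derivative[OF bounded_linear_Re])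
    then show ?thesis
      by (simp only: has_real_derivative_iff_has_vector_derivative[symmetric] Re_divide_of_real) simp
  qed
  have Re_le: "Re (exp (- s * (of_real x)\<^sup>2)) \<le> exp (- (\<sigma> * x\<^sup>2))" for x :: real
    using complex_Re_le_cmod[of "exp (- s * (of_real x)\<^sup>2)"] unfolding norm_exp .
  \<comment> \<open>The width of the Gaussian: beyond it
    \<open>exp (- \<sigma> x^2) \<le> exp (- 1) \<le> 1 / 2\<close>, so \<open>Q\<close> grows at
    least as fast as the integral of \<open>1 / (2 x^2)\<close>. This yields the gain
    \<open>(sqrt \<sigma> - 1) / 2\<close>.\<close>
  define \<eta> where "\<eta> = 1 / sqrt \<sigma>"
  have \<eta>: "0 < \<eta>" "\<eta> \<le> 1" "\<sigma> * \<eta>\<^sup>2 = 1"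
    using \<sigma>1 by (auto simp: \<eta>_def power_divide)
  \<comment> \<open>The derivative of \<open>Q\<close> is available for positive arguments only.
    Monotonicity is therefore started at a small \<open>\<zeta>\<close>, where \<open>Q\<close> is
    at most \<open>3 * norm s * \<zeta> \<le> e\<close> in absolute value.\<close>
  have "Q \<eta> \<ge> - e" if e: "e > 0" for e
  proof -
    define \<zeta> where "\<zeta> = min \<eta> (e / (3 * norm s))"
    have \<zeta>: "0 < \<zeta>" "\<zeta> \<le> \<eta>" "3 * norm s * \<zeta> \<le> e"
      using \<eta> e s0 by (auto simp: \<zeta>_def min_def field_simps)
    have "Q \<zeta> \<le> Q \<eta>"
    proof (rule DERIV_nonneg_imp_nondecreasing[OF \<zeta>(2)])
      fix x assume x: "\<zeta> \<le> x" "x \<le> \<eta>"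
      have "Re (exp (- s * (of_real x)\<^sup>2)) \<le> 1" using Re_le[of x] \<sigma>1 by (smt (verit) one_le_exp_iff exp_le_one_iff mult_nonneg_nonneg zero_le_power2)
      then show "\<exists>y. (Q has_real_derivative y) (at x) \<and> 0 \<le> y"
        using Q[of x] x \<zeta> by (intro exI[of _ "(1 - Re (exp (- s * (of_real x)\<^sup>2))) / x\<^sup>2"]) auto
    qed
    moreover have "norm (2 * s * E \<zeta> - (1 - exp (- s * (of_real \<zeta>)\<^sup>2)) / \<zeta>) \<le> 3 * norm s * \<zeta>"
    proof -
      have "norm (1 - exp (- (s * (of_real \<zeta>)\<^sup>2))) \<le> norm (s * (of_real \<zeta>)\<^sup>2)"
        using \<sigma>1 by (intro norm_one_minus_exp_le) (simp add: \<sigma>_def flip: of_real_power)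
      then have "norm ((1 - exp (- s * (of_real \<zeta>)\<^sup>2)) / \<zeta>) \<le> norm s * \<zeta>"
        using \<zeta> by (simp add: norm_divide norm_mult norm_power divide_simps power2_eq_square mult_ac)
      moreover have "norm (2 * s * E \<zeta>) \<le> 2 * norm s * \<zeta>"
        using Ele[of \<zeta>] \<zeta> by (simp add: norm_mult mult_left_mono)
      ultimately show ?thesis
        using norm_triangle_ineq4[of "2 * s * E \<zeta>" "(1 - exp (- s * (of_real \<zeta>)\<^sup>2)) / \<zeta>"] by linarith
    qed
    then have "\<bar>Q \<zeta>\<bar> \<le> 3 * norm s * \<zeta>"
      unfolding Q_def using abs_Re_le_cmod order_trans by blast
    ultimately show ?thesis using \<zeta> by linarith
  qed
  then have Q\<eta>: "Q \<eta> \<ge> 0" by (metis field_le_epsilon add.commute diff_0 diff_le_eq)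
  have "Q \<eta> + 1 / (2 * \<eta>) \<le> Q 1 + 1 / (2 * 1)"
  proof (rule DERIV_nonneg_imp_nondecreasing[OF \<eta>(2)])
    fix x assume x: "\<eta> \<le> x" "x \<le> 1"
    have "\<sigma> * \<eta>\<^sup>2 \<le> \<sigma> * x\<^sup>2"
      using x \<eta>(1) \<sigma>1 by (intro mult_left_mono power_mono) auto
    then have "\<sigma> * x\<^sup>2 \<ge> 1" using \<eta>(3) by simp
    then have "exp (- (\<sigma> * x\<^sup>2)) \<le> exp (- 1)" by simp
    also have "exp (- 1 :: real) \<le> 1 / 2"
      using exp_ge_add_one_self[of 1] by (simp add: exp_minus field_simps)
    finally have "Re (exp (- s * (of_real x)\<^sup>2)) \<le> 1 / 2" using Re_le[of x] by linarith
    then have nn: "0 \<le> (1 / 2 - Re (exp (- s * (of_real x)\<^sup>2))) / x\<^sup>2" by simp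
    have "((\<lambda>x. Q x + 1 / (2 * x)) has_real_derivative
        (1 - Re (exp (- s * (of_real x)\<^sup>2))) / x\<^sup>2 + - (1 / (2 * x\<^sup>2))) (at x)"
      using x \<eta> by (intro DERIV_add Q) (auto intro!: derivative_eq_intros simp: field_simps power2_eq_square)
    moreover have "(1 - Re (exp (- s * (of_real x)\<^sup>2))) / x\<^sup>2 + - (1 / (2 * x\<^sup>2)) = (1 / 2 - Re (exp (- s * (of_real x)\<^sup>2))) / x\<^sup>2"
      using x \<eta> by (simp add: field_simps)
    ultimately show "\<exists>y. ((\<lambda>x. Q x + 1 / (2 * x)) has_real_derivative y) (at x) \<and> 0 \<le> y"
      using nn by auto
  qed
  then have "(sqrt \<sigma> - 1) / 2 \<le> Q 1"
    using Q\<eta> \<sigma>1 by (simp add: \<eta>_def field_simps)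
  also have "Q 1 \<le> Re (2 * s * E 1)"
    using Re_le[of 1] \<sigma>1 by (simp add: Q_def) (smt (verit) exp_le_one_iff)
  also have "\<dots> \<le> 2 * norm s * norm (E 1)"
    using complex_Re_le_cmod[of "2 * s * E 1"] by (simp add: norm_mult)
  finally show "norm (exp (- s) * herm' s 0 1) \<ge> (sqrt (Re s) - 1) / (4 * norm s)"
    using s0 by (simp add: E_def \<sigma>_def field_simps)
qed

text \<open>
  Since \<open>y'' - 2 s x y' = 1\<close>, the function \<open>y - y' / (2 s x)\<close> varies little on \<open>[1/2, 1]\<close>, so that the bound on
  \<open>y' 1\<close> carries over to \<open>y 1\<close>.
\<close>

lemma norm_herm_ge:
  assumes \<sigma>: "Re s \<ge> 1" and K: "norm s \<le> K * Re s"
  shows "norm (herm s 0 1) \<ge> exp (Re s) * (sqrt (Re s) - 1) / (8 * K\<^sup>2 * (Re s)\<^sup>2)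
    - (1 / (2 * Re s) + exp (Re s) / (Re s)\<^sup>2 + exp (Re s / 4) / Re s + exp (Re s / 4) / (2 * Re s))"
proof -
  define \<sigma> where "\<sigma> = Re s"
  have \<sigma>1: "\<sigma> \<ge> 1" using assms by (simp add: \<sigma>_def)
  have s\<sigma>: "norm s \<ge> \<sigma>" using complex_Re_le_cmod[of s] by (simp add: \<sigma>_def)
  have s0: "s \<noteq> 0" using assms by auto
  define H where "H = (\<lambda>x::real. herm s 0 x - herm' s 0 x * inverse (2 * s * x))"
  define H' where "H' = (\<lambda>x::real. herm' s 0 x / (2 * s * x\<^sup>2) - 1 / (2 * s * x))"
  have H: "(H has_vector_derivative H' x) (at x)" if "x > 0" for x
  proof -
    let ?g = "herm' s 0 (of_real x)"
    have "((\<lambda>z. herm s 0 z - herm' s 0 z * inverse (2 * s * z)) has_field_derivative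
        ?g - ((1 + 2 * s * x * ?g - 0 * herm s 0 x) * inverse (2 * s * x)
          + - (inverse (2 * s * x) * (2 * s) * inverse (2 * s * x)) * ?g)) (at (complex_of_real x))"
      using that s0
      by (intro DERIV_diff DERIV_mult herm_has_field_derivative herm'_has_field_derivative DERIV_inverse')
        (auto intro!: derivative_eq_intros)
    also have "?g - ((1 + 2 * s * x * ?g - 0 * herm s 0 x) * inverse (2 * s * x)
          + - (inverse (2 * s * x) * (2 * s) * inverse (2 * s * x)) * ?g) = H' x"
      using that s0 by (simp add: H'_def field_simps power2_eq_square)
    finally show ?thesis unfolding H_def by (rule has_vector_derivative_real_field)
  qed
  let ?\<phi> = "\<lambda>x. x / norm s + exp (\<sigma> * x\<^sup>2) / (\<sigma> * norm s)"
  have "norm (H 1 - H (1 / 2)) \<le> ?\<phi> 1 - ?\<phi> (1 / 2)"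
  proof (rule differentiable_bound_general)
    show "continuous_on {1 / 2..1} H"
      using H by (intro continuous_at_imp_continuous_on)
        (meson H atLeastAtMost_iff has_vector_derivative_continuous less_le_trans zero_less_divide_1_iff zero_less_numeral)
    show "continuous_on {1 / 2..1} ?\<phi>"
      using \<sigma>1 s0 by (intro continuous_intros) auto
    fix x :: real assume x: "1 / 2 < x" "x < 1"
    show "(H has_vector_derivative H' x) (at x)" using x by (intro H) simp
    show "(?\<phi> has_vector_derivative 1 / norm s + 2 * x * exp (\<sigma> * x\<^sup>2) / norm s) (at x)"
      using \<sigma>1 s0 by (auto intro!: derivative_eq_intros
          simp: has_real_derivative_iff_has_vector_derivative[symmetric] field_simps)
    have "norm (H' x) \<le> norm (herm' s 0 x) / (2 * norm s * x\<^sup>2) + 1 / (2 * norm s * x)"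
      unfolding H'_def using x
      by (intro order_trans[OF norm_triangle_ineq4]) (auto simp: norm_divide norm_mult norm_power)
    also have "\<dots> \<le> x * exp (\<sigma> * x\<^sup>2) / (2 * norm s * x\<^sup>2) + 1 / (2 * norm s * x)"
      using norm_weighted_herm'_ge(2)[OF \<sigma>, of x] x
      by (intro add_right_mono divide_right_mono) (auto simp: \<sigma>_def)
    also have "\<dots> = (exp (\<sigma> * x\<^sup>2) / norm s) * (1 / (2 * x)) + (1 / norm s) * (1 / (2 * x))"
      using x by (simp add: field_simps power2_eq_square)
    \<comment> \<open>On \<open>[1/2, 1]\<close> both \<open>1 / (2 * x) \<le> 2 * x\<close> and
      \<open>1 / (2 * x) \<le> 1\<close> hold; after these replacements the bound is exactly the
      derivative of \<open>?\<phi>\<close>.\<close>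
    also have "\<dots> \<le> (exp (\<sigma> * x\<^sup>2) / norm s) * (2 * x) + (1 / norm s) * 1"
    proof (intro add_mono mult_left_mono)
      have "1 / 2 * (1 / 2) \<le> x * x" using x by (intro mult_mono) auto
      then show "1 / (2 * x) \<le> 2 * x" using x by (simp add: field_simps)
    qed (use x in \<open>auto simp: field_simps\<close>)
    finally show "norm (H' x) \<le> 1 / norm s + 2 * x * exp (\<sigma> * x\<^sup>2) / norm s" by (simp add: mult_ac)
  qed simp
  also have "\<dots> \<le> 1 / (2 * norm s) + exp \<sigma> / (\<sigma> * norm s)"
    using \<sigma>1 s0 by (simp add: field_simps)
  also have "\<dots> \<le> 1 / (2 * \<sigma>) + exp \<sigma> / \<sigma>\<^sup>2"
    using s\<sigma> \<sigma>1 unfolding power2_eq_square by (intro add_mono divide_left_mono mult_mono mult_pos_pos) auto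
  finally have 1: "norm (H 1 - H (1 / 2)) \<le> 1 / (2 * \<sigma>) + exp \<sigma> / \<sigma>\<^sup>2" .
  have "norm (H (1 / 2)) \<le> norm (herm s 0 (of_real (1 / 2))) + norm (herm' s 0 (of_real (1 / 2))) / norm s"
    unfolding H_def by (intro order_trans[OF norm_triangle_ineq4]) (auto simp: norm_divide norm_mult field_simps)
  also have "\<dots> \<le> exp (Re s * (1 / 2)\<^sup>2) / Re s + ((1 / 2) * exp (Re s * (1 / 2)\<^sup>2)) / norm s"
    using \<sigma> by (intro add_mono norm_herm_le divide_right_mono norm_weighted_herm'_ge(2)) auto
  also have "\<dots> = exp (\<sigma> / 4) / \<sigma> + exp (\<sigma> / 4) / (2 * norm s)"
    by (simp add: \<sigma>_def power2_eq_square)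
  also have "\<dots> \<le> exp (\<sigma> / 4) / \<sigma> + exp (\<sigma> / 4) / (2 * \<sigma>)"
    using s\<sigma> \<sigma>1 by (intro add_mono divide_left_mono mult_pos_pos) auto
  finally have 2: "norm (H (1 / 2)) \<le> exp (\<sigma> / 4) / \<sigma> + exp (\<sigma> / 4) / (2 * \<sigma>)" .
  have "(sqrt \<sigma> - 1) / (4 * norm s) \<le> exp (- \<sigma>) * norm (herm' s 0 1)"
    using norm_weighted_herm'_ge(1)[OF \<sigma>] by (simp add: norm_mult \<sigma>_def)
  then have "exp \<sigma> * (sqrt \<sigma> - 1) / (4 * norm s) / (2 * norm s) \<le> norm (herm' s 0 1) / (2 * norm s)"
    using s0 by (intro divide_right_mono) (auto simp: exp_minus field_simps)
  moreover have "exp \<sigma> * (sqrt \<sigma> - 1) / (8 * K\<^sup>2 * \<sigma>\<^sup>2) \<le> exp \<sigma> * (sqrt \<sigma> - 1) / (4 * norm s) / (2 * norm s)"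
  proof -
    have "norm s * norm s \<le> (K * \<sigma>) * (K * \<sigma>)"
      using K s\<sigma> \<sigma>1 by (intro mult_mono) (auto simp: \<sigma>_def)
    moreover have "K > 0"
      using K s\<sigma> \<sigma>1 by (metis \<sigma>_def less_le_trans mult_nonpos_nonneg not_le order_trans zero_le_one zero_less_one)
    ultimately have "exp \<sigma> * (sqrt \<sigma> - 1) / (8 * ((K * \<sigma>) * (K * \<sigma>))) \<le> exp \<sigma> * (sqrt \<sigma> - 1) / (8 * (norm s * norm s))"
      using \<sigma>1 s0 K by (intro divide_left_mono mult_pos_pos mult_nonneg_nonneg) (auto simp: \<sigma>_def)
    then show ?thesis by (simp add: power2_eq_square mult_ac)
  qed
  ultimately have 3: "norm (herm' s 0 1) / (2 * norm s) \<ge> exp \<sigma> * (sqrt \<sigma> - 1) / (8 * K\<^sup>2 * \<sigma>\<^sup>2)" by linarith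
  have "herm' s 0 1 / (2 * s) = herm s 0 1 - (H 1 - H (1 / 2)) - H (1 / 2)"
    by (simp add: H_def field_simps)
  then have "norm (herm' s 0 1) / (2 * norm s) = norm (herm s 0 1 - (H 1 - H (1 / 2)) - H (1 / 2))"
    by (metis norm_divide norm_mult norm_numeral)
  also have "\<dots> \<le> norm (herm s 0 1) + norm (H 1 - H (1 / 2)) + norm (H (1 / 2))"
    by (meson norm_triangle_ineq4 norm_triangle_le_diff order_trans add_right_mono)
  finally show ?thesis using 1 2 3 unfolding \<sigma>_def by linarith
qed

text \<open>The main term is of order \<open>exp \<sigma> / \<sigma> powr (3/2)\<close> with a
  constant depending on \<open>K\<close>, and the largest error is
  \<open>exp \<sigma> / \<sigma>^2\<close>. The factor \<open>sqrt \<sigma>\<close> between them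
  beats every constant, however wide the sector.\<close>

lemma eventually_norm_herm_ge:
  assumes "K > 0"
  shows "\<forall>\<^sub>F \<sigma> in at_top. \<forall>s. Re s = \<sigma> \<and> norm s \<le> K * \<sigma> \<longrightarrow> norm (herm s 0 1) \<ge> exp \<sigma> / \<sigma>\<^sup>2"
proof -
  have "\<forall>\<^sub>F \<sigma>::real in at_top. exp \<sigma> / \<sigma>\<^sup>2 \<le> exp \<sigma> * (sqrt \<sigma> - 1) / (8 * K\<^sup>2 * \<sigma>\<^sup>2)
    - (1 / (2 * \<sigma>) + exp \<sigma> / \<sigma>\<^sup>2 + exp (\<sigma> / 4) / \<sigma> + exp (\<sigma> / 4) / (2 * \<sigma>))"
    using assms by real_asymp
  with eventually_ge_at_top[of 1] show ?thesis
    by eventually_elim (use norm_herm_ge in fastforce)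
qed

text \<open>
  For large \<open>Re s\<close> the map \<open>r \<mapsto> 1 / herm s r 1\<close> is a contraction near \<open>0\<close>; its iterates are holomorphic in \<open>s\<close>
  and converge uniformly, so the fixed point is holomorphic too.
\<close>

lemma dirichlet_parameter:
  assumes K: "K > 0"
  obtains \<sigma>0 \<rho> where "\<sigma>0 \<ge> 1"
    and "\<And>\<sigma>. \<sigma> > \<sigma>0 \<Longrightarrow> 8 * \<sigma>\<^sup>2 \<le> exp \<sigma>"
    and "\<rho> holomorphic_on {s. Re s > \<sigma>0 \<and> norm s < K * Re s}"
    and "\<And>s. Re s > \<sigma>0 \<Longrightarrow> norm s < K * Re s \<Longrightarrow> norm (\<rho> s) \<le> 2 * (Re s)\<^sup>2 * exp (- Re s)"
    and "\<And>s. Re s > \<sigma>0 \<Longrightarrow> norm s < K * Re s \<Longrightarrow> \<rho> s * herm s (\<rho> s) 1 = 1"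
proof -
  have "\<forall>\<^sub>F \<sigma>::real in at_top. 8 \<le> exp \<sigma> / \<sigma>\<^sup>2" by real_asymp
  with eventually_norm_herm_ge[OF K] eventually_ge_at_top[of "1::real"]
  have "\<forall>\<^sub>F \<sigma> in at_top. \<sigma> \<ge> 1 \<and> 8 \<le> exp \<sigma> / \<sigma>\<^sup>2 \<and>
      (\<forall>s. Re s = \<sigma> \<and> norm s \<le> K * \<sigma> \<longrightarrow> norm (herm s 0 1) \<ge> exp \<sigma> / \<sigma>\<^sup>2)"
    by eventually_elim auto
  then obtain \<sigma>0 where \<sigma>0: "\<And>\<sigma>. \<sigma> \<ge> \<sigma>0 \<Longrightarrow> \<sigma> \<ge> 1 \<and> 8 \<le> exp \<sigma> / \<sigma>\<^sup>2 \<and>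
      (\<forall>s. Re s = \<sigma> \<and> norm s \<le> K * \<sigma> \<longrightarrow> norm (herm s 0 1) \<ge> exp \<sigma> / \<sigma>\<^sup>2)"
    unfolding eventually_at_top_linorder by blast
  define D where "D = {s. Re s > \<sigma>0 \<and> norm s < K * Re s}"
  define \<gamma> where "\<gamma> = (\<lambda>s::complex. exp (Re s) / (Re s)\<^sup>2)"
  \<comment> \<open>The lower bound \<open>8\<close> for \<open>\<gamma>\<close> serves three
    purposes: the disc of radius \<open>2 / \<gamma> s\<close> lies in
    \<open>norm r \<le> Re s\<close>; one has \<open>\<gamma> s - 2 \<ge> \<gamma> s / 2\<close>;
    and the Lipschitz constant \<open>4 / \<gamma> s\<close> of the iteration is at most
    \<open>1 / 2\<close>.\<close>
  have D: "Re s \<ge> 1" "8 \<le> \<gamma> s" "norm (herm s 0 1) \<ge> \<gamma> s" if "s \<in> D" for s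
    using \<sigma>0[of "Re s"] that by (auto simp: D_def \<gamma>_def)
  have "open D"
    unfolding D_def by (intro open_Collect_conj open_Collect_less continuous_intros)
  have herm_ge: "norm (herm s r 1) \<ge> \<gamma> s / 2" if s: "s \<in> D" and r: "norm r \<le> 2 / \<gamma> s" for s r
  proof -
    have "2 / \<gamma> s \<le> 2 / 8" using D[OF s] by (intro divide_left_mono) auto
    then have "norm r \<le> Re s" using r D[OF s] by linarith
    then have "norm (herm s r (of_real 1) - herm s 0 (of_real 1)) \<le> norm (r - 0) / (Re s)\<^sup>2 * exp (Re s * 1\<^sup>2)"
      using D[OF s] by (intro norm_herm_diff_le) auto
    also have "\<dots> = norm r * \<gamma> s" by (simp add: \<gamma>_def)
    also have "\<dots> \<le> 2" using r D[OF s] by (simp add: field_simps)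
    finally have "norm (herm s 0 1) - norm (herm s r 1) \<le> 2"
      using norm_triangle_ineq2[of "herm s 0 1" "herm s r 1"] by (simp add: norm_minus_commute)
    with D[OF s] show ?thesis by linarith
  qed
  have lip: "norm (1 / herm s r1 1 - 1 / herm s r2 1) \<le> norm (r1 - r2) / 2"
    if s: "s \<in> D" and r: "norm r1 \<le> 2 / \<gamma> s" "norm r2 \<le> 2 / \<gamma> s" for s r1 r2
  proof -
    have "2 / \<gamma> s \<le> 2 / 8" using D[OF s] by (intro divide_left_mono) auto
    then have r': "norm r1 \<le> Re s" "norm r2 \<le> Re s" using r D[OF s] by linarith+
    then have 1: "norm (herm s r1 (of_real 1) - herm s r2 (of_real 1)) \<le> norm (r1 - r2) / (Re s)\<^sup>2 * exp (Re s * 1\<^sup>2)"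
      using D[OF s] by (intro norm_herm_diff_le) auto
    have herm: "norm (herm s r1 1) \<ge> \<gamma> s / 2" "norm (herm s r2 1) \<ge> \<gamma> s / 2" using herm_ge[OF s] r by auto
    then have "herm s r1 1 \<noteq> 0" "herm s r2 1 \<noteq> 0" using D[OF s] by auto
    then have "norm (1 / herm s r1 1 - 1 / herm s r2 1) = norm (herm s r1 1 - herm s r2 1) / (norm (herm s r1 1) * norm (herm s r2 1))"
      by (subst diff_frac_eq, simp, simp, simp only: mult_1 mult_1_right norm_divide norm_mult norm_minus_commute[of "herm s r2 1"])
    also have "\<dots> \<le> (norm (r1 - r2) * \<gamma> s) / ((\<gamma> s / 2) * (\<gamma> s / 2))"
      using 1 herm D[OF s] by (intro frac_le mult_mono) (auto simp: \<gamma>_def)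
    also have "\<dots> = norm (r1 - r2) * (4 / \<gamma> s)" using D[OF s] by (simp add: field_simps)
    also have "\<dots> \<le> norm (r1 - r2) * (1 / 2)"
      using D[OF s] by (intro mult_left_mono) (auto simp: field_simps)
    finally show ?thesis by simp
  qed
  define p where "p = rec_nat (\<lambda>_. 0) (\<lambda>_ q s. 1 / herm s (q s) 1)"
  have p_0: "p 0 = (\<lambda>_. 0)" and p_Suc: "p (Suc n) s = 1 / herm s (p n s) 1" for n s
    by (simp_all add: p_def)
  have p_le: "norm (p n s) \<le> 2 / \<gamma> s" if s: "s \<in> D" for n s
  proof (induction n)
    case (Suc n)
    have "norm (p (Suc n) s) \<le> 1 / (\<gamma> s / 2)"
      unfolding p_Suc norm_divide using herm_ge[OF s Suc] D[OF s] by (intro frac_le) auto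
    then show ?case by simp
  qed (use D[OF s] in \<open>simp add: p_0\<close>)
  have p_diff: "norm (p (Suc n) s - p n s) \<le> (1 / 2) ^ n" if s: "s \<in> D" for n s
  proof (induction n)
    case 0
    have "2 / \<gamma> s \<le> 2 / 8" using D[OF s] by (intro divide_left_mono) auto
    with p_le[OF s, of "Suc 0"] show ?case by (simp add: p_0)
  next
    case (Suc n)
    show ?case
      using lip[OF s p_le[OF s, of "Suc n"] p_le[OF s, of n]] Suc unfolding p_Suc by simp
  qed
  \<comment> \<open>Since the iteration starts at \<open>0\<close>, the partial sums of this
    telescoping series are the iterates, and the geometric bound makes the convergence uniform on
    all of \<open>D\<close>.\<close>
  define \<rho> where "\<rho> = (\<lambda>s. \<Sum>n. p (Suc n) s - p n s)"
  have "uniform_limit D (\<lambda>n s. \<Sum>i<n. p (Suc i) s - p i s) \<rho> sequentially"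
    unfolding \<rho>_def using p_diff by (intro Weierstrass_m_test[where M = "\<lambda>n. (1 / 2) ^ n"]) auto
  moreover have "(\<Sum>i<n. p (Suc i) s - p i s) = p n s" for n s
    using sum_lessThan_telescope[of "\<lambda>i. p i s" n] by (simp add: p_0)
  ultimately have lim: "uniform_limit D p \<rho> sequentially" by simp
  have hol_p: "p n holomorphic_on D" for n
  proof (induction n)
    case (Suc n)
    have "herm s (p n s) 1 \<noteq> 0" if "s \<in> D" for s
      using herm_ge[OF that p_le[OF that, of n]] D[OF that] by auto
    then have "(\<lambda>s. 1 / herm s (p n s) 1) holomorphic_on D"
      by (intro holomorphic_intros herm_holomorphic[OF \<open>open D\<close> Suc]) auto
    then show ?case by (simp add: p_def)
  qed (simp add: p_0)
  have hol: "\<rho> holomorphic_on D"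
  proof (rule holomorphic_uniform_sequence[OF \<open>open D\<close> hol_p])
    fix s assume "s \<in> D"
    then obtain d where "d > 0" "cball s d \<subseteq> D"
      using \<open>open D\<close> open_contains_cball by blast
    with lim show "\<exists>d>0. cball s d \<subseteq> D \<and> uniform_limit (cball s d) p \<rho> sequentially"
      using uniform_limit_on_subset by blast
  qed
  have tendsto: "(\<lambda>n. p n s) \<longlonglongrightarrow> \<rho> s" if "s \<in> D" for s
    using tendsto_uniform_limitI[OF lim that] .
  have \<rho>_le: "norm (\<rho> s) \<le> 2 / \<gamma> s" if s: "s \<in> D" for s
    using p_le[OF s] by (intro Lim_norm_ubound[OF _ tendsto[OF s]]) auto
  have root: "\<rho> s * herm s (\<rho> s) 1 = 1" if s: "s \<in> D" for s
  proof -
    have "norm (1 / herm s (p n s) 1 - 1 / herm s (\<rho> s) 1) \<le> norm (p n s - \<rho> s) / 2" for n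
      by (rule lip[OF s p_le[OF s] \<rho>_le[OF s]])
    then have "\<forall>\<^sub>F n in sequentially.
        norm (1 / herm s (p n s) 1 - 1 / herm s (\<rho> s) 1) \<le> norm (p n s - \<rho> s) / 2"
      by (intro always_eventually allI)
    moreover have "(\<lambda>n. norm (p n s - \<rho> s) / 2) \<longlonglongrightarrow> 0"
      using tendsto[OF s] by (auto intro!: tendsto_eq_intros)
    ultimately have "(\<lambda>n. 1 / herm s (p n s) 1 - 1 / herm s (\<rho> s) 1) \<longlonglongrightarrow> 0"
      by (rule Lim_null_comparison)
    then have "(\<lambda>n. p (Suc n) s) \<longlonglongrightarrow> 1 / herm s (\<rho> s) 1"
      unfolding p_Suc using LIM_zero_iff by blast
    moreover have "(\<lambda>n. p (Suc n) s) \<longlonglongrightarrow> \<rho> s"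
      using tendsto[OF s] LIMSEQ_Suc by blast
    ultimately have "\<rho> s = 1 / herm s (\<rho> s) 1" using LIMSEQ_unique by blast
    moreover have "herm s (\<rho> s) 1 \<noteq> 0" using herm_ge[OF s \<rho>_le[OF s]] D[OF s] by auto
    ultimately show ?thesis by (simp add: field_simps)
  qed
  show ?thesis
  proof (rule that)
    show "max \<sigma>0 1 \<ge> 1" by simp
    show "8 * \<sigma>\<^sup>2 \<le> exp \<sigma>" if "\<sigma> > max \<sigma>0 1" for \<sigma>
      using \<sigma>0[of \<sigma>] that by (auto simp: field_simps)
    show "\<rho> holomorphic_on {s. max \<sigma>0 1 < Re s \<and> norm s < K * Re s}"
      using hol by (rule holomorphic_on_subset) (auto simp: D_def)
    fix s assume s: "max \<sigma>0 1 < Re s" "norm s < K * Re s"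
    then have "s \<in> D" by (auto simp: D_def)
    from \<rho>_le[OF this] show "norm (\<rho> s) \<le> 2 * (Re s)\<^sup>2 * exp (- Re s)"
      by (simp add: \<gamma>_def exp_minus field_simps)
    from root[OF \<open>s \<in> D\<close>] show "\<rho> s * herm s (\<rho> s) 1 = 1" .
  qed
qed

section \<open>Eigenfunctions and their distance from the Gaussian\<close>

definition mode :: "complex \<Rightarrow> complex \<Rightarrow> complex \<Rightarrow> complex" where
  "mode s r x = exp (- s * x\<^sup>2 / 2) * (1 - r * herm s r x)"

definition mode' :: "complex \<Rightarrow> complex \<Rightarrow> complex \<Rightarrow> complex" where
  "mode' s r x = exp (- s * x\<^sup>2 / 2) * (- s * x * (1 - r * herm s r x) - r * herm' s r x)"

lemma mode_has_field_derivative: "(mode s r has_field_derivative mode' s r x) (at x)"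
  unfolding mode_def[abs_def]
  by (rule derivative_eq_intros herm_has_field_derivative refl | simp)+
    (simp add: mode'_def algebra_simps)

lemma mode'_has_field_derivative:
  "(mode' s r has_field_derivative (s\<^sup>2 * x\<^sup>2 - (s + r)) * mode s r x) (at x)"
  unfolding mode'_def[abs_def]
  by (rule derivative_eq_intros herm_has_field_derivative herm'_has_field_derivative refl | simp)+
    (simp add: mode_def algebra_simps power2_eq_square)

lemma mode_1: "r * herm s r 1 = 1 \<Longrightarrow> mode s r 1 = 0"
  by (simp add: mode_def)

lemma mode_minus [simp]: "mode s r (- x) = mode s r x"
  by (simp add: mode_def)

text \<open>In \<open>mode\<close> the correction \<open>r * herm s r x\<close> is multiplied by a
  Gaussian of modulus \<open>exp (- Re s * x^2 / 2)\<close>. The bounds for \<open>r\<close> and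
  \<open>herm\<close> leave \<open>2 * Re s * exp (- Re s + Re s * x^2 / 2)\<close>, which is
  largest at the ends of the interval and still exponentially small there. The constant
  \<open>3\<close> is \<open>1\<close> for the Gaussian plus \<open>2\<close> for the
  correction.\<close>

lemma norm_mode_le:
  fixes x :: real
  assumes s: "Re s \<ge> 1" "8 * (Re s)\<^sup>2 \<le> exp (Re s)"
    and r: "norm r \<le> 2 * (Re s)\<^sup>2 * exp (- Re s)" and x: "\<bar>x\<bar> \<le> 1"
  shows "norm r \<le> 1"
    and "norm (mode s r x - exp (- s * (of_real x)\<^sup>2 / 2)) \<le> 2 * Re s * exp (- Re s / 2)"
    and "norm (mode s r x) \<le> 3"
proof -
  define \<sigma> where "\<sigma> = Re s"
  have "2 * \<sigma>\<^sup>2 * exp (- \<sigma>) \<le> 1"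
  proof -
    have "2 * \<sigma>\<^sup>2 \<le> exp \<sigma>" using s(2) zero_le_power2[of "Re s"] unfolding \<sigma>_def by linarith
    then show ?thesis by (simp add: exp_minus field_simps)
  qed
  with r show r1: "norm r \<le> 1" by (simp add: \<sigma>_def)
  have "herm s r x = herm s r \<bar>x\<bar>" by (cases "x \<ge> 0") auto
  moreover have "norm (herm s r (of_real \<bar>x\<bar>)) \<le> exp (Re s * \<bar>x\<bar>\<^sup>2) / Re s"
    using s r1 x by (intro norm_herm_le) auto
  ultimately have "norm (r * herm s r x) \<le> 2 * \<sigma>\<^sup>2 * exp (- \<sigma>) * (exp (\<sigma> * x\<^sup>2) / \<sigma>)"
    unfolding norm_mult using r by (intro mult_mono) (auto simp: \<sigma>_def)
  then have "exp (- \<sigma> * x\<^sup>2 / 2) * norm (r * herm s r x)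
      \<le> exp (- \<sigma> * x\<^sup>2 / 2) * (2 * \<sigma>\<^sup>2 * exp (- \<sigma>) * (exp (\<sigma> * x\<^sup>2) / \<sigma>))"
    by (intro mult_left_mono) auto
  also have "\<dots> = 2 * \<sigma> * exp (- \<sigma> + \<sigma> * x\<^sup>2 / 2)"
    using s by (simp add: \<sigma>_def power2_eq_square field_simps flip: exp_add)
  also have "\<dots> \<le> 2 * \<sigma> * exp (- \<sigma> / 2)"
  proof -
    have "\<sigma> * x\<^sup>2 \<le> \<sigma> * 1" using x s by (intro mult_left_mono) (auto simp: \<sigma>_def abs_square_le_1)
    then have "- \<sigma> + \<sigma> * x\<^sup>2 / 2 \<le> - \<sigma> / 2" by linarith
    then show ?thesis using s unfolding \<sigma>_def by (intro mult_left_mono) auto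
  qed
  finally have 1: "exp (- \<sigma> * x\<^sup>2 / 2) * norm (r * herm s r x) \<le> 2 * \<sigma> * exp (- \<sigma> / 2)" .
  have norm_exp: "norm (exp (- s * (of_real x)\<^sup>2 / 2)) = exp (- \<sigma> * x\<^sup>2 / 2)"
    by (simp add: \<sigma>_def flip: of_real_power)
  have "mode s r x - exp (- s * (of_real x)\<^sup>2 / 2) = - (exp (- s * (of_real x)\<^sup>2 / 2) * (r * herm s r x))"
    by (simp add: mode_def algebra_simps)
  then have "norm (mode s r x - exp (- s * (of_real x)\<^sup>2 / 2)) = exp (- \<sigma> * x\<^sup>2 / 2) * norm (r * herm s r x)"
    by (simp only: norm_minus_cancel norm_mult norm_exp)
  with 1 show 2: "norm (mode s r x - exp (- s * (of_real x)\<^sup>2 / 2)) \<le> 2 * Re s * exp (- Re s / 2)"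
    by (simp add: \<sigma>_def)
  have "\<sigma>\<^sup>2 \<le> (exp (\<sigma> / 2))\<^sup>2"
  proof -
    have "\<sigma>\<^sup>2 \<le> exp \<sigma>" using s(2) zero_le_power2[of "Re s"] unfolding \<sigma>_def by linarith
    also have "exp \<sigma> = (exp (\<sigma> / 2))\<^sup>2" by (simp flip: exp_double)
    finally show ?thesis .
  qed
  then have "\<sigma> \<le> exp (\<sigma> / 2)" by (rule power2_le_imp_le) simp
  then have "\<sigma> * exp (- \<sigma> / 2) \<le> 1" by (simp add: exp_minus field_simps)
  moreover have "exp (- \<sigma> * x\<^sup>2 / 2) \<le> 1" using s by (simp add: \<sigma>_def)
  moreover have "norm (mode s r x) \<le> norm (exp (- s * (of_real x)\<^sup>2 / 2)) + norm (mode s r x - exp (- s * (of_real x)\<^sup>2 / 2))"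
    by (rule norm_triangle_sub)
  ultimately show "norm (mode s r x) \<le> 3" using 2 unfolding norm_exp \<sigma>_def by linarith
qed

section \<open>Lattice sums as contour integrals\<close>

text \<open>This is \<open>1 - exp (2 pi i s)\<close> on the upper ray of slope
  \<open>\<kappa>\<close> leaving a half-integer. Up to \<open>r = 1 / 4\<close> the cosine is
  nonnegative; from there on the exponential is at most \<open>1 / 2\<close>, thanks to
  \<open>\<kappa> \<ge> 1\<close>. The ray thus keeps away from the poles of the kernel.\<close>

lemma norm_one_plus_decaying_cis_ge:
  fixes r \<kappa> :: real
  assumes "\<kappa> \<ge> 1" "r \<ge> 0"
  shows "norm (1 + exp (- 2 * pi * \<kappa> * r) *\<^sub>R cis (2 * pi * r)) \<ge> 1 / 2"
proof (cases "r \<le> 1 / 4")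
  case True
  then have "2 * pi * r \<le> pi / 2" by simp
  then have "cos (2 * pi * r) \<ge> 0" using assms by (intro cos_ge_zero) (auto intro: order_trans[of _ 0])
  then have "1 \<le> Re (1 + exp (- 2 * pi * \<kappa> * r) *\<^sub>R cis (2 * pi * r))" by simp
  then show ?thesis
    using complex_Re_le_cmod[of "1 + exp (- 2 * pi * \<kappa> * r) *\<^sub>R cis (2 * pi * r)"] by linarith
next
  case False
  have "1 * (1 / 4) \<le> \<kappa> * r" using False assms by (intro mult_mono) auto
  then have "4 * (1 / 4) \<le> (2 * pi) * (\<kappa> * r)" using pi_ge_two by (intro mult_mono) auto
  then have "exp (- 2 * pi * \<kappa> * r) \<le> exp (- 1)" by (simp add: mult_ac)
  also have "exp (- 1 :: real) \<le> 1 / 2"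
    using exp_ge_add_one_self[of 1] by (simp add: exp_minus field_simps)
  finally have "norm (exp (- 2 * pi * \<kappa> * r) *\<^sub>R cis (2 * pi * r)) \<le> 1 / 2" by simp
  moreover have "norm (1 :: complex) - norm (exp (- 2 * pi * \<kappa> * r) *\<^sub>R cis (2 * pi * r))
      \<le> norm (1 + exp (- 2 * pi * \<kappa> * r) *\<^sub>R cis (2 * pi * r))"
    by (rule norm_diff_ineq)
  ultimately show ?thesis by simp
qed

text \<open>Half-integers lie midway between the zeros of \<open>exp (2 pi i s) - 1\<close>.
  Measuring the real part from one of them produces the minus sign, which turns the dangerous
  difference into a sum.\<close>

lemma exp_2pi_i_eq:
  "exp (2 * pi * \<i> * s) = - (exp (- 2 * pi * Im s) *\<^sub>R cis (2 * pi * (Re s - (real n - 1 / 2))))"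
proof -
  have "cis (2 * pi * (Re s - (real n - 1 / 2))) = cis (2 * pi * Re s) * cis pi * cis (- (2 * pi * n))"
    unfolding cis_mult by (rule arg_cong[where f = cis]) (simp add: algebra_simps)
  also have "cis (- (2 * pi * n)) = 1"
    using cis_multiple_2pi[of "- real n"] by (simp add: mult_ac)
  finally show ?thesis by (subst exp_eq_polar) (simp add: scaleR_conv_of_real)
qed

text \<open>A summation kernel: simple poles at the integers, with residue
  \<open>cis (n * y) / (2 * pi * \<i>)\<close> at \<open>n\<close>. For
  \<open>0 < y < 2 * pi\<close> it decays in both vertical directions, like
  \<open>exp (- y * Im s)\<close> upwards and like \<open>exp ((2 * pi - y) * Im s)\<close>
  downwards.\<close>

definition kernel :: "real \<Rightarrow> complex \<Rightarrow> complex" where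
  "kernel y s = exp (\<i> * s * y) / (exp (2 * pi * \<i> * s) - 1)"

text \<open>Above the axis the numerator decays at rate \<open>y\<close> while the denominator is
  bounded below. Below the axis the numerator grows at rate \<open>y\<close>, but the denominator
  grows at rate \<open>2 * pi\<close>. Either way the net rate of decay is at least
  \<open>\<delta>\<close>.\<close>

lemma kernel_ray:
  fixes \<kappa> r y \<delta> :: real
  assumes \<kappa>: "\<kappa> \<ge> 1" and r: "r \<ge> 0" and y: "\<delta> \<le> y" "y \<le> 2 * pi - \<delta>"
    and s: "Re s = real n - 1 / 2 + r" "\<bar>Im s\<bar> = \<kappa> * r"
  shows "norm (kernel y s) \<le> 2 * exp (- (\<kappa> * \<delta> * r))" and "exp (2 * pi * \<i> * s) \<noteq> 1"
proof -
  let ?z = "exp (- 2 * pi * \<kappa> * r) *\<^sub>R cis (2 * pi * r)"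
  have z: "norm (1 + ?z) \<ge> 1 / 2" using norm_one_plus_decaying_cis_ge[OF \<kappa> r] .
  have num: "norm (exp (\<i> * s * y)) = exp (- (Im s * y))" by simp
  have "exp (2 * pi * \<i> * s) - 1 = - (1 + exp (- 2 * pi * Im s) *\<^sub>R cis (2 * pi * r))"
    by (subst exp_2pi_i_eq[of s n]) (simp add: s)
  then have den: "norm (exp (2 * pi * \<i> * s) - 1) = norm (1 + exp (- 2 * pi * Im s) *\<^sub>R cis (2 * pi * r))"
    by (simp only: norm_minus_cancel)
  have "norm (kernel y s) \<le> 2 * exp (- (\<kappa> * \<delta> * r)) \<and> exp (2 * pi * \<i> * s) \<noteq> 1"
  proof (cases "Im s \<ge> 0")
    case True
    then have Im: "Im s = \<kappa> * r" using s by simp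
    have d: "norm (exp (2 * pi * \<i> * s) - 1) \<ge> 1 / 2" using z unfolding den Im by (simp add: mult_ac)
    have "norm (kernel y s) \<le> exp (- (\<kappa> * r * y)) / (1 / 2)"
      unfolding kernel_def norm_divide num Im using d by (intro divide_left_mono) auto
    also have "\<dots> \<le> 2 * exp (- (\<kappa> * \<delta> * r))"
      using mult_left_mono[OF y(1), of "\<kappa> * r"] \<kappa> r by (simp add: mult_ac)
    finally show ?thesis using d by auto
  next
    case False
    then have Im: "Im s = - (\<kappa> * r)" using s by simp
    \<comment> \<open>Factoring out the large exponential leaves the conjugate of the quantity met
      on the upper ray, so the same lower bound applies.\<close>
    have gen: "1 + E *\<^sub>R c = E *\<^sub>R (c * (1 + cnj (e *\<^sub>R c)))" if "c * cnj c = 1" "E * e = 1"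
      for E e :: real and c :: complex
    proof -
      have "E *\<^sub>R (c * (1 + cnj (e *\<^sub>R c))) = of_real E * c + of_real (E * e) * (c * cnj c)"
        by (simp add: scaleR_conv_of_real algebra_simps)
      with that show ?thesis by (simp add: scaleR_conv_of_real)
    qed
    have "1 + exp (2 * pi * \<kappa> * r) *\<^sub>R cis (2 * pi * r)
        = exp (2 * pi * \<kappa> * r) *\<^sub>R (cis (2 * pi * r) * (1 + cnj ?z))"
      by (rule gen) (simp_all add: cis_cnj cis_mult flip: exp_add)
    then have "norm (exp (2 * pi * \<i> * s) - 1) = exp (2 * pi * \<kappa> * r) * norm (cnj (1 + ?z))"
      unfolding den Im by (simp add: norm_mult mult_ac)
    then have d: "norm (exp (2 * pi * \<i> * s) - 1) \<ge> exp (2 * pi * \<kappa> * r) * (1 / 2)"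
      using z unfolding complex_mod_cnj by simp
    have "norm (kernel y s) \<le> exp (\<kappa> * r * y) / (exp (2 * pi * \<kappa> * r) * (1 / 2))"
      unfolding kernel_def norm_divide num Im using d
      by (simp only: mult_minus_left minus_minus) (intro divide_left_mono mult_pos_pos, auto intro: less_le_trans[of 0 "exp (2 * pi * \<kappa> * r) * (1 / 2)"])
    also have "\<dots> = 2 * exp (\<kappa> * r * y - 2 * pi * \<kappa> * r)" by (simp add: exp_diff)
    also have "\<dots> \<le> 2 * exp (- (\<kappa> * \<delta> * r))"
      using mult_left_mono[OF y(2), of "\<kappa> * r"] \<kappa> r by (simp add: algebra_simps)
    finally show ?thesis
      using d by (metis cancel_comm_monoid_add_class.diff_cancel exp_gt_zero half_gt_zero_iff linorder_not_less mult.right_neutral norm_zero times_divide_eq_right)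
  qed
  then show "norm (kernel y s) \<le> 2 * exp (- (\<kappa> * \<delta> * r))" "exp (2 * pi * \<i> * s) \<noteq> 1" by auto
qed

text \<open>On such a line \<open>exp (2 pi i s)\<close> is a negative real number, so nothing
  cancels in the denominator \<open>1 + exp (- 2 * pi * Im s)\<close>. Its first summand dominates
  the numerator above the axis, its second one below.\<close>

lemma kernel_vertical:
  assumes y: "0 \<le> y" "y \<le> 2 * pi" and s: "Re s = real n - 1 / 2"
  shows "norm (kernel y s) \<le> 1" and "exp (2 * pi * \<i> * s) \<noteq> 1"
proof -
  have "exp (2 * pi * \<i> * s) - 1 = - of_real (1 + exp (- 2 * pi * Im s))"
    by (subst exp_2pi_i_eq[of s n]) (simp add: s scaleR_conv_of_real)
  then have den: "norm (exp (2 * pi * \<i> * s) - 1) = 1 + exp (- 2 * pi * Im s)"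
    by (simp only: norm_minus_cancel norm_of_real) simp
  have "exp (- (Im s * y)) \<le> 1 + exp (- 2 * pi * Im s)"
  proof (cases "Im s \<ge> 0")
    case True
    then have "exp (- (Im s * y)) \<le> 1" using y by simp
    then show ?thesis using exp_ge_zero[of "- 2 * pi * Im s"] by linarith
  next
    case False
    then have "exp (- (Im s * y)) \<le> exp (- 2 * pi * Im s)"
      using mult_left_mono_neg[OF y(2), of "Im s"] by (simp add: mult_ac)
    also have "\<dots> \<le> 1 + exp (- 2 * pi * Im s)" by simp
    finally show ?thesis .
  qed
  then show "norm (kernel y s) \<le> 1"
    unfolding kernel_def norm_divide den by (simp add: divide_le_eq_1 add_pos_pos)
  show "exp (2 * pi * \<i> * s) \<noteq> 1"
    using den by (metis add_less_same_cancel1 add.commute cancel_comm_monoid_add_class.diff_cancel exp_gt_zero less_numeral_extra(3) norm_zero not_one_less_zero add_pos_pos zero_less_one)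
qed

section \<open>Residue calculus in a triangle\<close>

lemma contour_integral_linepath_exp_bound:
  assumes f: "f contour_integrable_on linepath a b" and L: "L > 0" and M: "M \<ge> 0"
    and le: "\<And>t. t \<in> {0..1} \<Longrightarrow> norm (f (linepath a b t)) \<le> M * exp (- (L * t))"
  shows "norm (contour_integral (linepath a b) f) \<le> M * norm (b - a) / L"
proof -
  have "((\<lambda>t. - M * norm (b - a) / L * exp (- (L * t))) has_vector_derivative M * norm (b - a) * exp (- (L * t)))
      (at t within {0..1})" for t :: real
    using L by (auto intro!: derivative_eq_intros simp: has_real_derivative_iff_has_vector_derivative[symmetric])
  then have I: "((\<lambda>t. M * norm (b - a) * exp (- (L * t))) has_integral
      (- M * norm (b - a) / L * exp (- (L * 1)) - (- M * norm (b - a) / L * exp (- (L * 0))))) {0..1}"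
    by (intro fundamental_theorem_of_calculus) auto
  have h: "((\<lambda>x. f (linepath a b x) * (b - a)) has_integral contour_integral (linepath a b) f) {0..1}"
    using has_contour_integral_integral[OF f] has_contour_integral_linepath by blast
  have "norm (contour_integral (linepath a b) f) = norm (integral {0..1} (\<lambda>x. f (linepath a b x) * (b - a)))"
    by (simp only: integral_unique[OF h])
  also have "\<dots> \<le> integral {0..1} (\<lambda>t. M * norm (b - a) * exp (- (L * t)))"
  proof (rule integral_norm_bound_integral)
    show "norm (f (linepath a b x) * (b - a)) \<le> M * norm (b - a) * exp (- (L * x))" if "x \<in> {0..1}" for x
      using mult_right_mono[OF le[OF that], of "norm (b - a)"] by (simp add: norm_mult mult_ac)
  qed (use h I in \<open>auto simp: integrable_on_def\<close>)
  also have "\<dots> = M * norm (b - a) / L - M * norm (b - a) / L * exp (- L)"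
    using integral_unique[OF I] by simp
  also have "\<dots> \<le> M * norm (b - a) / L" using L M by simp
  finally show ?thesis .
qed

lemma residue_times_kernel:
  assumes W: "open W" "h holomorphic_on W" "of_nat n \<in> W"
  shows "residue (\<lambda>s. h s * kernel y s) (of_nat n) = h (of_nat n) * cis (n * y) / (2 * pi * \<i>)"
proof (rule residue_simple')
  let ?z = "of_nat n :: complex"
  let ?V = "W \<inter> ball ?z 1"
  show "open ?V" "?z \<in> ?V" using W by auto
  have ne: "exp (2 * pi * \<i> * s) \<noteq> 1" if "s \<in> ?V - {?z}" for s
  proof
    assume "exp (2 * pi * \<i> * s) = 1"
    then obtain k :: int where k: "Im s = 0" "2 * pi * Re s = of_int (2 * k) * pi"
      by (auto simp: exp_eq_1)
    then have s: "s = of_int k" by (auto simp: complex_eq_iff)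
    with that have "norm (of_int (int n - k) :: complex) < 1" by (simp add: dist_norm)
    then have "k = int n" unfolding norm_of_int by linarith
    with s that show False by auto
  qed
  show "(\<lambda>s. h s * kernel y s) holomorphic_on ?V - {?z}"
    unfolding kernel_def using ne
    by (intro holomorphic_intros holomorphic_on_subset[OF W(2)]) auto
  have e1: "exp (2 * complex_of_real pi * \<i> * of_nat n) = 1"
    by (auto simp: exp_eq_1 intro!: exI[of _ "int n"])
  have "((\<lambda>s. exp (2 * pi * \<i> * s)) has_field_derivative exp (2 * pi * \<i> * ?z) * (2 * pi * \<i>)) (at ?z)"
    by (auto intro!: derivative_eq_intros)
  then have "((\<lambda>s. (exp (2 * pi * \<i> * s) - 1) / (s - ?z)) \<longlongrightarrow> 2 * pi * \<i>) (at ?z)"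
    by (simp add: has_field_derivative_iff e1)
  moreover have "((\<lambda>s. h s * exp (\<i> * s * y)) \<longlongrightarrow> h ?z * exp (\<i> * ?z * y)) (at ?z)"
  proof -
    have "isCont h ?z"
      using W holomorphic_on_imp_continuous_on continuous_on_eq_continuous_at by blast
    then show ?thesis by (intro tendsto_intros) (simp add: isCont_def)
  qed
  ultimately have "((\<lambda>s. h s * exp (\<i> * s * y) / ((exp (2 * pi * \<i> * s) - 1) / (s - ?z)))
      \<longlongrightarrow> h ?z * exp (\<i> * ?z * y) / (2 * pi * \<i>)) (at ?z)"
    by (intro tendsto_divide) auto
  moreover have "exp (\<i> * ?z * y) = cis (n * y)" by (simp add: cis_conv_exp mult.assoc)
  ultimately show "(\<lambda>s. h s * kernel y s * (s - ?z)) \<midarrow>?z\<rightarrow> h ?z * cis (n * y) / (2 * pi * \<i>)"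
    by (simp add: kernel_def mult_ac)
qed

text \<open>The sum is the integral of \<open>h s * kernel y s\<close> along the boundary of the
  triangle with apex \<open>n0 - 1/2\<close>, slopes \<open>\<kappa>\<close> and
  \<open>- \<kappa>\<close>, and vertical side at \<open>N + 1/2\<close>. On the slanted sides
  growth at rate \<open>\<tau>\<close> meets decay at rate
  \<open>\<kappa> * \<delta> \<ge> \<tau> + 1\<close>, so each contributes at most
  \<open>2 * H * exp (\<tau> * (n0 - 1/2)) * (1 + \<kappa>)\<close>, independently of
  \<open>N\<close>. The last term is the length of the vertical side times \<open>V\<close>.\<close>

lemma lattice_sum_bound:
  fixes h :: "complex \<Rightarrow> complex" and \<kappa> \<delta> \<tau> y H V :: real and n0 N :: nat
  assumes \<kappa>: "\<kappa> \<ge> 1" and \<delta>: "\<delta> > 0" and y: "\<delta> \<le> y" "y \<le> 2 * pi - \<delta>"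
    and \<tau>: "\<tau> + 1 \<le> \<kappa> * \<delta>" and HV: "H \<ge> 0" "V \<ge> 0" and N: "n0 \<le> N"
    and W: "open W" "convex W" "h holomorphic_on W"
    and sub: "\<And>s. \<lbrakk>n0 - 1 / 2 \<le> Re s; Re s \<le> N + 1 / 2; \<bar>Im s\<bar> \<le> \<kappa> * (Re s - (n0 - 1 / 2))\<rbrakk> \<Longrightarrow> s \<in> W"
    and H: "\<And>s. \<lbrakk>n0 - 1 / 2 \<le> Re s; Re s \<le> N + 1 / 2; \<bar>Im s\<bar> \<le> \<kappa> * (Re s - (n0 - 1 / 2))\<rbrakk> \<Longrightarrow>
      norm (h s) \<le> H * exp (\<tau> * Re s)"
    and V: "\<And>s. \<lbrakk>Re s = N + 1 / 2; \<bar>Im s\<bar> \<le> \<kappa> * (Re s - (n0 - 1 / 2))\<rbrakk> \<Longrightarrow> norm (h s) \<le> V"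
  shows "norm (\<Sum>n=n0..N. h (of_nat n) * cis (n * y))
      \<le> 4 * H * exp (\<tau> * (n0 - 1 / 2)) * (1 + \<kappa>) + 2 * \<kappa> * (real N + 1 - real n0) * V"
proof -
  define c0 where "c0 = real n0 - 1 / 2"
  define L where "L = real N + 1 - real n0"
  have L: "L > 0" "c0 + L = real N + 1 / 2" using N by (auto simp: L_def c0_def)
  define Tri where "Tri = {s. c0 \<le> Re s \<and> Re s \<le> c0 + L \<and> \<bar>Im s\<bar> \<le> \<kappa> * (Re s - c0)}"
  define A where "A = complex_of_real c0"
  define B where "B = Complex (c0 + L) (- \<kappa> * L)"
  define C where "C = Complex (c0 + L) (\<kappa> * L)"
  note ABC = A_def B_def C_def
  \<comment> \<open>An open convex neighbourhood of the triangle whose real parts lie strictly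
    between \<open>n0 - 1\<close> and \<open>N + 1\<close>, so that it contains no poles other than
    \<open>n0, ..., N\<close>.\<close>
  define S where "S = W \<inter> {s. c0 - 1 / 2 < Re s} \<inter> {s. Re s < real N + 1}"
  have S: "open S" "convex S"
    using W unfolding S_def
    by (auto intro!: open_Int convex_Int open_halfspace_Re_gt open_halfspace_Re_lt
        convex_halfspace_Re_gt convex_halfspace_Re_lt)
  have "Tri \<subseteq> S"
    using sub L by (auto simp: Tri_def S_def c0_def)
  have "convex Tri"
  proof -
    have "Tri = {s. Re s \<ge> c0} \<inter> {s. Re s \<le> c0 + L} \<inter> {s. inner (Complex \<kappa> 1) s \<ge> \<kappa> * c0} \<inter> {s. inner (Complex \<kappa> (- 1)) s \<ge> \<kappa> * c0}"
      by (auto simp: Tri_def inner_complex_def algebra_simps abs_le_iff)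
    then show ?thesis
      by (simp only:) (intro convex_Int convex_halfspace_Re_ge convex_halfspace_Re_le convex_halfspace_ge)
  qed
  moreover have "{A, B, C} \<subseteq> Tri" using L \<kappa> by (auto simp: Tri_def ABC)
  ultimately have hull_sub: "convex hull {A, B, C} \<subseteq> Tri" by (intro hull_minimal)
  have sub_hull: "Tri \<subseteq> convex hull {A, B, C}"
  proof
    fix s assume s: "s \<in> Tri"
    \<comment> \<open>Barycentric coordinates: \<open>p\<close> is the relative horizontal distance
      from the apex, \<open>q\<close> the relative height, and \<open>\<bar>q\<bar> \<le> p\<close>
      inside the triangle.\<close>
    define p where "p = (Re s - c0) / L"
    define q where "q = Im s / (\<kappa> * L)"
    have pq: "p \<le> 1" "\<bar>q\<bar> \<le> p" "p * L = Re s - c0" "q * (\<kappa> * L) = Im s"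
      using s L \<kappa> by (auto simp: Tri_def p_def q_def field_simps abs_mult abs_divide)
    have "s = (1 - p) *\<^sub>R A + ((p - q) / 2) *\<^sub>R B + ((p + q) / 2) *\<^sub>R C"
      using pq(3,4) by (auto simp: complex_eq_iff ABC algebra_simps add_divide_distrib diff_divide_distrib)
    moreover have "1 - p \<ge> 0" "(p - q) / 2 \<ge> 0" "(p + q) / 2 \<ge> 0" "(1 - p) + (p - q) / 2 + (p + q) / 2 = 1"
      using pq by (auto simp: add_divide_distrib diff_divide_distrib)
    ultimately show "s \<in> convex hull {A, B, C}"
      unfolding convex_hull_3 by blast
  qed
  define pts where "pts = (of_nat :: nat \<Rightarrow> complex) ` {n0..N}"
  define g where "g = linepath A B +++ linepath B C +++ linepath C A"
  define f where "f = (\<lambda>s. h s * kernel y s)"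
  have y': "0 \<le> y" "y \<le> 2 * pi" using y \<delta> by auto
  have pts_1: "exp (2 * pi * \<i> * s) = 1" if "s \<in> pts" for s
    using that by (auto simp: pts_def exp_eq_1 intro!: exI[of _ "int _"])
  have pts_iff: "s \<in> pts" if s: "s \<in> S" "exp (2 * pi * \<i> * s) = 1" for s
  proof -
    from s(2) obtain k :: int where k: "Im s = 0" "2 * pi * Re s = of_int (2 * k) * pi"
      by (auto simp: exp_eq_1)
    then have sk: "s = of_int k" by (auto simp: complex_eq_iff)
    with s(1) have "real n0 - 1 < of_int k" "of_int k < real N + 1" by (auto simp: S_def c0_def)
    then have "int n0 \<le> k" "k \<le> int N" by linarith+
    then have "nat k \<in> {n0..N}" "s = of_nat (nat k)" by (auto simp: sk)
    then show ?thesis by (auto simp: pts_def)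
  qed
  have holf: "f holomorphic_on S - pts"
    unfolding f_def kernel_def using pts_iff
    by (intro holomorphic_intros holomorphic_on_subset[OF W(3)]) (auto simp: S_def)
  have rayAB: "Re (linepath A B t) = real n0 - 1 / 2 + L * t" "\<bar>Im (linepath A B t)\<bar> = \<kappa> * (L * t)"
    "linepath A B t \<in> Tri" if "t \<in> {0..1}" for t
  proof -
    have eq: "linepath A B t = Complex (c0 + L * t) (- (\<kappa> * (L * t)))"
      by (simp add: linepath_def ABC complex_eq_iff algebra_simps)
    have "0 \<le> L * t" "L * t \<le> L" "0 \<le> \<kappa> * (L * t)"
      using that L(1) \<kappa> by (auto simp: mult_left_le)
    then show "Re (linepath A B t) = real n0 - 1 / 2 + L * t" "\<bar>Im (linepath A B t)\<bar> = \<kappa> * (L * t)"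
      "linepath A B t \<in> Tri"
      unfolding eq by (simp_all add: Tri_def c0_def)
  qed
  have rayCA: "Re (linepath A C t) = real n0 - 1 / 2 + L * t" "\<bar>Im (linepath A C t)\<bar> = \<kappa> * (L * t)"
    "linepath A C t \<in> Tri" if "t \<in> {0..1}" for t
  proof -
    have eq: "linepath A C t = Complex (c0 + L * t) ((\<kappa> * (L * t)))"
      by (simp add: linepath_def ABC complex_eq_iff algebra_simps)
    have "0 \<le> L * t" "L * t \<le> L" "0 \<le> \<kappa> * (L * t)"
      using that L(1) \<kappa> by (auto simp: mult_left_le)
    then show "Re (linepath A C t) = real n0 - 1 / 2 + L * t" "\<bar>Im (linepath A C t)\<bar> = \<kappa> * (L * t)"
      "linepath A C t \<in> Tri"
      unfolding eq by (simp_all add: Tri_def c0_def)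
  qed
  have segBC: "Re s = real (Suc N) - 1 / 2" "s \<in> Tri" if "s \<in> closed_segment B C" for s
  proof -
    show "s \<in> Tri" using that \<open>convex Tri\<close> \<open>{A, B, C} \<subseteq> Tri\<close> closed_segment_subset by blast
    show "Re s = real (Suc N) - 1 / 2"
    proof -
      from that obtain u where "s = (1 - u) *\<^sub>R B + u *\<^sub>R C" by (auto simp: closed_segment_def)
      then have "Re s = (1 - u) * (c0 + L) + u * (c0 + L)" by (simp add: ABC)
      also have "\<dots> = c0 + L" by (simp add: algebra_simps)
      finally show ?thesis using L(2) by simp
    qed
  qed
  have seg_ne: "s \<in> S - pts" if s: "s \<in> closed_segment A B \<union> closed_segment B C \<union> closed_segment A C" for s
  proof -
    have "s \<in> Tri \<and> exp (2 * pi * \<i> * s) \<noteq> 1"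
      using s
    proof (elim UnE)
      assume "s \<in> closed_segment A B"
      then obtain t where "t \<in> {0..1}" "s = linepath A B t" by (auto simp: linepath_image_01[symmetric])
      then show ?thesis using rayAB[of t] kernel_ray(2)[OF \<kappa> _ y, of "L * t" s n0] L by auto
    next
      assume "s \<in> closed_segment A C"
      then obtain t where "t \<in> {0..1}" "s = linepath A C t" by (auto simp: linepath_image_01[symmetric])
      then show ?thesis using rayCA[of t] kernel_ray(2)[OF \<kappa> _ y, of "L * t" s n0] L by auto
    next
      assume "s \<in> closed_segment B C"
      then show ?thesis using segBC[of s] kernel_vertical(2)[OF y', of s "Suc N"] by blast
    qed
    then show ?thesis using pts_1 \<open>Tri \<subseteq> S\<close> by blast
  qed
  have img: "path_image g = closed_segment A B \<union> closed_segment B C \<union> closed_segment A C"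
    by (auto simp: g_def path_image_join closed_segment_commute)
  have loop: "valid_path g" "pathfinish g = pathstart g" by (auto simp: g_def)
  have res: "contour_integral g f = 2 * pi * \<i> * (\<Sum>p\<in>pts. winding_number g p * residue f p)"
  proof (rule Residue_theorem[OF S(1) convex_connected[OF S(2)] _ holf loop])
    show "finite pts" by (simp add: pts_def)
    show "path_image g \<subseteq> S - pts" using seg_ne img by blast
    then show "\<forall>z. z \<notin> S \<longrightarrow> winding_number g z = 0"
      using loop S(2) by (intro allI impI winding_number_zero_outside[of g S])
        (auto intro: valid_path_imp_path)
  qed
  have wn: "winding_number g p = 1" if "p \<in> pts" for p
  proof -
    from that obtain n where n: "n \<in> {n0..N}" "p = of_nat n" by (auto simp: pts_def)
    let ?I = "{s. c0 < Re s} \<inter> {s. Re s < c0 + L} \<inter> {s. inner (Complex \<kappa> 1) s > \<kappa> * c0} \<inter> {s. inner (Complex \<kappa> (- 1)) s > \<kappa> * c0}"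
    have "open ?I" by (intro open_Int open_halfspace_Re_gt open_halfspace_Re_lt open_halfspace_gt)
    moreover have "?I \<subseteq> convex hull {A, B, C}"
      by (rule order_trans[OF _ sub_hull]) (auto simp: Tri_def inner_complex_def algebra_simps abs_le_iff)
    moreover have "p \<in> ?I" using n L \<kappa> by (auto simp: inner_complex_def c0_def)
    ultimately have "p \<in> interior (convex hull {A, B, C})" using interior_maximal by blast
    \<comment> \<open>The order apex, lower corner, upper corner is counterclockwise, which makes
      the winding number \<open>1\<close> rather than \<open>- 1\<close>.\<close>
    moreover have "0 < Im ((B - A) * cnj (B - p))"
    proof -
      have "Im ((B - A) * cnj (B - p)) = L * \<kappa> * (n - c0)"
        by (simp add: ABC n algebra_simps)
      also have "\<dots> > 0" using L \<kappa> n by (auto simp: c0_def)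
      finally show ?thesis .
    qed
    ultimately show ?thesis using winding_number_triangle by (simp add: g_def)
  qed
  have "(\<Sum>p\<in>pts. winding_number g p * residue f p) = (\<Sum>n=n0..N. residue f (of_nat n))"
    unfolding pts_def by (subst sum.reindex) (auto simp: inj_on_def wn pts_def intro!: sum.cong)
  also have "\<dots> = (\<Sum>n=n0..N. h (of_nat n) * cis (n * y) / (2 * pi * \<i>))"
  proof (intro sum.cong refl)
    fix n assume "n \<in> {n0..N}"
    then have "of_nat n \<in> W" using \<kappa> by (intro sub) auto
    from residue_times_kernel[OF W(1,3) this] show "residue f (of_nat n) = h (of_nat n) * cis (n * y) / (2 * pi * \<i>)"
      unfolding f_def .
  qed
  also have "\<dots> = (\<Sum>n=n0..N. h (of_nat n) * cis (n * y)) / (2 * pi * \<i>)"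
    by (simp add: sum_divide_distrib)
  finally have I: "contour_integral g f = (\<Sum>n=n0..N. h (of_nat n) * cis (n * y))"
    unfolding res by simp
  have cont: "continuous_on (S - pts) f" by (rule holomorphic_on_imp_continuous_on[OF holf])
  have int: "f contour_integrable_on linepath A B" "f contour_integrable_on linepath B C"
    "f contour_integrable_on linepath C A"
    using seg_ne by (auto intro!: contour_integrable_continuous_linepath continuous_on_subset[OF cont]
        simp: closed_segment_commute)
  have int': "f contour_integrable_on linepath A C"
    using seg_ne by (auto intro!: contour_integrable_continuous_linepath continuous_on_subset[OF cont])
  \<comment> \<open>The third side is reversed, so that both slanted sides start at the apex and the
    integrand decays along their parametrisations.\<close>
  have split: "contour_integral g f = contour_integral (linepath A B) f + contour_integral (linepath B C) f
      - contour_integral (linepath A C) f"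
    using int unfolding g_def
    by (simp add: contour_integrable_joinI contour_integral_reverse_linepath[of C A f]
        closed_segment_commute) (simp add: contour_integral_reversepath[symmetric] )
  define M where "M = 2 * H * exp (\<tau> * c0)"
  have ray: "norm (f s) \<le> M * exp (- (L * t))"
    if t: "t \<in> {0..1}" and s: "Re s = real n0 - 1 / 2 + L * t" "\<bar>Im s\<bar> = \<kappa> * (L * t)" "s \<in> Tri" for s t
  proof -
    have Lt: "L * t \<ge> 0" using t L by simp
    have "norm (h s) \<le> H * exp (\<tau> * Re s)" using s(3) L by (intro H) (auto simp: Tri_def c0_def)
    then have "norm (f s) \<le> (H * exp (\<tau> * Re s)) * (2 * exp (- (\<kappa> * \<delta> * (L * t))))"
      unfolding f_def norm_mult using kernel_ray(1)[OF \<kappa> Lt y s(1,2)] HV by (intro mult_mono) auto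
    also have "\<dots> = M * exp (\<tau> * (L * t) - \<kappa> * \<delta> * (L * t))"
    proof -
      have "exp (\<tau> * Re s) * exp (- (\<kappa> * \<delta> * (L * t))) = exp (\<tau> * c0) * exp (\<tau> * (L * t) - \<kappa> * \<delta> * (L * t))"
        unfolding mult_exp_exp s(1) c0_def by (simp add: algebra_simps)
      then show ?thesis by (simp add: M_def)
    qed
    also have "\<dots> \<le> M * exp (- (L * t))"
      using mult_right_mono[OF \<tau> Lt] HV by (intro mult_left_mono) (auto simp: M_def algebra_simps)
    finally show ?thesis .
  qed
  have M: "M \<ge> 0" using HV by (simp add: M_def)
  have BA: "norm (B - A) \<le> L * (1 + \<kappa>)" "norm (C - A) \<le> L * (1 + \<kappa>)"
    using cmod_le[of "B - A"] cmod_le[of "C - A"] L \<kappa> by (simp_all add: ABC abs_mult algebra_simps)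
  have "norm (contour_integral (linepath A B) f) \<le> M * norm (B - A) / L"
    using ray rayAB by (intro contour_integral_linepath_exp_bound int L(1) M) auto
  also have "\<dots> \<le> M * (L * (1 + \<kappa>)) / L" using BA L M by (intro divide_right_mono mult_left_mono) auto
  finally have 1: "norm (contour_integral (linepath A B) f) \<le> M * (1 + \<kappa>)" using L by simp
  have "norm (contour_integral (linepath A C) f) \<le> M * norm (C - A) / L"
    using ray rayCA by (intro contour_integral_linepath_exp_bound int' L(1) M) auto
  also have "\<dots> \<le> M * (L * (1 + \<kappa>)) / L" using BA L M by (intro divide_right_mono mult_left_mono) auto
  finally have 2: "norm (contour_integral (linepath A C) f) \<le> M * (1 + \<kappa>)" using L by simp
  have "norm (contour_integral (linepath B C) f) \<le> V * norm (C - B)"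
  proof (rule contour_integral_bound_linepath[OF int(2) HV(2)])
    fix s assume s: "s \<in> closed_segment B C"
    have "norm (h s) \<le> V" using segBC[OF s] by (intro V) (auto simp: Tri_def c0_def)
    moreover have "norm (kernel y s) \<le> 1" using segBC[OF s] kernel_vertical(1)[OF y', of s "Suc N"] by blast
    ultimately have "norm (h s) * norm (kernel y s) \<le> V * 1" using HV by (intro mult_mono) auto
    then show "norm (f s) \<le> V" by (simp add: f_def norm_mult)
  qed
  also have "C - B = Complex 0 (2 * \<kappa> * L)" by (simp add: ABC complex_eq_iff)
  also have "norm \<dots> = 2 * \<kappa> * L" using \<kappa> L by (simp add: cmod_def)
  finally have 3: "norm (contour_integral (linepath B C) f) \<le> 2 * \<kappa> * L * V" by (simp add: mult_ac)
  have "norm (contour_integral g f) \<le> M * (1 + \<kappa>) + 2 * \<kappa> * L * V + M * (1 + \<kappa>)"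
    unfolding split using 1 2 3 by (intro norm_triangle_le_diff norm_triangle_le add_mono) 
  then show ?thesis
    unfolding I M_def L_def c0_def by (simp add: algebra_simps)
qed

text \<open>\<open>Re (s * Ln s)\<close> equals
  \<open>Re s * ln (norm s) - Im s * Im (Ln s)\<close>, and the argument stays below
  \<open>pi / 2\<close> in modulus. Damping is thus effective as soon as
  \<open>ln (Re s) > \<kappa> * pi / 2\<close>, for any opening \<open>\<kappa>\<close>.\<close>

lemma Re_times_Ln_ge:
  assumes "Re s > 0" "\<bar>Im s\<bar> \<le> \<kappa> * Re s"
  shows "Re (s * Ln s) \<ge> Re s * (ln (Re s) - \<kappa> * pi / 2)"
proof -
  have s: "s \<noteq> 0" using assms by auto
  have "Im s * Im (Ln s) \<le> \<bar>Im s\<bar> * \<bar>Im (Ln s)\<bar>" by (metis abs_ge_self abs_mult)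
  also have "\<dots> \<le> (\<kappa> * Re s) * (pi / 2)"
    using assms Re_Ln_pos_lt[OF s] by (intro mult_mono) auto
  finally have "Im s * Im (Ln s) \<le> \<kappa> * Re s * (pi / 2)" .
  moreover have "Re s * ln (Re s) \<le> Re s * Re (Ln s)"
    using assms s complex_Re_le_cmod[of s] by (intro mult_left_mono) auto
  ultimately show ?thesis by (simp add: algebra_simps)
qed

text \<open>
  The factor \<open>exp (- \<epsilon> s Ln s)\<close> is bounded by \<open>1\<close> for large \<open>s\<close> in any given sector \<open>\<bar>Im s\<bar> \<le> \<kappa> Re s\<close> and
  decays faster than any exponential there, so it truncates the sums without destroying the
  oscillation.
\<close>

definition amplitude :: "real \<Rightarrow> real \<Rightarrow> nat \<Rightarrow> real" where
  "amplitude T \<epsilon> n = exp ((T + 1) * n - \<epsilon> * (n * ln n))"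

text \<open>The summands extend to a holomorphic function \<open>h\<close> on a sector, to which
  \<open>lattice_sum_bound\<close> applies; here \<open>y\<close> is measured from the midpoint of
  the segment. On the slanted sides the damping is estimated by \<open>1\<close>, which makes
  \<open>M\<close> independent of \<open>\<epsilon>\<close>. On the vertical side it is kept and
  pushes the contribution below \<open>1\<close> once \<open>N\<close> is large, depending on
  \<open>\<epsilon>\<close>.\<close>

lemma bounded_away_from_axis:
  fixes T \<delta> :: real
  assumes T: "T > 0" and \<delta>: "\<delta> > 0"
  obtains n0 :: nat and \<rho> :: "complex \<Rightarrow> complex" and M :: real where
    "\<And>n. n \<ge> n0 \<Longrightarrow> n \<ge> 1 \<and> 8 * (real n)\<^sup>2 \<le> exp (real n) \<and> norm (\<rho> n) \<le> 2 * (real n)\<^sup>2 * exp (- real n)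
       \<and> \<rho> n * herm n (\<rho> n) 1 = 1"
    and "\<And>\<epsilon>. \<epsilon> > 0 \<Longrightarrow> \<forall>\<^sub>F N in sequentially. \<forall>t\<in>{0..T}. \<forall>x\<in>{-1..1::real}. \<forall>y\<in>{\<delta>..2 * pi - \<delta>}.
       norm (\<Sum>n=n0..N. of_real (amplitude T \<epsilon> n) * exp (- (n + \<rho> n) * t) * mode n (\<rho> n) (of_real x) * cis (n * y)) \<le> M"
proof -
  define \<tau> where "\<tau> = T + 1"
  \<comment> \<open>The smallest slope, not below \<open>1\<close>, for which the decay rate
    \<open>\<kappa> * \<delta>\<close> of the kernel exceeds the growth rate \<open>\<tau>\<close>
    by at least \<open>1\<close>.\<close>
  define \<kappa> where "\<kappa> = max 1 ((\<tau> + 1) / \<delta>)"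
  have \<kappa>: "\<kappa> \<ge> 1" "\<tau> + 1 \<le> \<kappa> * \<delta>" using \<delta> by (auto simp: \<kappa>_def max_def field_simps)
  \<comment> \<open>An open set around the closed sector is needed: \<open>W\<close> below has slope
    \<open>\<kappa> + 1\<close>, hence \<open>norm s < (\<kappa> + 2) * Re s\<close> in it, and
    \<open>\<kappa> + 3\<close> leaves room.\<close>
  obtain \<sigma>0 \<rho> where \<sigma>0: "\<sigma>0 \<ge> 1" "\<And>\<sigma>. \<sigma> > \<sigma>0 \<Longrightarrow> 8 * \<sigma>\<^sup>2 \<le> exp \<sigma>"
    and \<rho>: "\<rho> holomorphic_on {s. Re s > \<sigma>0 \<and> norm s < (\<kappa> + 3) * Re s}"
      "\<And>s. Re s > \<sigma>0 \<Longrightarrow> norm s < (\<kappa> + 3) * Re s \<Longrightarrow> norm (\<rho> s) \<le> 2 * (Re s)\<^sup>2 * exp (- Re s)"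
      "\<And>s. Re s > \<sigma>0 \<Longrightarrow> norm s < (\<kappa> + 3) * Re s \<Longrightarrow> \<rho> s * herm s (\<rho> s) 1 = 1"
    using dirichlet_parameter[of "\<kappa> + 3"] \<kappa> by auto
  have "\<forall>\<^sub>F n in sequentially. real n - 1 / 2 > \<sigma>0 \<and> ln (real n - 1 / 2) \<ge> \<kappa> * pi / 2"
    by (intro eventually_conj; real_asymp)
  \<comment> \<open>From the apex on, \<open>Re (s * Ln s)\<close> is nonnegative in the sector, so
    the damping factor never exceeds \<open>1\<close>, whatever \<open>\<epsilon>\<close>.\<close>
  then obtain n0 :: nat where n0: "real n0 - 1 / 2 > \<sigma>0" "ln (real n0 - 1 / 2) \<ge> \<kappa> * pi / 2"
    using eventually_happens by force
  define W where "W = {s. Re s > \<sigma>0} \<inter> {s. inner (Complex (\<kappa> + 1) 1) s > 0} \<inter> {s. inner (Complex (\<kappa> + 1) (- 1)) s > 0}"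
  have W: "open W" "convex W"
    unfolding W_def by (intro open_Int open_halfspace_Re_gt open_halfspace_gt
        convex_Int convex_halfspace_Re_gt convex_halfspace_gt)+
  have W_D: "Re s > \<sigma>0 \<and> norm s < (\<kappa> + 3) * Re s" if "s \<in> W" for s
    using that cmod_le[of s] \<sigma>0(1) by (auto simp: W_def inner_complex_def algebra_simps abs_if split: if_splits)
  have \<rho>_W: "\<rho> holomorphic_on W" by (rule holomorphic_on_subset[OF \<rho>(1)]) (use W_D in auto)
  have tri: "s \<in> W \<and> Re s \<ge> 1 \<and> \<bar>Im s\<bar> \<le> \<kappa> * Re s \<and> ln (Re s) \<ge> \<kappa> * pi / 2"
    if s: "real n0 - 1 / 2 \<le> Re s" "\<bar>Im s\<bar> \<le> \<kappa> * (Re s - (real n0 - 1 / 2))" for s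
  proof -
    have Re: "Re s > \<sigma>0" "Re s \<ge> 1" using s n0 \<sigma>0 by auto
    have "\<kappa> * (Re s - (real n0 - 1 / 2)) \<le> \<kappa> * Re s" using \<kappa> n0 \<sigma>0 by (intro mult_left_mono) auto
    with s have Im: "\<bar>Im s\<bar> \<le> \<kappa> * Re s" by linarith
    then have "s \<in> W" using Re by (auto simp: W_def inner_complex_def algebra_simps abs_le_iff)
    moreover have "ln (real n0 - 1 / 2) \<le> ln (Re s)" using s n0 \<sigma>0 by auto
    ultimately show ?thesis using Re Im n0 by auto
  qed
  define h where "h = (\<lambda>\<epsilon> t x s. exp (of_real \<tau> * s - of_real \<epsilon> * (s * Ln s) - (s + \<rho> s) * of_real t) * mode s (\<rho> s) (of_real x))"
  \<comment> \<open>The \<open>3\<close> bounds the eigenfunction, and \<open>exp T\<close> bounds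
    the effect of the shift \<open>\<rho>\<close>, of modulus at most \<open>1\<close>, over time at
    most \<open>T\<close>. The factor \<open>exp (- Re s * t)\<close> is estimated by
    \<open>1\<close>, which covers all \<open>t\<close> at once.\<close>
  define E where "E = (\<lambda>\<epsilon> R. 3 * exp T * exp (\<tau> * R - \<epsilon> * (R * (ln R - \<kappa> * pi / 2))))"
  have h_le: "norm (h \<epsilon> t x s) \<le> E \<epsilon> (Re s)" "E \<epsilon> (Re s) \<le> 3 * exp T * exp (\<tau> * Re s)"
    if \<epsilon>: "\<epsilon> > 0" and t: "t \<in> {0..T}" and x: "x \<in> {-1..1}"
      and s: "real n0 - 1 / 2 \<le> Re s" "\<bar>Im s\<bar> \<le> \<kappa> * (Re s - (real n0 - 1 / 2))" for \<epsilon> t x :: real and s :: complex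
  proof -
    note s' = tri[OF s] and D = W_D[of s]
    have r: "norm (\<rho> s) \<le> 1" and m: "norm (mode s (\<rho> s) x) \<le> 3"
      using s' D norm_mode_le[of s "\<rho> s" x] \<sigma>0 \<rho>(2)[of s] x by auto
    have "- Re (\<rho> s) * t \<le> 1 * T"
      using r t abs_Re_le_cmod[of "\<rho> s"] by (intro mult_mono) auto
    moreover have "Re s * t \<ge> 0" using s' t by auto
    moreover have "\<epsilon> * (Re s * (ln (Re s) - \<kappa> * pi / 2)) \<le> \<epsilon> * Re (s * Ln s)"
      using s' \<epsilon> by (intro mult_left_mono Re_times_Ln_ge) auto
    ultimately have "Re (of_real \<tau> * s - of_real \<epsilon> * (s * Ln s) - (s + \<rho> s) * of_real t)
        \<le> T + (\<tau> * Re s - \<epsilon> * (Re s * (ln (Re s) - \<kappa> * pi / 2)))"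
      by (simp add: algebra_simps)
    then have "norm (exp (of_real \<tau> * s - of_real \<epsilon> * (s * Ln s) - (s + \<rho> s) * of_real t))
        \<le> exp T * exp (\<tau> * Re s - \<epsilon> * (Re s * (ln (Re s) - \<kappa> * pi / 2)))"
      by (simp only: norm_exp_eq_Re mult_exp_exp exp_le_cancel_iff)
    from mult_mono[OF this m] show "norm (h \<epsilon> t x s) \<le> E \<epsilon> (Re s)"
      by (simp add: h_def E_def norm_mult mult_ac)
    have "0 \<le> \<epsilon> * (Re s * (ln (Re s) - \<kappa> * pi / 2))" using s' \<epsilon> by auto
    then show "E \<epsilon> (Re s) \<le> 3 * exp T * exp (\<tau> * Re s)" by (simp add: E_def)
  qed
  define M where "M = 4 * (3 * exp T) * exp (\<tau> * (n0 - 1 / 2)) * (1 + \<kappa>) + 1"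
  show ?thesis
  proof (rule that[of n0 \<rho> M])
    fix n assume "n \<ge> n0"
    then have "real n \<ge> real n0" by simp
    have "of_nat n \<in> W" using tri[of "of_nat n"] \<open>n \<ge> n0\<close> \<kappa> by auto
    from W_D[OF this] show "n \<ge> 1 \<and> 8 * (real n)\<^sup>2 \<le> exp (real n) \<and> norm (\<rho> n) \<le> 2 * (real n)\<^sup>2 * exp (- real n)
       \<and> \<rho> n * herm n (\<rho> n) 1 = 1"
      using \<sigma>0(1) \<sigma>0(2)[of "real n"] \<rho>(2,3)[of "of_nat n"] \<open>real n \<ge> real n0\<close> n0 by auto
  next
    fix \<epsilon> :: real assume \<epsilon>: "\<epsilon> > 0"
    have "\<forall>\<^sub>F N in sequentially. 2 * \<kappa> * (real N + 1) * E \<epsilon> (real N + 1 / 2) \<le> 1"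
      unfolding E_def using \<epsilon> \<kappa>(1) by real_asymp
    with eventually_ge_at_top[of n0]
    show "\<forall>\<^sub>F N in sequentially. \<forall>t\<in>{0..T}. \<forall>x\<in>{-1..1::real}. \<forall>y\<in>{\<delta>..2 * pi - \<delta>}.
       norm (\<Sum>n=n0..N. of_real (amplitude T \<epsilon> n) * exp (- (n + \<rho> n) * t) * mode n (\<rho> n) (of_real x) * cis (n * y)) \<le> M"
    proof eventually_elim
      case (elim N)
      show ?case
      proof (intro ballI)
        fix t x y :: real assume t: "t \<in> {0..T}" and x: "x \<in> {-1..1}" and y: "y \<in> {\<delta>..2 * pi - \<delta>}"
        have h_n: "h \<epsilon> t x (of_nat n) = of_real (amplitude T \<epsilon> n) * exp (- (n + \<rho> n) * t) * mode n (\<rho> n) (of_real x)"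
          if "n \<ge> n0" for n
        proof -
          have "n > 0" using that n0 \<sigma>0 by (cases n) auto
          then have ln: "Ln (of_nat n) = of_real (ln n)" using Ln_of_real[of "real n"] by simp
          have "complex_of_real (amplitude T \<epsilon> n) * exp (- (n + \<rho> n) * t)
              = exp (of_real \<tau> * of_nat n - of_real \<epsilon> * (of_nat n * of_real (ln n)) - (of_nat n + \<rho> n) * of_real t)"
            unfolding amplitude_def exp_of_real[symmetric] mult_exp_exp
            by (rule arg_cong[where f = exp]) (simp add: \<tau>_def algebra_simps)
          with ln show ?thesis by (simp add: h_def)
        qed
        have "norm (\<Sum>n=n0..N. h \<epsilon> t x (of_nat n) * cis (n * y))
          \<le> 4 * (3 * exp T) * exp (\<tau> * (n0 - 1 / 2)) * (1 + \<kappa>) + 2 * \<kappa> * (real N + 1 - real n0) * E \<epsilon> (real N + 1 / 2)"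
        proof (rule lattice_sum_bound[where \<delta> = \<delta> and W = W])
          show "h \<epsilon> t x holomorphic_on W"
            unfolding h_def mode_def
          proof -
            have "s \<notin> \<real>\<^sub>\<le>\<^sub>0" if "s \<in> W" for s
              using W_D[OF that] \<sigma>0 by (auto simp: complex_nonpos_Reals_iff)
            then show "(\<lambda>s. exp (of_real \<tau> * s - of_real \<epsilon> * (s * Ln s) - (s + \<rho> s) * of_real t)
                * (exp (- s * (of_real x)\<^sup>2 / 2) * (1 - \<rho> s * herm s (\<rho> s) (of_real x)))) holomorphic_on W"
              by (intro holomorphic_intros \<rho>_W herm_holomorphic W(1)) auto
          qed
          show "norm (h \<epsilon> t x s) \<le> 3 * exp T * exp (\<tau> * Re s)"
            if "n0 - 1 / 2 \<le> Re s" "Re s \<le> N + 1 / 2" "\<bar>Im s\<bar> \<le> \<kappa> * (Re s - (n0 - 1 / 2))" for s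
            using h_le[OF \<epsilon> t x that(1,3)] by linarith
          show "norm (h \<epsilon> t x s) \<le> E \<epsilon> (real N + 1 / 2)"
            if "Re s = N + 1 / 2" "\<bar>Im s\<bar> \<le> \<kappa> * (Re s - (n0 - 1 / 2))" for s
            using h_le(1)[OF \<epsilon> t x _ that(2)] that elim by auto
          show "E \<epsilon> (real N + 1 / 2) \<ge> 0" by (simp add: E_def)
        qed (use \<kappa> \<delta> y W tri elim in auto)
        also have "\<dots> \<le> M"
        proof -
          have "2 * \<kappa> * (real N + 1 - real n0) * E \<epsilon> (real N + 1 / 2) \<le> 2 * \<kappa> * (real N + 1) * E \<epsilon> (real N + 1 / 2)"
            using \<kappa> by (intro mult_right_mono mult_left_mono) (auto simp: E_def)
          with elim show ?thesis by (simp add: M_def)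
        qed
        finally show "norm (\<Sum>n=n0..N. of_real (amplitude T \<epsilon> n) * exp (- (n + \<rho> n) * t) * mode n (\<rho> n) (of_real x) * cis (n * y)) \<le> M"
          using h_n by (simp add: mult.assoc)
      qed
    qed
  qed
qed

section \<open>Smooth cutoff functions\<close>

lemma has_vector_derivative_partial_x:
  assumes "f differentiable (at (x, y))"
  shows "((\<lambda>s. f (s, y)) has_vector_derivative partial_x f (x, y)) (at x)"
proof -
  have "(\<lambda>s. (s, y)) differentiable (at x)" by (auto intro!: derivative_intros differentiableI)
  then have "(f \<circ> (\<lambda>s. (s, y))) differentiable (at x)"
    using assms by (intro differentiable_chain_at) auto
  then show ?thesis by (simp add: partial_x_def o_def vector_derivative_works)
qed

lemma has_vector_derivative_partial_y:
  assumes "f differentiable (at (x, y))"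
  shows "((\<lambda>s. f (x, s)) has_vector_derivative partial_y f (x, y)) (at y)"
proof -
  have "(\<lambda>s. (x, s)) differentiable (at y)" by (auto intro!: derivative_intros differentiableI)
  then have "(f \<circ> (\<lambda>s. (x, s))) differentiable (at y)"
    using assms by (intro differentiable_chain_at) auto
  then show ?thesis by (simp add: partial_y_def o_def vector_derivative_works)
qed

lemma partial_x_eqI:
  "(\<And>x y. ((\<lambda>s. f (s, y)) has_vector_derivative f' (x, y)) (at x)) \<Longrightarrow> partial_x f = f'"
  by (auto simp: partial_x_def vector_derivative_at)

lemma partial_y_eqI:
  "(\<And>x y. ((\<lambda>s. f (x, s)) has_vector_derivative f' (x, y)) (at y)) \<Longrightarrow> partial_y f = f'"
  by (auto simp: partial_y_def vector_derivative_at)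

lemma C_k_imp_continuous: "C_k k f \<Longrightarrow> continuous_on UNIV f"
  by (cases k) (auto intro!: continuous_at_imp_continuous_on differentiable_imp_continuous_within)

lemma C_k_add:
  "C_k k f \<Longrightarrow> C_k k g \<Longrightarrow> C_k k (\<lambda>p. f p + g p)"
proof (induction k arbitrary: f g)
  case (Suc k)
  have d: "f differentiable (at p)" "g differentiable (at p)" for p
    using Suc.prems unfolding C_k.simps by blast+
  have "partial_x (\<lambda>p. f p + g p) = (\<lambda>p. partial_x f p + partial_x g p)"
    by (intro partial_x_eqI has_vector_derivative_add has_vector_derivative_partial_x d)
  moreover have "partial_y (\<lambda>p. f p + g p) = (\<lambda>p. partial_y f p + partial_y g p)"
    by (intro partial_y_eqI has_vector_derivative_add has_vector_derivative_partial_y d)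
  ultimately show ?case
    using Suc d unfolding C_k.simps by (intro conjI allI) (simp_all only: differentiable_add)
qed (auto intro: continuous_intros)

lemma C_k_zero: "C_k k (\<lambda>p. 0)"
proof (induction k)
  case (Suc k)
  have "partial_x (\<lambda>p. 0) = (\<lambda>p. 0)" "partial_y (\<lambda>p. 0) = (\<lambda>p. 0)"
    by (auto intro!: partial_x_eqI partial_y_eqI)
  with Suc show ?case by auto
qed simp

lemma C_k_sum: "finite I \<Longrightarrow> (\<And>i. i \<in> I \<Longrightarrow> C_k k (f i)) \<Longrightarrow> C_k k (\<lambda>p. \<Sum>i\<in>I. f i p)"
  by (induction I rule: finite_induct) (auto intro: C_k_add C_k_zero)

text \<open>
  With \<open>q = 1 / (m (1 - x\<^sup>2) - 1)\<close> this is \<open>g q\<^sup>j exp (- q)\<close> near the centre of the interval and \<open>0\<close> near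
  its ends; derivatives stay in the family because \<open>q' = 2 m x q\<^sup>2\<close>.
\<close>

definition cutoff :: "real \<Rightarrow> nat \<Rightarrow> (complex \<Rightarrow> complex) \<Rightarrow> real \<Rightarrow> complex" where
  "cutoff m j g x = (if m * (1 - x\<^sup>2) > 1
     then g (of_real x) * of_real ((1 / (m * (1 - x\<^sup>2) - 1)) ^ j * exp (- 1 / (m * (1 - x\<^sup>2) - 1))) else 0)"

lemma cutoff_mult: "cutoff m j (\<lambda>z. c * g z) x = c * cutoff m j g x"
  by (simp add: cutoff_def)

lemma power_times_exp_minus_le:
  fixes q :: real
  assumes "q \<ge> 0"
  shows "q ^ n * exp (- q) \<le> fact n"
proof -
  have "(\<Sum>k\<in>{n}. q ^ k /\<^sub>R fact k) \<le> exp q"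
    unfolding exp_def using summable_exp_generic[of q] assms by (intro sum_le_suminf) auto
  then show ?thesis by (simp add: exp_minus field_simps)
qed

text \<open>Inside the support this is the product and chain rule. At every other point, the ends
  included, the derivative is \<open>0\<close> because the function is of second order there: with
  \<open>u = m * (1 - y^2) - 1\<close>, the product \<open>(1 / u) ^ j * exp (- 1 / u)\<close> is
  \<open>u^2\<close> times \<open>(1 / u) ^ (j + 2) * exp (- 1 / u)\<close>, and the latter is at
  most \<open>fact (j + 2)\<close>.\<close>

lemma cutoff_has_vector_derivative:
  fixes g g' :: "complex \<Rightarrow> complex"
  assumes m: "m > 0" and g: "\<And>z. (g has_field_derivative g' z) (at z)"
  shows "(cutoff m j g has_vector_derivative
    cutoff m j g' x + cutoff m (Suc j) (\<lambda>z. of_nat j * 2 * of_real m * z * g z) x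
      - cutoff m (Suc (Suc j)) (\<lambda>z. 2 * of_real m * z * g z) x) (at x)"
proof (cases "m * (1 - x\<^sup>2) > 1")
  case True
  define u where "u = (\<lambda>x::real. m * (1 - x\<^sup>2) - 1)"
  have ux: "u x > 0" using True by (simp add: u_def)
  have "open {x. u x > 0}" unfolding u_def by (intro open_Collect_less continuous_intros)
  have du: "((\<lambda>x. (1 / u x) ^ j * exp (- 1 / u x)) has_real_derivative
      2 * m * x * j * (1 / u x) ^ Suc j * exp (- 1 / u x) - 2 * m * x * (1 / u x) ^ Suc (Suc j) * exp (- 1 / u x)) (at x)"
  proof -
    have q: "((\<lambda>x. 1 / u x) has_real_derivative 2 * m * x * (1 / u x)\<^sup>2) (at x)"
      unfolding u_def using True by (auto intro!: derivative_eq_intros simp: power2_eq_square)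
    have p: "((\<lambda>x. (1 / u x) ^ j) has_real_derivative 2 * m * x * j * (1 / u x) ^ Suc j) (at x)"
    proof (cases j)
      case (Suc i)
      show ?thesis using DERIV_power[OF q, of j] by (simp add: Suc power2_eq_square algebra_simps add_divide_distrib)
    qed simp
    have e: "((\<lambda>x. exp (- (1 / u x))) has_real_derivative exp (- (1 / u x)) * (- (2 * m * x * (1 / u x)\<^sup>2))) (at x)"
      by (intro DERIV_fun_exp DERIV_minus q)
    have "((\<lambda>x. (1 / u x) ^ j * exp (- (1 / u x))) has_real_derivative
      2 * m * x * j * (1 / u x) ^ Suc j * exp (- (1 / u x)) - 2 * m * x * (1 / u x) ^ Suc (Suc j) * exp (- (1 / u x))) (at x)"
      by (rule DERIV_cong[OF DERIV_mult[OF p e]]) (simp add: algebra_simps power2_eq_square)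
    then show ?thesis by (simp only: minus_divide_left[symmetric])
  qed
  have "((\<lambda>x. g (of_real x) * of_real ((1 / u x) ^ j * exp (- 1 / u x))) has_vector_derivative
     g (of_real x) * of_real (2 * m * x * j * (1 / u x) ^ Suc j * exp (- 1 / u x) - 2 * m * x * (1 / u x) ^ Suc (Suc j) * exp (- 1 / u x))
      + g' (of_real x) * of_real ((1 / u x) ^ j * exp (- 1 / u x))) (at x)"
    by (intro has_vector_derivative_mult has_vector_derivative_real_field g
        has_vector_derivative_of_real du)
  then have "(cutoff m j g has_vector_derivative
     g (of_real x) * of_real (2 * m * x * j * (1 / u x) ^ Suc j * exp (- 1 / u x) - 2 * m * x * (1 / u x) ^ Suc (Suc j) * exp (- 1 / u x))
      + g' (of_real x) * of_real ((1 / u x) ^ j * exp (- 1 / u x))) (at x)"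
    by (rule has_vector_derivative_transform_within_open[OF _ \<open>open {x. u x > 0}\<close>])
      (use ux in \<open>auto simp: cutoff_def u_def\<close>)
  then show ?thesis
    by (rule has_vector_derivative_eq_rhs) (use True in \<open>simp add: cutoff_def u_def algebra_simps\<close>)
next
  case False
  have "continuous_on UNIV g"
    by (intro continuous_at_imp_continuous_on ballI DERIV_isCont[OF g])
  then have "continuous_on {x-1..x+1} (\<lambda>y. norm (g (of_real y)))"
    by (intro continuous_on_norm continuous_on_compose2[OF _ continuous_on_of_real[OF continuous_on_id]]) auto
  from continuous_attains_sup[OF _ _ this] obtain G where
    G: "\<And>y. y \<in> {x-1..x+1} \<Longrightarrow> norm (g (of_real y)) \<le> G" by fastforce
  have "G \<ge> 0" using order_trans[OF norm_ge_zero G[of x]] by simp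
  define C where "C = G * (fact (j + 2) * (m * (2 * \<bar>x\<bar> + 1))\<^sup>2)"
  have bound: "norm (cutoff m j g y) \<le> C * \<bar>y - x\<bar>\<^sup>2" if y: "\<bar>y - x\<bar> < 1" for y
  proof (cases "m * (1 - y\<^sup>2) > 1")
    case True
    define u where "u = m * (1 - y\<^sup>2) - 1"
    have u: "u > 0" using True by (simp add: u_def)
    \<comment> \<open>As \<open>x\<close> is outside the support,
      \<open>m * (1 - x^2) \<le> 1\<close>; hence \<open>u\<close> is at most \<open>m\<close> times
      a difference of squares and so of the order of the distance from \<open>x\<close> to
      \<open>y\<close>.\<close>
    have "u \<le> m * ((x - y) * (x + y))"
      using False by (simp add: u_def algebra_simps power2_eq_square)
    also have "\<dots> \<le> m * (\<bar>x - y\<bar> * \<bar>x + y\<bar>)"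
      using m by (intro mult_left_mono) (auto simp flip: abs_mult)
    also have "\<dots> \<le> m * (\<bar>x - y\<bar> * (2 * \<bar>x\<bar> + 1))" using m y by (intro mult_left_mono) auto
    finally have u_le: "u \<le> m * (2 * \<bar>x\<bar> + 1) * \<bar>y - x\<bar>" by (simp add: mult_ac abs_minus_commute)
    have "(1 / u) ^ j * exp (- 1 / u) = u\<^sup>2 * ((1 / u) ^ (j + 2) * exp (- (1 / u)))"
      using u by (simp add: power_add field_simps power2_eq_square)
    also have "\<dots> \<le> u\<^sup>2 * fact (j + 2)"
      using u by (intro mult_left_mono power_times_exp_minus_le) auto
    also have "\<dots> \<le> (m * (2 * \<bar>x\<bar> + 1) * \<bar>y - x\<bar>)\<^sup>2 * fact (j + 2)"
      using u u_le by (intro mult_right_mono power_mono) auto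
    finally have 1: "(1 / u) ^ j * exp (- 1 / u) \<le> fact (j + 2) * (m * (2 * \<bar>x\<bar> + 1))\<^sup>2 * \<bar>y - x\<bar>\<^sup>2"
      by (simp add: power_mult_distrib mult_ac)
    have "norm (cutoff m j g y) = norm (g (of_real y)) * ((1 / u) ^ j * exp (- 1 / u))"
    proof -
      have "cutoff m j g y = g (of_real y) * of_real ((1 / u) ^ j * exp (- 1 / u))"
        using True by (simp add: cutoff_def u_def[symmetric])
      moreover have "0 \<le> (1 / u) ^ j * exp (- 1 / u)" using u by simp
      ultimately show ?thesis by (simp only: norm_mult norm_of_real abs_of_nonneg)
    qed
    also have "\<dots> \<le> G * (fact (j + 2) * (m * (2 * \<bar>x\<bar> + 1))\<^sup>2 * \<bar>y - x\<bar>\<^sup>2)"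
    proof (rule mult_mono[OF _ 1])
      show "norm (g (of_real y)) \<le> G" using y by (intro G) (auto simp: abs_less_iff)
    qed (use u \<open>G \<ge> 0\<close> in auto)
    finally show ?thesis by (simp add: C_def mult_ac)
  qed (use \<open>G \<ge> 0\<close> in \<open>auto simp: cutoff_def C_def\<close>)
  have "(cutoff m j g has_derivative (\<lambda>_. 0)) (at x)"
    unfolding has_derivative_iff_norm
  proof (intro conjI)
    have "\<forall>\<^sub>F y in at x. norm (norm (cutoff m j g y - cutoff m j g x - 0) / norm (y - x)) \<le> C * \<bar>y - x\<bar>"
      unfolding eventually_at
    proof (intro exI[of _ 1] conjI ballI impI)
      fix y assume "y \<noteq> x \<and> dist y x < 1"
      then show "norm (norm (cutoff m j g y - cutoff m j g x - 0) / norm (y - x)) \<le> C * \<bar>y - x\<bar>"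
        using bound[of y] bound[of x] by (simp add: dist_real_def divide_simps power2_eq_square)
    qed simp
    moreover have "((\<lambda>y. C * \<bar>y - x\<bar>) \<longlongrightarrow> 0) (at x)"
      by (auto intro!: tendsto_eq_intros)
    ultimately show "((\<lambda>y. norm (cutoff m j g y - cutoff m j g x - 0) / norm (y - x)) \<longlongrightarrow> 0) (at x)"
      by (rule Lim_null_comparison)
  qed simp
  then show ?thesis using False by (simp add: has_vector_derivative_def cutoff_def)
qed

lemma cis_has_vector_derivative:
  "((\<lambda>y. cis (n * y)) has_vector_derivative \<i> * of_real n * cis (n * y)) (at y)"
proof -
  have "((\<lambda>z. exp (\<i> * of_real n * z)) has_field_derivative \<i> * of_real n * exp (\<i> * of_real n * of_real y))
      (at (complex_of_real y))"
    by (auto intro!: derivative_eq_intros)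
  from has_vector_derivative_real_field[OF this] show ?thesis
    by (simp add: cis_conv_exp mult.assoc)
qed

text \<open>The induction generalises \<open>j\<close> and \<open>g\<close>: the
  \<open>x\<close>-derivative is a sum of three members of the family, with exponents
  \<open>j\<close>, \<open>Suc j\<close> and \<open>Suc (Suc j)\<close>, and the
  \<open>y\<close>-derivative multiplies \<open>g\<close> by \<open>\<i> * n\<close>. With
  \<open>g\<close> entire, the new factors are entire again.\<close>

lemma C_k_cutoff:
  assumes m: "m > 0" and g: "g holomorphic_on UNIV"
  shows "C_k k (\<lambda>(x, y). cutoff m j g x * cis (n * y))"
  using g
proof (induction k arbitrary: g j)
  have D: "(g has_field_derivative deriv g z) (at z)" if "g holomorphic_on UNIV" for g z
    using that by (simp add: holomorphic_derivI)
  {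
    case 0
    have "continuous_on UNIV (cutoff m j g)"
      by (intro continuous_at_imp_continuous_on ballI
          has_vector_derivative_continuous[OF cutoff_has_vector_derivative[OF m D[OF 0]]])
    then have "continuous_on UNIV (\<lambda>p::real \<times> real. cutoff m j g (fst p))"
      by (rule continuous_on_compose2[OF _ continuous_on_fst[OF continuous_on_id]]) auto
    then have "continuous_on UNIV (\<lambda>p::real \<times> real. cutoff m j g (fst p) * cis (n * snd p))"
      by (intro continuous_on_mult continuous_on_cis continuous_on_snd continuous_on_const continuous_on_id)
    then show ?case by (simp add: case_prod_unfold)
  next
    case (Suc k)
    let ?F = "\<lambda>(x, y). cutoff m j g x * cis (n * y)"
    let ?g1 = "\<lambda>z. of_nat j * 2 * of_real m * z * g z"
    let ?g2 = "\<lambda>z. - (2 * of_real m * z * g z)"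
    note dc = cutoff_has_vector_derivative[OF m D[OF Suc.prems]]
    have "cutoff m (Suc (Suc j)) ?g2 x = - cutoff m (Suc (Suc j)) (\<lambda>z. 2 * of_real m * z * g z) x" for x
      by (simp add: cutoff_def)
    then have dc': "(cutoff m j g has_vector_derivative cutoff m j (deriv g) x + cutoff m (Suc j) ?g1 x
        + cutoff m (Suc (Suc j)) ?g2 x) (at x)" for x
      using dc[of j x] by simp
    have px: "partial_x ?F = (\<lambda>p. (case p of (x, y) \<Rightarrow> cutoff m j (deriv g) x * cis (n * y))
       + (case p of (x, y) \<Rightarrow> cutoff m (Suc j) ?g1 x * cis (n * y))
       + (case p of (x, y) \<Rightarrow> cutoff m (Suc (Suc j)) ?g2 x * cis (n * y)))"
    proof (rule partial_x_eqI)
      fix x y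
      have "((\<lambda>s. cutoff m j g s * cis (n * y)) has_vector_derivative (cutoff m j (deriv g) x + cutoff m (Suc j) ?g1 x
        + cutoff m (Suc (Suc j)) ?g2 x) * cis (n * y)) (at x)"
        by (intro has_vector_derivative_mult_left dc')
      then show "((\<lambda>s. case (s, y) of (x, y) \<Rightarrow> cutoff m j g x * cis (n * y)) has_vector_derivative
          (case (x, y) of (x, y) \<Rightarrow> cutoff m j (deriv g) x * cis (n * y))
       + (case (x, y) of (x, y) \<Rightarrow> cutoff m (Suc j) ?g1 x * cis (n * y))
       + (case (x, y) of (x, y) \<Rightarrow> cutoff m (Suc (Suc j)) ?g2 x * cis (n * y))) (at x)"
        by (simp add: distrib_right)
    qed
    have py: "partial_y ?F = (\<lambda>(x, y). cutoff m j (\<lambda>z. \<i> * of_real n * g z) x * cis (n * y))"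
    proof (rule partial_y_eqI)
      fix x y
      have "((\<lambda>s. cutoff m j g x * cis (n * s)) has_vector_derivative
          cutoff m j g x * (\<i> * of_real n * cis (n * y))) (at y)"
        by (intro has_vector_derivative_mult_right cis_has_vector_derivative)
      then show "((\<lambda>s. case (x, s) of (x, y) \<Rightarrow> cutoff m j g x * cis (n * y)) has_vector_derivative
          (case (x, y) of (x, y) \<Rightarrow> cutoff m j (\<lambda>z. \<i> * of_real n * g z) x * cis (n * y))) (at y)"
        by (simp add: cutoff_mult mult_ac)
    qed
    have "?F differentiable (at p)" for p
    proof -
      have "cutoff m j g differentiable (at (fst p))" "(\<lambda>y. cis (n * y)) differentiable (at (snd p))"
        using dc' cis_has_vector_derivative differentiableI_vector by blast+
      then have 1: "(\<lambda>p. cutoff m j g (fst p)) differentiable (at p)"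
        and 2: "(\<lambda>p. cis (n * snd p)) differentiable (at p)"
        using differentiable_chain_at[OF bounded_linear_imp_differentiable[OF bounded_linear_fst], of "cutoff m j g" p]
          differentiable_chain_at[OF bounded_linear_imp_differentiable[OF bounded_linear_snd], of "\<lambda>y. cis (n * y)" p]
        by (simp_all add: o_def)
      from differentiable_mult[OF 1 2] show ?thesis by (simp add: case_prod_unfold)
    qed
    then show ?case
      unfolding C_k.simps px py using Suc.prems
      by (intro conjI allI C_k_add Suc.IH holomorphic_intros holomorphic_deriv) auto
  }
qed

section \<open>Integrals over Omega\<close>

lemma Omega_borel [measurable]: "Omega \<in> sets borel"
  unfolding Omega_def by (intro borel_Times) auto

lemma Omega_subset_cbox: "Omega \<subseteq> cbox (-1, 0) (1, 2 * pi)"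
  by (auto simp: Omega_def cbox_Pair_eq)

lemma box_subset_Omega: "box (-1, 0) (1, 2 * pi) \<subseteq> Omega"
  by (auto simp: Omega_def box_prod)

lemma bounded_Omega: "bounded Omega"
  by (rule bounded_subset[OF bounded_cbox Omega_subset_cbox])

lemma set_integrable_continuous:
  fixes F :: "'a::euclidean_space \<Rightarrow> 'b::{banach, second_countable_topology}"
  assumes "continuous_on UNIV F" "S \<in> sets borel" "bounded S"
  shows "set_integrable lborel S F"
proof (rule set_integrable_subset[of lborel "closure S"])
  show "set_integrable lborel (closure S) F"
    unfolding set_integrable_def using assms
    by (intro borel_integrable_compact continuous_on_subset[OF assms(1)]) auto
qed (use assms closure_subset in auto)

lemma square_integrable_continuous:
  assumes "continuous_on UNIV F" "S \<in> sets borel" "bounded S"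
  shows "square_integrable_on S F"
  unfolding square_integrable_on_def
proof
  show "set_borel_measurable lborel S F"
    using set_integrable_continuous[OF assms] unfolding set_integrable_def set_borel_measurable_def by auto
  show "set_integrable lborel S (\<lambda>p. (norm (F p))\<^sup>2)"
    by (intro set_integrable_continuous assms continuous_intros)
qed

text \<open>Measurability and finite measure are asked of the larger set \<open>S'\<close>, so the
  bound applies to \<open>{0..T} \<times> omega a b\<close> inside
  \<open>{0..T} \<times> Omega\<close>. Should the integrand on \<open>S\<close> fail to be
  integrable, its integral has the default value \<open>0\<close> and the bound persists.\<close>

lemma l2norm_le:
  assumes "S \<subseteq> S'" "S' \<in> sets borel" "bounded S'" "C \<ge> 0"
    and F: "\<And>p. p \<in> S \<Longrightarrow> norm (F p) \<le> C"
  shows "l2norm S F \<le> C * sqrt (measure lborel S')"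
proof -
  have fin: "emeasure lborel S' < \<infinity>"
    using assms emeasure_bounded_finite by blast
  have int: "integrable lborel (\<lambda>p. indicator S' p *\<^sub>R C\<^sup>2)"
    using assms fin by (intro integrable_indicator) auto
  have "(LINT p:S|lborel. (norm (F p))\<^sup>2) \<le> (\<integral>p. indicator S' p *\<^sub>R C\<^sup>2 \<partial>lborel)"
    unfolding set_lebesgue_integral_def
    using assms by (intro integral_mono'[OF int]) (auto simp: indicator_def intro!: power_mono F)
  also have "\<dots> = measure lborel S' * C\<^sup>2" by simp
  finally have "sqrt (LINT p:S|lborel. (norm (F p))\<^sup>2) \<le> sqrt (measure lborel S' * C\<^sup>2)" by simp
  then show ?thesis using assms by (simp add: l2norm_def real_sqrt_mult mult.commute)
qed

lemma l2norm_nonneg: "l2norm S F \<ge> 0"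
  unfolding l2norm_def set_lebesgue_integral_def by (simp add: integral_nonneg_AE)

lemma l2norm_Omega_tendsto_0:
  assumes cont: "\<And>n. continuous_on UNIV (F n)"
    and lim: "\<And>p. p \<in> Omega \<Longrightarrow> (\<lambda>n. F n p) \<longlonglongrightarrow> 0"
    and bound: "\<And>n p. p \<in> Omega \<Longrightarrow> norm (F n p) \<le> C"
  shows "(\<lambda>n. l2norm Omega (F n)) \<longlonglongrightarrow> 0"
proof -
  have "(\<lambda>n. \<integral>p. indicator Omega p *\<^sub>R (norm (F n p))\<^sup>2 \<partial>lborel) \<longlonglongrightarrow> (\<integral>p. (0::real) \<partial>(lborel :: (real \<times> real) measure))"
  proof (rule integral_dominated_convergence[where w = "\<lambda>p. indicator Omega p *\<^sub>R C\<^sup>2"])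
    show "integrable lborel (\<lambda>p::real \<times> real. indicator Omega p *\<^sub>R C\<^sup>2)"
      using emeasure_bounded_finite[OF bounded_Omega] Omega_borel by (intro integrable_indicator) auto
    show "(\<lambda>p. indicator Omega p *\<^sub>R (norm (F n p))\<^sup>2) \<in> borel_measurable lborel" for n
      using borel_measurable_continuous_onI[OF cont[of n]] by measurable
    show "AE p in lborel. (\<lambda>n. indicator Omega p *\<^sub>R (norm (F n p))\<^sup>2) \<longlonglongrightarrow> 0"
    proof (intro AE_I2)
      fix p :: "real \<times> real"
      show "(\<lambda>n. indicator Omega p *\<^sub>R (norm (F n p))\<^sup>2) \<longlonglongrightarrow> 0"
      proof (cases "p \<in> Omega")
        case True
        have "(\<lambda>n. (norm (F n p))\<^sup>2) \<longlonglongrightarrow> (norm (0::complex))\<^sup>2"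
          by (intro tendsto_intros lim True)
        with True show ?thesis by simp
      qed simp
    qed
    show "AE p in lborel. norm (indicator Omega p *\<^sub>R (norm (F n p))\<^sup>2) \<le> indicator Omega p *\<^sub>R C\<^sup>2" for n
      using bound by (intro AE_I2) (auto simp: indicator_def intro!: power_mono)
  qed auto
  from tendsto_real_sqrt[OF this] show ?thesis
    by (simp add: l2norm_def set_lebesgue_integral_def)
qed

text \<open>The half-open rectangle and the closed box differ by a negligible set; on the box,
  Fubini and the fundamental theorem of calculus are available.\<close>

lemma integral_Omega_eq:
  fixes F :: "real \<times> real \<Rightarrow> 'b::euclidean_space"
  assumes "continuous_on UNIV F"
  shows "(LINT p:Omega|lborel. F p) = integral (cbox (-1, 0) (1, 2 * pi)) F"
proof -
  have "(LINT p:Omega|lborel. F p) = integral Omega F"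
    by (intro set_borel_integral_eq_integral set_integrable_continuous assms Omega_borel bounded_Omega)
  also have "\<dots> = integral (cbox (-1, 0) (1, 2 * pi)) F"
  proof (rule integral_spike_set)
    have "negligible (cbox (-1, 0) (1, 2 * pi) - box (-1 :: real, 0 :: real) (1, 2 * pi))"
      by (rule negligible_frontier_interval)
    then show "negligible {x \<in> cbox (-1, 0) (1, 2 * pi) - Omega. F x \<noteq> 0}"
      by (rule negligible_subset) (use box_subset_Omega in auto)
    have "{x \<in> Omega - cbox (-1, 0) (1, 2 * pi). F x \<noteq> 0} = {}" using Omega_subset_cbox by auto
    then show "negligible {x \<in> Omega - cbox (-1, 0) (1, 2 * pi). F x \<noteq> 0}" by (simp only: negligible_empty)
  qed
  finally show ?thesis .
qed

text \<open>Integration by parts in \<open>x\<close>, in the form applied to products with a test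
  function: \<open>H\<close> is such a product and takes the value \<open>0\<close> at both ends.
  The companion in \<open>y\<close> uses periodicity instead.\<close>

lemma integral_Omega_derivative_x:
  fixes F :: "real \<times> real \<Rightarrow> complex"
  assumes F: "continuous_on UNIV F"
    and H: "\<And>x y. ((\<lambda>s. H (s, y)) has_vector_derivative F (x, y)) (at x)"
    and bdry: "\<And>y. H (1, y) = H (- 1, y)"
  shows "(LINT p:Omega|lborel. F p) = 0"
proof -
  have "integral (cbox (-1, 0) (1, 2 * pi)) F
      = integral (cbox (-1) 1) (\<lambda>x. integral (cbox 0 (2 * pi)) (\<lambda>y. F (x, y)))"
    by (rule integral_prod_continuous[OF continuous_on_subset[OF F]]) simp
  also have "\<dots> = integral (cbox 0 (2 * pi)) (\<lambda>y. integral (cbox (-1) 1) (\<lambda>x. F (x, y)))"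
    by (rule integral_swap_continuous) (auto intro: continuous_on_subset[OF F])
  also have "\<dots> = integral (cbox 0 (2 * pi)) (\<lambda>y. 0)"
  proof (intro integral_cong)
    fix y :: real
    have "((\<lambda>x. F (x, y)) has_integral (H (1, y) - H (- 1, y))) {-1..1}"
      by (intro fundamental_theorem_of_calculus) (auto intro: has_vector_derivative_at_within[OF H])
    then show "integral (cbox (-1) 1) (\<lambda>x. F (x, y)) = 0"
      using bdry by (simp add: integral_unique)
  qed
  finally show ?thesis unfolding integral_Omega_eq[OF F] by simp
qed

lemma integral_Omega_derivative_y:
  fixes F :: "real \<times> real \<Rightarrow> complex"
  assumes F: "continuous_on UNIV F"
    and H: "\<And>x y. ((\<lambda>s. H (x, s)) has_vector_derivative F (x, y)) (at y)"
    and bdry: "\<And>x. H (x, 2 * pi) = H (x, 0)"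
  shows "(LINT p:Omega|lborel. F p) = 0"
proof -
  have "integral (cbox (-1, 0) (1, 2 * pi)) F
      = integral (cbox (-1) 1) (\<lambda>x. integral (cbox 0 (2 * pi)) (\<lambda>y. F (x, y)))"
    by (rule integral_prod_continuous[OF continuous_on_subset[OF F]]) simp
  also have "\<dots> = integral (cbox (-1) 1) (\<lambda>x::real. 0)"
  proof (intro integral_cong)
    fix x :: real
    have "((\<lambda>y. F (x, y)) has_integral (H (x, 2 * pi) - H (x, 0))) {0..2 * pi}"
      by (intro fundamental_theorem_of_calculus) (auto intro: has_vector_derivative_at_within[OF H])
    then show "integral (cbox 0 (2 * pi)) (\<lambda>y. F (x, y)) = 0"
      using bdry by (simp add: integral_unique)
  qed
  finally show ?thesis unfolding integral_Omega_eq[OF F] by simp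
qed

section \<open>Finite sums of modes are solutions\<close>

text \<open>The mean value estimate from the nearer end point, with
  \<open>1 - \<bar>x\<bar> \<le> 1 - x^2\<close>. It turns the Dirichlet condition into the decay
  that pays for the steep slope of the cutoff.\<close>

lemma norm_le_distance_to_boundary:
  fixes g g' :: "complex \<Rightarrow> complex" and x :: real
  assumes g: "\<And>z. (g has_field_derivative g' z) (at z)" and bdry: "g 1 = 0" "g (- 1) = 0"
    and G: "\<And>x. x \<in> {-1..1::real} \<Longrightarrow> norm (g' (of_real x)) \<le> G" and x: "\<bar>x\<bar> < 1"
  shows "norm (g (of_real x)) \<le> G * (1 - x\<^sup>2)"
proof -
  have g_real: "((\<lambda>x::real. g x) has_vector_derivative g' x) (at x)" for x
    by (rule has_vector_derivative_real_field[OF g])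
  then have cont: "continuous_on A (\<lambda>x::real. g x)" for A
    by (intro continuous_at_imp_continuous_on ballI has_vector_derivative_continuous)
  have *: "norm (g (of_real b) - g (of_real a)) \<le> G * b - G * a" if "a < b" "-1 \<le> a" "b \<le> 1" for a b :: real
  proof (rule differentiable_bound_general[OF that(1) cont _ g_real])
    show "((\<lambda>x. G * x) has_vector_derivative G) (at x)" for x :: real
      by (auto intro!: derivative_eq_intros)
  qed (use G that in \<open>auto intro!: continuous_intros\<close>)
  have "G \<ge> 0" using order_trans[OF norm_ge_zero G[of 0]] by simp
  show ?thesis
  proof (cases "x \<ge> 0")
    case True
    have "norm (g (of_real x)) \<le> G * (1 - x)" using *[of x 1] x bdry by (simp add: algebra_simps)
    also have "1 - x \<le> 1 - x\<^sup>2" using True x by (simp add: power2_eq_square mult_left_le)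
    finally show ?thesis using \<open>G \<ge> 0\<close> by (simp add: mult_left_mono)
  next
    case False
    have "norm (g (of_real x)) \<le> G * (1 + x)" using *[of "-1" x] x bdry by (simp add: algebra_simps)
    also have "1 + x \<le> 1 - x\<^sup>2"
    proof -
      have "(- x) * (- x) \<le> (- x) * 1" using False x by (intro mult_left_mono) auto
      then show ?thesis by (simp add: power2_eq_square)
    qed
    finally show ?thesis using \<open>G \<ge> 0\<close> by (simp add: mult_left_mono)
  qed
qed

lemma norm_cutoff_0_le: "norm (cutoff m 0 g x) \<le> norm (g (of_real x))"
proof -
  have "exp (- 1 / (m * (1 - x\<^sup>2) - 1)) \<le> 1" if "m * (1 - x\<^sup>2) > 1" using that by simp
  then show ?thesis
    by (auto simp: cutoff_def norm_mult mult_left_le simp del: exp_le_one_iff)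
qed

lemma cutoff_eventually:
  assumes "\<bar>x\<bar> < 1"
  shows "\<forall>\<^sub>F m in sequentially. (real m + 2) * (1 - x\<^sup>2) > 1"
proof -
  have "1 - x\<^sup>2 > 0" using assms by (simp add: abs_square_less_1)
  then show ?thesis by real_asymp
qed

lemma cutoff_0_tendsto:
  assumes x: "\<bar>x\<bar> < 1"
  shows "(\<lambda>m. cutoff (real m + 2) 0 g x) \<longlonglongrightarrow> g (of_real x)"
proof -
  have c: "1 - x\<^sup>2 > 0" using assms by (simp add: abs_square_less_1)
  have "(\<lambda>m. exp (- 1 / ((real m + 2) * (1 - x\<^sup>2) - 1))) \<longlonglongrightarrow> 1"
    using c by real_asymp
  then have "(\<lambda>m. g (of_real x) * of_real ((1 / ((real m + 2) * (1 - x\<^sup>2) - 1)) ^ 0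
      * exp (- 1 / ((real m + 2) * (1 - x\<^sup>2) - 1)))) \<longlonglongrightarrow> g (of_real x) * of_real 1"
    by (intro tendsto_intros) simp
  then have "(\<lambda>m. cutoff (real m + 2) 0 g x) \<longlonglongrightarrow> g (of_real x) * of_real 1"
    by (rule Lim_transform_eventually) (use cutoff_eventually[OF x] in \<open>eventually_elim, simp add: cutoff_def\<close>)
  then show ?thesis by simp
qed

text \<open>The term in which the derivative falls on the cutoff itself. For fixed \<open>x\<close>
  inside the interval, \<open>q\<close> is of order \<open>1 / m\<close>, so \<open>m * q^2\<close>
  tends to \<open>0\<close>.\<close>

lemma cutoff_2_tendsto:
  assumes x: "\<bar>x\<bar> < 1"
  shows "(\<lambda>m. cutoff (real m + 2) 2 (\<lambda>z. 2 * of_real (real m + 2) * z * g z) x) \<longlonglongrightarrow> 0"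
proof -
  have c: "1 - x\<^sup>2 > 0" using assms by (simp add: abs_square_less_1)
  have "(\<lambda>m. (real m + 2) * ((1 / ((real m + 2) * (1 - x\<^sup>2) - 1)) ^ 2
      * exp (- 1 / ((real m + 2) * (1 - x\<^sup>2) - 1)))) \<longlonglongrightarrow> 0"
    using c by real_asymp
  then have "(\<lambda>m. 2 * of_real x * g (of_real x) * of_real ((real m + 2) * ((1 / ((real m + 2) * (1 - x\<^sup>2) - 1)) ^ 2
      * exp (- 1 / ((real m + 2) * (1 - x\<^sup>2) - 1))))) \<longlonglongrightarrow> 2 * of_real x * g (of_real x) * of_real 0"
    by (intro tendsto_intros)
  then have "(\<lambda>m. cutoff (real m + 2) 2 (\<lambda>z. 2 * of_real (real m + 2) * z * g z) x)
      \<longlonglongrightarrow> 2 * of_real x * g (of_real x) * of_real 0"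
    by (rule Lim_transform_eventually)
      (use cutoff_eventually[OF x] in \<open>eventually_elim, simp add: cutoff_def mult_ac\<close>)
  then show ?thesis by simp
qed

text \<open>The factor \<open>m\<close> is unbounded, but \<open>g\<close> supplies a factor
  \<open>1 - x^2\<close>, and \<open>m * (1 - x^2) = 1 + 1 / q\<close>. What remains is
  \<open>(q^2 + q) * exp (- q)\<close>, at most \<open>fact 2 + fact 1 = 3\<close>, whence
  \<open>6\<close>. Being uniform in \<open>m\<close>, the bound permits dominated convergence of
  the derivatives.\<close>

lemma norm_cutoff_2_le:
  fixes g g' :: "complex \<Rightarrow> complex" and x :: real
  assumes m: "m > 0" and g: "\<And>z. (g has_field_derivative g' z) (at z)" and bdry: "g 1 = 0" "g (- 1) = 0"
    and G: "\<And>x. x \<in> {-1..1::real} \<Longrightarrow> norm (g' (of_real x)) \<le> G" and x: "\<bar>x\<bar> < 1"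
  shows "norm (cutoff m 2 (\<lambda>z. 2 * of_real m * z * g z) x) \<le> 6 * G"
proof (cases "m * (1 - x\<^sup>2) > 1")
  case True
  define q where "q = 1 / (m * (1 - x\<^sup>2) - 1)"
  have q: "q > 0" using True by (simp add: q_def)
  have mc: "m * (1 - x\<^sup>2) = 1 + 1 / q" by (simp add: q_def)
  have "G \<ge> 0" using order_trans[OF norm_ge_zero G[of 0]] by simp
  have "cutoff m 2 (\<lambda>z. 2 * of_real m * z * g z) x
      = (2 * of_real m * of_real x * g (of_real x)) * of_real (q ^ 2 * exp (- q))"
    using True by (simp add: cutoff_def q_def)
  then have "norm (cutoff m 2 (\<lambda>z. 2 * of_real m * z * g z) x)
      = 2 * m * (\<bar>x\<bar> * norm (g (of_real x))) * (q ^ 2 * exp (- q))"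
    using m by (simp only: norm_mult norm_of_real) simp
  also have "\<dots> \<le> 2 * m * (1 * (G * (1 - x\<^sup>2))) * (q ^ 2 * exp (- q))"
    using norm_le_distance_to_boundary[OF g bdry G x] x m
    by (intro mult_right_mono mult_left_mono mult_mono) auto
  also have "\<dots> = 2 * G * (m * (1 - x\<^sup>2)) * (q ^ 2 * exp (- q))" by simp
  also have "\<dots> = 2 * G * (q ^ 2 * exp (- q) + q ^ 1 * exp (- q))"
    unfolding mc using q by (simp add: field_simps power2_eq_square)
  also have "\<dots> \<le> 2 * G * (fact 2 + fact 1)"
    using q \<open>G \<ge> 0\<close> by (intro mult_left_mono add_mono power_times_exp_minus_le) auto
  finally show ?thesis by simp
qed (use order_trans[OF norm_ge_zero G[of 0]] in \<open>simp add: cutoff_def\<close>)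

lemma bounded_on_interval:
  fixes g :: "complex \<Rightarrow> complex"
  assumes "continuous_on UNIV g"
  obtains B where "B \<ge> 0" "\<And>x::real. x \<in> {-1..1::real} \<Longrightarrow> norm (g (of_real x)) \<le> B"
proof -
  have "continuous_on {-1..1::real} (\<lambda>x. norm (g (of_real x)))"
    by (intro continuous_on_norm continuous_on_compose2[OF assms continuous_on_of_real[OF continuous_on_id]]) auto
  from continuous_attains_sup[OF _ _ this] obtain B where
    B: "\<And>x::real. x \<in> {-1..1::real} \<Longrightarrow> norm (g (of_real x)) \<le> B" by fastforce
  then show thesis using that order_trans[OF norm_ge_zero B[of 0]] by simp
qed

definition fourier_sum :: "nat set \<Rightarrow> (nat \<Rightarrow> complex \<Rightarrow> complex) \<Rightarrow> real \<times> real \<Rightarrow> complex" where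
  "fourier_sum I w = (\<lambda>(x, y). \<Sum>n\<in>I. w n (of_real x) * cis (real n * y))"

lemma cis_real_nat_periodic: "cis (real n * (y + 2 * pi)) = cis (real n * y)"
  using cis_multiple_2pi[of "real n"] by (simp add: distrib_left mult_ac flip: cis_mult)

lemma continuous_fourier_sum:
  assumes "\<And>n. n \<in> I \<Longrightarrow> continuous_on UNIV (w n)"
  shows "continuous_on UNIV (fourier_sum I w)"
proof -
  have "continuous_on UNIV (\<lambda>p::real \<times> real. w n (of_real (fst p)))" if "n \<in> I" for n
    by (rule continuous_on_compose2[OF assms[OF that] continuous_on_of_real[OF continuous_on_fst[OF continuous_on_id]]]) auto
  then have "continuous_on UNIV (\<lambda>p::real \<times> real. \<Sum>n\<in>I. w n (of_real (fst p)) * cis (real n * snd p))"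
    by (intro continuous_on_sum continuous_on_mult continuous_on_cis continuous_on_snd continuous_on_const continuous_on_id) auto
  then show ?thesis by (simp add: fourier_sum_def case_prod_unfold)
qed

lemma fourier_sum_L2:
  assumes "\<And>n. n \<in> I \<Longrightarrow> continuous_on UNIV (w n)"
  shows "fourier_sum I w \<in> L2_Omega"
  using square_integrable_continuous[OF continuous_fourier_sum[OF assms] Omega_borel bounded_Omega]
  by (simp add: L2_Omega_def fourier_sum_def cis_real_nat_periodic)

text \<open>The approximating test functions cut off each coefficient at parameter
  \<open>real m + 2\<close>. Convergence in the three norms is dominated convergence; the boundary
  condition is what keeps the \<open>x\<close>-derivatives bounded while the cutoff
  steepens.\<close>

lemma grushin_V_fourier_sum:
  fixes w w' :: "nat \<Rightarrow> complex \<Rightarrow> complex"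
  assumes I: "finite I" and w: "\<And>n z. n \<in> I \<Longrightarrow> (w n has_field_derivative w' n z) (at z)"
    and bdry: "\<And>n. n \<in> I \<Longrightarrow> w n 1 = 0" "\<And>n. n \<in> I \<Longrightarrow> w n (- 1) = 0"
  shows "grushin_V (fourier_sum I w) (fourier_sum I w') (fourier_sum I (\<lambda>n z. \<i> * of_nat n * z * w n z))"
proof -
  have hol: "w n holomorphic_on UNIV" if "n \<in> I" for n
    using w[OF that] holomorphic_on_open by blast
  have w'_eq: "w' n = deriv (w n)" if "n \<in> I" for n
    by (intro ext DERIV_imp_deriv[symmetric] w that)
  have hol': "w' n holomorphic_on UNIV" if "n \<in> I" for n
    unfolding w'_eq[OF that] using hol[OF that] by (intro holomorphic_deriv) auto
  note cont = holomorphic_on_imp_continuous_on[OF hol] and cont' = holomorphic_on_imp_continuous_on[OF hol']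
  have cont_y: "continuous_on UNIV (\<lambda>z. \<i> * of_nat n * z * w n z)" if "n \<in> I" for n
    by (intro continuous_intros cont that)
  have "\<exists>B. \<forall>x::real. x \<in> {-1..1::real} \<longrightarrow> norm (w n x) \<le> B \<and> norm (w' n x) \<le> B" if n: "n \<in> I" for n
  proof -
    obtain B where "\<And>x. x \<in> {-1..1::real} \<Longrightarrow> norm (w n x) \<le> B"
      using bounded_on_interval[OF cont[OF n]] by metis
    moreover obtain B' where "\<And>x. x \<in> {-1..1::real} \<Longrightarrow> norm (w' n x) \<le> B'"
      using bounded_on_interval[OF cont'[OF n]] by metis
    ultimately show ?thesis by (intro exI[of _ "max B B'"]) (auto intro: max.coboundedI1 max.coboundedI2)
  qed
  then obtain B where B: "\<And>n x. n \<in> I \<Longrightarrow> x \<in> {-1..1::real} \<Longrightarrow> norm (w n x) \<le> B n"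
    "\<And>n x. n \<in> I \<Longrightarrow> x \<in> {-1..1::real} \<Longrightarrow> norm (w' n x) \<le> B n"
    by metis
  define \<phi> where "\<phi> = (\<lambda>m (x, y). \<Sum>n\<in>I. cutoff (real m + 2) 0 (w n) x * cis (real n * y))"
  have C_k_\<phi>: "C_k k (\<phi> m)" for k m
  proof -
    have "C_k k (\<lambda>p. \<Sum>n\<in>I. (\<lambda>(x, y). cutoff (real m + 2) 0 (w n) x * cis (real n * y)) p)"
      using I hol by (intro C_k_sum C_k_cutoff) auto
    then show ?thesis by (simp add: \<phi>_def case_prod_unfold)
  qed
  have test: "\<phi> m \<in> test_functions" for m
    unfolding test_functions_def mem_Collect_eq
  proof (intro conjI allI C_k_\<phi> exI impI)
    show "\<phi> m (x, y + 2 * pi) = \<phi> m (x, y)" for x y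
      by (simp add: \<phi>_def cis_real_nat_periodic)
    \<comment> \<open>The radius beyond which \<open>(real m + 2) * (1 - x^2) \<le> 1\<close>, that
      is, where the cutoff vanishes.\<close>
    show "sqrt (1 - 1 / (real m + 2)) < 1" by simp
    fix x y :: real assume "\<bar>x\<bar> \<ge> sqrt (1 - 1 / (real m + 2))"
    then have "x\<^sup>2 \<ge> 1 - 1 / (real m + 2)" by (metis real_sqrt_abs real_sqrt_le_iff)
    then have "\<not> 1 < (real m + 2) * (1 - x\<^sup>2)" by (simp add: field_simps)
    then show "\<phi> m (x, y) = 0" by (simp add: \<phi>_def cutoff_def)
  qed
  have px: "partial_x (\<phi> m) = (\<lambda>(x, y). \<Sum>n\<in>I. (cutoff (real m + 2) 0 (w' n) x
      - cutoff (real m + 2) 2 (\<lambda>z. 2 * of_real (real m + 2) * z * w n z) x) * cis (real n * y))" for m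
  proof (rule partial_x_eqI)
    fix x y
    have "((\<lambda>x. \<Sum>n\<in>I. cutoff (real m + 2) 0 (w n) x * cis (real n * y)) has_vector_derivative
      (\<Sum>n\<in>I. (cutoff (real m + 2) 0 (w' n) x + cutoff (real m + 2) (Suc 0) (\<lambda>z. of_nat 0 * 2 * of_real (real m + 2) * z * w n z) x
      - cutoff (real m + 2) (Suc (Suc 0)) (\<lambda>z. 2 * of_real (real m + 2) * z * w n z) x) * cis (real n * y))) (at x)"
      using w by (intro has_vector_derivative_sum has_vector_derivative_mult_left cutoff_has_vector_derivative) auto
    moreover have "cutoff (real m + 2) (Suc 0) (\<lambda>z. of_nat 0 * 2 * of_real (real m + 2) * z * w n z) x = 0" for n
      by (simp add: cutoff_def)
    ultimately show "((\<lambda>s. \<phi> m (s, y)) has_vector_derivative (case (x, y) of (x, y) \<Rightarrow> \<Sum>n\<in>I. (cutoff (real m + 2) 0 (w' n) x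
      - cutoff (real m + 2) 2 (\<lambda>z. 2 * of_real (real m + 2) * z * w n z) x) * cis (real n * y))) (at x)"
      by (simp add: \<phi>_def numeral_2_eq_2)
  qed
  have py: "partial_y (\<phi> m) = (\<lambda>(x, y). \<Sum>n\<in>I. cutoff (real m + 2) 0 (w n) x * (\<i> * of_real (real n) * cis (real n * y)))" for m
  proof (rule partial_y_eqI)
    fix x y
    have "((\<lambda>y. \<Sum>n\<in>I. cutoff (real m + 2) 0 (w n) x * cis (real n * y)) has_vector_derivative
      (\<Sum>n\<in>I. cutoff (real m + 2) 0 (w n) x * (\<i> * of_real (real n) * cis (real n * y)))) (at y)"
      by (intro has_vector_derivative_sum has_vector_derivative_mult_right cis_has_vector_derivative)
    then show "((\<lambda>s. \<phi> m (x, s)) has_vector_derivative (case (x, y) of (x, y) \<Rightarrow>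
      \<Sum>n\<in>I. cutoff (real m + 2) 0 (w n) x * (\<i> * of_real (real n) * cis (real n * y)))) (at y)"
      by (simp add: \<phi>_def)
  qed
  have cont_\<phi>: "continuous_on UNIV (\<phi> m)" "continuous_on UNIV (partial_x (\<phi> m))"
    "continuous_on UNIV (grushin_y (\<phi> m))" for m
  proof -
    show "continuous_on UNIV (\<phi> m)" by (rule C_k_imp_continuous[OF C_k_\<phi>])
    from C_k_\<phi>[of "Suc 0" m] have "C_k 0 (partial_x (\<phi> m))" "C_k 0 (partial_y (\<phi> m))"
      unfolding C_k.simps(2) by blast+
    note * = this[unfolded C_k.simps(1)]
    show "continuous_on UNIV (partial_x (\<phi> m))" by (rule *)
    have "grushin_y (\<phi> m) = (\<lambda>p. of_real (fst p) * partial_y (\<phi> m) p)"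
      by (simp add: grushin_y_def case_prod_unfold)
    then show "continuous_on UNIV (grushin_y (\<phi> m))"
      using *(2) by (auto intro!: continuous_on_mult continuous_on_of_real continuous_on_fst continuous_on_id)
  qed
  have 1: "(\<lambda>m. l2norm Omega (\<lambda>p. \<phi> m p - fourier_sum I w p)) \<longlonglongrightarrow> 0"
  proof (rule l2norm_Omega_tendsto_0[where C = "\<Sum>n\<in>I. 2 * B n"])
    show "continuous_on UNIV (\<lambda>p. \<phi> m p - fourier_sum I w p)" for m
      by (intro continuous_on_diff cont_\<phi> continuous_fourier_sum cont)
    fix p assume "p \<in> Omega"
    then obtain x y where p: "p = (x, y)" and x: "\<bar>x\<bar> < 1" by (auto simp: Omega_def)
    have "(\<lambda>m. \<Sum>n\<in>I. (cutoff (real m + 2) 0 (w n) x - w n (of_real x)) * cis (real n * y))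
        \<longlonglongrightarrow> (\<Sum>n\<in>I. (w n (of_real x) - w n (of_real x)) * cis (real n * y))"
      by (intro tendsto_intros cutoff_0_tendsto x)
    then show "(\<lambda>m. \<phi> m p - fourier_sum I w p) \<longlonglongrightarrow> 0"
      by (simp add: \<phi>_def fourier_sum_def p left_diff_distrib sum_subtractf)
    fix m
    have "norm (\<phi> m p - fourier_sum I w p) = norm (\<Sum>n\<in>I. (cutoff (real m + 2) 0 (w n) x - w n (of_real x)) * cis (real n * y))"
      by (simp add: \<phi>_def fourier_sum_def p left_diff_distrib sum_subtractf)
    also have "\<dots> \<le> (\<Sum>n\<in>I. 2 * B n)"
    proof (rule sum_norm_le)
      fix n assume n: "n \<in> I"
      have b: "norm (w n x) \<le> B n" using x by (intro B(1)[OF n]) (auto simp: abs_less_iff)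
      then have "norm (cutoff (real m + 2) 0 (w n) x) \<le> B n"
        using norm_cutoff_0_le[of "real m + 2" "w n" x] by linarith
      with b show "norm ((cutoff (real m + 2) 0 (w n) x - w n (of_real x)) * cis (real n * y)) \<le> 2 * B n"
        using norm_triangle_ineq4[of "cutoff (real m + 2) 0 (w n) x" "w n x"] by (simp add: norm_mult)
    qed
    finally show "norm (\<phi> m p - fourier_sum I w p) \<le> (\<Sum>n\<in>I. 2 * B n)" .
  qed
  have 2: "(\<lambda>m. l2norm Omega (\<lambda>p. partial_x (\<phi> m) p - fourier_sum I w' p)) \<longlonglongrightarrow> 0"
  \<comment> \<open>Here \<open>8 = 1 + 6 + 1\<close>: the truncated derivative, the derivative of
    the cutoff, and the limit.\<close>
  proof (rule l2norm_Omega_tendsto_0[where C = "\<Sum>n\<in>I. 8 * B n"])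
    show "continuous_on UNIV (\<lambda>p. partial_x (\<phi> m) p - fourier_sum I w' p)" for m
      by (intro continuous_on_diff cont_\<phi> continuous_fourier_sum cont')
    fix p assume "p \<in> Omega"
    then obtain x y where p: "p = (x, y)" and x: "\<bar>x\<bar> < 1" by (auto simp: Omega_def)
    let ?c2 = "\<lambda>m n. cutoff (real m + 2) 2 (\<lambda>z. 2 * of_real (real m + 2) * z * w n z) x"
    have eq: "partial_x (\<phi> m) p - fourier_sum I w' p
      = (\<Sum>n\<in>I. (cutoff (real m + 2) 0 (w' n) x - ?c2 m n - w' n (of_real x)) * cis (real n * y))" for m
      unfolding px by (simp add: fourier_sum_def p left_diff_distrib sum_subtractf)
    have "(\<lambda>m. \<Sum>n\<in>I. (cutoff (real m + 2) 0 (w' n) x - ?c2 m n - w' n (of_real x)) * cis (real n * y))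
        \<longlonglongrightarrow> (\<Sum>n\<in>I. (w' n (of_real x) - 0 - w' n (of_real x)) * cis (real n * y))"
      by (intro tendsto_intros cutoff_0_tendsto cutoff_2_tendsto x)
    then show "(\<lambda>m. partial_x (\<phi> m) p - fourier_sum I w' p) \<longlonglongrightarrow> 0"
      unfolding eq by simp
    fix m
    show "norm (partial_x (\<phi> m) p - fourier_sum I w' p) \<le> (\<Sum>n\<in>I. 8 * B n)"
      unfolding eq
    proof (rule sum_norm_le)
      fix n assume n: "n \<in> I"
      have b: "norm (w' n x) \<le> B n" using x by (intro B(2)[OF n]) (auto simp: abs_less_iff)
      then have "norm (cutoff (real m + 2) 0 (w' n) x) \<le> B n"
        using norm_cutoff_0_le[of "real m + 2" "w' n" x] by linarith
      moreover note b
      moreover have "norm (?c2 m n) \<le> 6 * B n"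
        using x by (intro norm_cutoff_2_le[OF _ w[OF n] bdry(1)[OF n] bdry(2)[OF n] B(2)[OF n]]) auto
      ultimately show "norm ((cutoff (real m + 2) 0 (w' n) x - ?c2 m n - w' n (of_real x)) * cis (real n * y)) \<le> 8 * B n"
        using norm_triangle_ineq4[of "cutoff (real m + 2) 0 (w' n) x - ?c2 m n" "w' n x"]
          norm_triangle_ineq4[of "cutoff (real m + 2) 0 (w' n) x" "?c2 m n"] by (simp add: norm_mult)
    qed
  qed
  have 3: "(\<lambda>m. l2norm Omega (\<lambda>p. grushin_y (\<phi> m) p - fourier_sum I (\<lambda>n z. \<i> * of_nat n * z * w n z) p)) \<longlonglongrightarrow> 0"
  proof (rule l2norm_Omega_tendsto_0[where C = "\<Sum>n\<in>I. n * (2 * B n)"])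
    show "continuous_on UNIV (\<lambda>p. grushin_y (\<phi> m) p - fourier_sum I (\<lambda>n z. \<i> * of_nat n * z * w n z) p)" for m
      by (intro continuous_on_diff cont_\<phi> continuous_fourier_sum cont_y)
    fix p assume "p \<in> Omega"
    then obtain x y where p: "p = (x, y)" and x: "\<bar>x\<bar> < 1" by (auto simp: Omega_def)
    have eq: "grushin_y (\<phi> m) p - fourier_sum I (\<lambda>n z. \<i> * of_nat n * z * w n z) p
      = (\<Sum>n\<in>I. of_real x * (\<i> * of_nat n) * (cutoff (real m + 2) 0 (w n) x - w n (of_real x)) * cis (real n * y))" for m
      unfolding grushin_y_def py
      by (simp add: fourier_sum_def p algebra_simps sum_subtractf sum_distrib_left)
    have "(\<lambda>m. \<Sum>n\<in>I. of_real x * (\<i> * of_nat n) * (cutoff (real m + 2) 0 (w n) x - w n (of_real x)) * cis (real n * y))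
        \<longlonglongrightarrow> (\<Sum>n\<in>I. of_real x * (\<i> * of_nat n) * (w n (of_real x) - w n (of_real x)) * cis (real n * y))"
      by (intro tendsto_intros cutoff_0_tendsto x)
    then show "(\<lambda>m. grushin_y (\<phi> m) p - fourier_sum I (\<lambda>n z. \<i> * of_nat n * z * w n z) p) \<longlonglongrightarrow> 0"
      unfolding eq by simp
    fix m
    show "norm (grushin_y (\<phi> m) p - fourier_sum I (\<lambda>n z. \<i> * of_nat n * z * w n z) p) \<le> (\<Sum>n\<in>I. n * (2 * B n))"
      unfolding eq
    proof (rule sum_norm_le)
      fix n assume n: "n \<in> I"
      have b: "norm (w n x) \<le> B n" using x by (intro B(1)[OF n]) (auto simp: abs_less_iff)
      then have "norm (cutoff (real m + 2) 0 (w n) x) \<le> B n"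
        using norm_cutoff_0_le[of "real m + 2" "w n" x] by linarith
      with b have "norm (cutoff (real m + 2) 0 (w n) x - w n (of_real x)) \<le> 2 * B n"
        using norm_triangle_ineq4[of "cutoff (real m + 2) 0 (w n) x" "w n x"] by simp
      then have "\<bar>x\<bar> * (n * norm (cutoff (real m + 2) 0 (w n) x - w n (of_real x))) \<le> 1 * (n * (2 * B n))"
        using x by (intro mult_mono) auto
      then show "norm (of_real x * (\<i> * of_nat n) * (cutoff (real m + 2) 0 (w n) x - w n (of_real x)) * cis (real n * y)) \<le> n * (2 * B n)"
        by (simp add: norm_mult mult_ac)
    qed
  qed
  show ?thesis
    unfolding grushin_V_def
    by (intro conjI exI[of _ \<phi>] fourier_sum_L2 cont cont' cont_y allI test 1 2 3)
qed

section \<open>The weak formulation for finite sums of modes\<close>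

lemma test_functionD:
  assumes "\<phi> \<in> test_functions"
  shows "continuous_on UNIV \<phi>" "continuous_on UNIV (partial_x \<phi>)" "continuous_on UNIV (partial_y \<phi>)"
    and "\<phi> differentiable (at p)"
    and "\<phi> (x, y + 2 * pi) = \<phi> (x, y)" and "\<phi> (1, y) = 0" and "\<phi> (- 1, y) = 0"
proof -
  have C: "C_k k \<phi>" for k using assms by (simp add: test_functions_def)
  from C[of "Suc 0"] show "continuous_on UNIV (partial_x \<phi>)" "continuous_on UNIV (partial_y \<phi>)"
    "\<phi> differentiable (at p)" unfolding C_k.simps by blast+
  show "continuous_on UNIV \<phi>" by (rule C_k_imp_continuous[OF C])
  show "\<phi> (x, y + 2 * pi) = \<phi> (x, y)" using assms by (simp add: test_functions_def)
  obtain r where "r < 1" "\<And>x y. \<bar>x\<bar> \<ge> r \<Longrightarrow> \<phi> (x, y) = 0"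
    using assms unfolding test_functions_def by blast
  then show "\<phi> (1, y) = 0" "\<phi> (- 1, y) = 0" by simp_all
qed

definition fourier_mode :: "nat \<Rightarrow> (complex \<Rightarrow> complex) \<Rightarrow> real \<times> real \<Rightarrow> complex" where
  "fourier_mode n v = (\<lambda>p. v (of_real (fst p)) * cis (real n * snd p))"

lemma continuous_fourier_mode:
  assumes "continuous_on UNIV v"
  shows "continuous_on UNIV (fourier_mode n v)"
  unfolding fourier_mode_def
  by (intro continuous_on_mult continuous_on_cis continuous_on_snd continuous_on_const continuous_on_id
      continuous_on_compose2[OF assms continuous_on_of_real[OF continuous_on_fst[OF continuous_on_id]]]) auto

lemma fourier_sum_eq: "fourier_sum I w p = (\<Sum>n\<in>I. fourier_mode n (w n) p)"
  by (simp add: fourier_sum_def fourier_mode_def case_prod_unfold)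

lemma set_integrable_Omega_mult_cnj:
  fixes f \<phi> :: "real \<times> real \<Rightarrow> complex"
  assumes "continuous_on UNIV f" "continuous_on UNIV \<phi>"
  shows "set_integrable lborel Omega (\<lambda>p. f p * cnj (\<phi> p))"
  by (intro set_integrable_continuous continuous_on_mult continuous_on_cnj assms Omega_borel bounded_Omega)

lemma l2inner_fourier_sum:
  assumes "finite I" "\<And>n. n \<in> I \<Longrightarrow> continuous_on UNIV (w n)" "continuous_on UNIV \<phi>"
  shows "l2inner Omega (fourier_sum I w) \<phi> = (\<Sum>n\<in>I. l2inner Omega (fourier_mode n (w n)) \<phi>)"
proof -
  have "l2inner Omega (fourier_sum I w) \<phi>
      = (\<integral>p. (\<Sum>n\<in>I. indicator Omega p *\<^sub>R (fourier_mode n (w n) p * cnj (\<phi> p))) \<partial>lborel)"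
    unfolding l2inner_def set_lebesgue_integral_def fourier_sum_eq
    by (simp add: sum_distrib_right scaleR_sum_right)
  also have "\<dots> = (\<Sum>n\<in>I. l2inner Omega (fourier_mode n (w n)) \<phi>)"
    unfolding l2inner_def set_lebesgue_integral_def
    using set_integrable_Omega_mult_cnj[OF continuous_fourier_mode assms(3)] assms(2)
    by (intro Bochner_Integration.integral_sum) (auto simp: set_integrable_def)
  finally show ?thesis .
qed

lemma l2inner_fourier_mode_mult:
  "l2inner Omega (fourier_mode n (\<lambda>z. c * v z)) \<phi> = c * l2inner Omega (fourier_mode n v) \<phi>"
  by (simp add: l2inner_def fourier_mode_def mult.assoc)

text \<open>Integration by parts against the test function. \<open>?F1\<close> is the
  \<open>x\<close>-derivative of \<open>v' * cis (n * y) * cnj \<phi>\<close>, which is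
  \<open>0\<close> at both ends, and \<open>?F2\<close> is the \<open>y\<close>-derivative of
  \<open>\<i> * n * x^2 * v * cis (n * y) * cnj \<phi>\<close>, which is periodic. In
  \<open>?F1 + ?F2\<close> the terms with \<open>n^2 * x^2 * v\<close> cancel, and the integrand of
  the claim is left.\<close>

lemma weak_eigenfunction:
  fixes v v' :: "complex \<Rightarrow> complex"
  assumes v: "\<And>z. (v has_field_derivative v' z) (at z)"
    and v': "\<And>z. (v' has_field_derivative ((of_nat n)\<^sup>2 * z\<^sup>2 - \<mu>) * v z) (at z)"
    and \<phi>: "\<phi> \<in> test_functions"
  shows "l2inner Omega (fourier_mode n v') (partial_x \<phi>)
      + l2inner Omega (fourier_mode n (\<lambda>z. \<i> * of_nat n * z * v z)) (grushin_y \<phi>)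
    = \<mu> * l2inner Omega (fourier_mode n v) \<phi>"
proof -
  note T = test_functionD[OF \<phi>]
  have cv: "continuous_on UNIV v" "continuous_on UNIV v'"
    using v v' by (auto intro!: continuous_at_imp_continuous_on DERIV_isCont)
  have cz: "continuous_on UNIV (\<lambda>z. \<i> * of_nat n * z * v z)"
    "continuous_on UNIV (\<lambda>z. ((of_nat n)\<^sup>2 * z\<^sup>2 - \<mu>) * v z)"
    "continuous_on UNIV (\<lambda>z. z\<^sup>2 * (\<i> * of_nat n) * v z)"
    "continuous_on UNIV (\<lambda>z. z\<^sup>2 * (\<i> * of_nat n) * (\<i> * of_nat n) * v z)"
    by (intro continuous_intros cv)+
  have grushin_eq: "grushin_y \<phi> = (\<lambda>p. of_real (fst p) * partial_y \<phi> p)"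
    by (simp add: grushin_y_def case_prod_unfold)
  have cg: "continuous_on UNIV (grushin_y \<phi>)"
    unfolding grushin_eq using T(3)
    by (auto intro!: continuous_on_mult continuous_on_of_real continuous_on_fst continuous_on_id)
  have dx: "((\<lambda>s. cnj (\<phi> (s, y))) has_vector_derivative cnj (partial_x \<phi> (x, y))) (at x)" for x y
    by (intro bounded_linear.has_vector_derivative[OF bounded_linear_cnj] has_vector_derivative_partial_x T)
  have dy: "((\<lambda>s. cnj (\<phi> (x, s))) has_vector_derivative cnj (partial_y \<phi> (x, y))) (at y)" for x y
    by (intro bounded_linear.has_vector_derivative[OF bounded_linear_cnj] has_vector_derivative_partial_y T)
  let ?A = "\<lambda>p. fourier_mode n v' p * cnj (partial_x \<phi> p)"
  let ?B = "\<lambda>p. fourier_mode n (\<lambda>z. \<i> * of_nat n * z * v z) p * cnj (grushin_y \<phi> p)"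
  let ?C = "\<lambda>p. fourier_mode n v p * cnj (\<phi> p)"
  let ?F1 = "\<lambda>p. fourier_mode n v' p * cnj (partial_x \<phi> p) + fourier_mode n (\<lambda>z. ((of_nat n)\<^sup>2 * z\<^sup>2 - \<mu>) * v z) p * cnj (\<phi> p)"
  let ?F2 = "\<lambda>p. fourier_mode n (\<lambda>z. z\<^sup>2 * (\<i> * of_nat n) * v z) p * cnj (partial_y \<phi> p)
      + fourier_mode n (\<lambda>z. z\<^sup>2 * (\<i> * of_nat n) * (\<i> * of_nat n) * v z) p * cnj (\<phi> p)"
  have c1: "continuous_on UNIV ?F1" and c2: "continuous_on UNIV ?F2"
    by (intro continuous_on_add continuous_on_mult continuous_on_cnj continuous_fourier_mode T cv cz)+
  have I1: "(LINT p:Omega|lborel. ?F1 p) = 0"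
  proof (rule integral_Omega_derivative_x[OF c1])
    show "((\<lambda>s. (\<lambda>p. fourier_mode n v' p * cnj (\<phi> p)) (s, y)) has_vector_derivative ?F1 (x, y)) (at x)" for x y
    proof -
      have "((\<lambda>s. (v' (of_real s) * cis (n * y)) * cnj (\<phi> (s, y))) has_vector_derivative
          (v' (of_real x) * cis (n * y)) * cnj (partial_x \<phi> (x, y))
          + (((of_nat n)\<^sup>2 * (of_real x)\<^sup>2 - \<mu>) * v (of_real x) * cis (n * y)) * cnj (\<phi> (x, y))) (at x)"
        by (intro has_vector_derivative_mult has_vector_derivative_mult_left has_vector_derivative_real_field v' dx)
      then show ?thesis by (simp add: fourier_mode_def)
    qed
    show "(\<lambda>p. fourier_mode n v' p * cnj (\<phi> p)) (1, y) = (\<lambda>p. fourier_mode n v' p * cnj (\<phi> p)) (- 1, y)" for y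
      using T(6,7) by simp
  qed
  have I2: "(LINT p:Omega|lborel. ?F2 p) = 0"
  proof (rule integral_Omega_derivative_y[OF c2])
    show "((\<lambda>s. (\<lambda>p. fourier_mode n (\<lambda>z. z\<^sup>2 * (\<i> * of_nat n) * v z) p * cnj (\<phi> p)) (x, s)) has_vector_derivative ?F2 (x, y)) (at y)" for x y
    proof -
      let ?c = "(of_real x)\<^sup>2 * (\<i> * of_nat n) * v (of_real x)"
      have "((\<lambda>s. (?c * cis (n * s)) * cnj (\<phi> (x, s))) has_vector_derivative
          (?c * cis (n * y)) * cnj (partial_y \<phi> (x, y))
          + (?c * (\<i> * of_real (real n) * cis (n * y))) * cnj (\<phi> (x, y))) (at y)"
        by (intro has_vector_derivative_mult has_vector_derivative_mult_right cis_has_vector_derivative dy)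
      then show ?thesis by (simp add: fourier_mode_def mult_ac)
    qed
    show "(\<lambda>p. fourier_mode n (\<lambda>z. z\<^sup>2 * (\<i> * of_nat n) * v z) p * cnj (\<phi> p)) (x, 2 * pi)
        = (\<lambda>p. fourier_mode n (\<lambda>z. z\<^sup>2 * (\<i> * of_nat n) * v z) p * cnj (\<phi> p)) (x, 0)" for x
      using T(5)[of x 0] cis_real_nat_periodic[of n 0] by (simp add: fourier_mode_def)
  qed
  have i: "set_integrable lborel Omega ?A" "set_integrable lborel Omega ?B" "set_integrable lborel Omega ?C"
    "set_integrable lborel Omega ?F1" "set_integrable lborel Omega ?F2"
    by (intro set_integrable_Omega_mult_cnj continuous_fourier_mode cv cz cg T
        set_integrable_continuous c1 c2 Omega_borel bounded_Omega)+
  have "(\<lambda>p. ?A p + ?B p - \<mu> * ?C p) = (\<lambda>p. ?F1 p + ?F2 p)"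
    by (rule ext) (simp add: fourier_mode_def grushin_eq algebra_simps power2_eq_square)
  then have "(LINT p:Omega|lborel. ?A p + ?B p - \<mu> * ?C p) = (LINT p:Omega|lborel. ?F1 p + ?F2 p)"
    by (rule arg_cong)
  also have "\<dots> = 0" using I1 I2 i(4,5) by (simp add: set_integral_add)
  finally show ?thesis
    using i(1-3) unfolding l2inner_def by (simp add: set_integral_add set_integral_diff)
qed

text \<open>The witnesses for the two weak derivatives are sums of the same kind, with
  \<open>v'\<close> and \<open>\<i> * n * z * v\<close> in place of \<open>v\<close>. Tested with
  \<open>\<phi>\<close>, everything reduces to finitely many scalar exponentials, and by
  \<open>weak_eigenfunction\<close> the integrand in time is minus the derivative of
  \<open>l2inner Omega (F v s) \<phi>\<close> in \<open>s\<close>.\<close>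

lemma grushin_solution_modes:
  fixes v v' :: "nat \<Rightarrow> complex \<Rightarrow> complex" and \<mu> a :: "nat \<Rightarrow> complex"
  assumes T: "T > 0" and I: "finite I"
    and v: "\<And>n z. n \<in> I \<Longrightarrow> (v n has_field_derivative v' n z) (at z)"
    and v': "\<And>n z. n \<in> I \<Longrightarrow> (v' n has_field_derivative ((of_nat n)\<^sup>2 * z\<^sup>2 - \<mu> n) * v n z) (at z)"
    and bdry: "\<And>n. n \<in> I \<Longrightarrow> v n 1 = 0" "\<And>n. n \<in> I \<Longrightarrow> v n (- 1) = 0"
  defines "F \<equiv> \<lambda>u (t::real). fourier_sum I (\<lambda>n z. (a n * exp (- \<mu> n * t)) * u n z)"
  shows "F v 0 \<in> L2_Omega" and "grushin_solution T (F v 0) (F v)"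
proof -
  have cv: "continuous_on UNIV (v n)" and cv': "continuous_on UNIV (v' n)" if "n \<in> I" for n
    using v[OF that] v'[OF that] by (auto intro!: continuous_at_imp_continuous_on DERIV_isCont)
  let ?vy = "\<lambda>n z. \<i> * of_nat n * z * v n z"
  have cvy: "continuous_on UNIV (?vy n)" if "n \<in> I" for n
    by (intro continuous_intros cv that)
  have contF: "continuous_on UNIV (F u t)" if "\<And>n. n \<in> I \<Longrightarrow> continuous_on UNIV (u n)" for u t
    unfolding F_def by (intro continuous_fourier_sum continuous_on_mult continuous_on_const that)
  have L2: "F u t \<in> L2_Omega" if "\<And>n. n \<in> I \<Longrightarrow> continuous_on UNIV (u n)" for u t
    unfolding F_def by (intro fourier_sum_L2 continuous_on_mult continuous_on_const that)
  show "F v 0 \<in> L2_Omega" by (rule L2[OF cv])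
  have contF2: "continuous_on UNIV (\<lambda>(t, p). F u t p)" if "\<And>n. n \<in> I \<Longrightarrow> continuous_on UNIV (u n)" for u
  proof -
    have "continuous_on UNIV (\<lambda>q::real \<times> real \<times> real. fourier_mode n (u n) (snd q))" if "n \<in> I" for n
      by (rule continuous_on_compose2[OF continuous_fourier_mode[OF \<open>\<And>n. n \<in> I \<Longrightarrow> continuous_on UNIV (u n)\<close>[OF that]] continuous_on_snd[OF continuous_on_id]]) auto
    then have "continuous_on UNIV (\<lambda>q::real \<times> real \<times> real. \<Sum>n\<in>I. (a n * exp (- \<mu> n * of_real (fst q))) * fourier_mode n (u n) (snd q))"
      by (intro continuous_on_sum continuous_on_mult continuous_on_exp continuous_on_of_real continuous_on_fst
          continuous_on_const continuous_on_id) auto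
    then show ?thesis by (simp add: F_def fourier_sum_eq fourier_mode_def case_prod_unfold mult.assoc)
  qed
  have "{0..T} \<times> Omega \<in> sets borel" by (intro borel_Times Omega_borel) auto
  moreover have "bounded ({0..T} \<times> Omega)" by (intro bounded_Times bounded_Omega bounded_closed_interval)
  ultimately have sq: "square_integrable_on ({0..T} \<times> Omega) (\<lambda>(t, p). F u t p)"
    if "\<And>n. n \<in> I \<Longrightarrow> continuous_on UNIV (u n)" for u
    by (intro square_integrable_continuous contF2 that)
  have tcont: "((\<lambda>s. l2norm Omega (\<lambda>p. F v s p - F v t p)) \<longlongrightarrow> 0) (at t within {0..T})" for t
  proof -
    have "\<exists>B\<ge>0. \<forall>x\<in>{-1..1::real}. norm (v n (of_real x)) \<le> B" if "n \<in> I" for n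
      by (rule bounded_on_interval[OF cv[OF that]]) blast
    then obtain B where B: "\<And>n. n \<in> I \<Longrightarrow> B n \<ge> 0" "\<And>n x. n \<in> I \<Longrightarrow> x \<in> {-1..1::real} \<Longrightarrow> norm (v n (of_real x)) \<le> B n"
      by metis
    define D where "D = (\<lambda>s::real. \<Sum>n\<in>I. norm (a n * exp (- \<mu> n * s) - a n * exp (- \<mu> n * t)) * B n)"
    have D0: "D s \<ge> 0" for s unfolding D_def by (intro sum_nonneg mult_nonneg_nonneg B) auto
    have le: "l2norm Omega (\<lambda>p. F v s p - F v t p) \<le> D s * sqrt (measure lborel Omega)" for s
    proof (rule l2norm_le[OF order_refl Omega_borel bounded_Omega D0])
      fix p assume "p \<in> Omega"
      then obtain x y where p: "p = (x, y)" and x: "x \<in> {-1..1}" by (auto simp: Omega_def)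
      have "F v s p - F v t p = (\<Sum>n\<in>I. (a n * exp (- \<mu> n * s) - a n * exp (- \<mu> n * t)) * v n (of_real x) * cis (n * y))"
        by (simp add: F_def fourier_sum_def p left_diff_distrib sum_subtractf)
      also have "norm \<dots> \<le> D s"
        unfolding D_def using B(2) x by (intro sum_norm_le) (simp add: norm_mult mult_left_mono)
      finally show "norm (F v s p - F v t p) \<le> D s" .
    qed
    have "(D \<longlongrightarrow> (\<Sum>n\<in>I. norm (a n * exp (- \<mu> n * t) - a n * exp (- \<mu> n * t)) * B n)) (at t within {0..T})"
      unfolding D_def by (intro tendsto_intros)
    then have "((\<lambda>s. D s * sqrt (measure lborel Omega)) \<longlongrightarrow> 0) (at t within {0..T})"
      by (intro tendsto_mult_left_zero) simp
    then show ?thesis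
      by (rule Lim_null_comparison[rotated]) (use le in \<open>auto intro!: always_eventually simp: abs_of_nonneg[OF l2norm_nonneg]\<close>)
  qed
  have V: "grushin_V (F v t) (F v' t) (F ?vy t)" for t
  proof -
    have "grushin_V (fourier_sum I (\<lambda>n z. (a n * exp (- \<mu> n * t)) * v n z))
        (fourier_sum I (\<lambda>n z. (a n * exp (- \<mu> n * t)) * v' n z))
        (fourier_sum I (\<lambda>n z. \<i> * of_nat n * z * ((a n * exp (- \<mu> n * t)) * v n z)))"
      using v bdry by (intro grushin_V_fourier_sum I DERIV_cmult) auto
    then show ?thesis by (simp add: F_def mult_ac)
  qed
  have weak: "l2inner Omega (F v t) \<phi> - l2inner Omega (F v 0) \<phi> =
      - (LINT s:{0..t}|lborel. l2inner Omega (F v' s) (partial_x \<phi>) + l2inner Omega (F ?vy s) (grushin_y \<phi>))"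
    if \<phi>: "\<phi> \<in> test_functions" and t: "t \<in> {0..T}" for \<phi> t
  proof -
    note T = test_functionD[OF \<phi>]
    have "grushin_y \<phi> = (\<lambda>p. of_real (fst p) * partial_y \<phi> p)"
      by (simp add: grushin_y_def case_prod_unfold)
    then have cg: "continuous_on UNIV (grushin_y \<phi>)"
      using T(3) by (auto intro!: continuous_on_mult continuous_on_of_real continuous_on_fst continuous_on_id)
    define k where "k = (\<lambda>n. l2inner Omega (fourier_mode n (v n)) \<phi>)"
    have inner: "l2inner Omega (F u s) \<psi> = (\<Sum>n\<in>I. (a n * exp (- \<mu> n * s)) * l2inner Omega (fourier_mode n (u n)) \<psi>)"
      if "\<And>n. n \<in> I \<Longrightarrow> continuous_on UNIV (u n)" "continuous_on UNIV \<psi>" for u s \<psi>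
      unfolding F_def using I that
      by (subst l2inner_fourier_sum) (auto intro!: continuous_on_mult continuous_on_const simp: l2inner_fourier_mode_mult)
    have "l2inner Omega (F v' s) (partial_x \<phi>) + l2inner Omega (F ?vy s) (grushin_y \<phi>)
        = (\<Sum>n\<in>I. (a n * exp (- \<mu> n * s)) * (\<mu> n * k n))" for s
    proof -
      have "l2inner Omega (F v' s) (partial_x \<phi>) + l2inner Omega (F ?vy s) (grushin_y \<phi>)
        = (\<Sum>n\<in>I. (a n * exp (- \<mu> n * s)) * (l2inner Omega (fourier_mode n (v' n)) (partial_x \<phi>) + l2inner Omega (fourier_mode n (?vy n)) (grushin_y \<phi>)))"
        using cv' cvy T cg by (simp add: inner distrib_left sum.distrib)
      also have "\<dots> = (\<Sum>n\<in>I. (a n * exp (- \<mu> n * s)) * (\<mu> n * k n))"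
        unfolding k_def using weak_eigenfunction[OF v v' \<phi>] by (intro sum.cong refl arg_cong2[where f = "(*)"]) auto
      finally show ?thesis .
    qed
    then have "(LINT s:{0..t}|lborel. l2inner Omega (F v' s) (partial_x \<phi>) + l2inner Omega (F ?vy s) (grushin_y \<phi>))
      = (LINT s:{0..t}|lborel. \<Sum>n\<in>I. (a n * exp (- \<mu> n * s)) * (\<mu> n * k n))" by simp
    also have "\<dots> = - (\<Sum>n\<in>I. (a n * exp (- \<mu> n * t)) * k n) - - (\<Sum>n\<in>I. (a n * exp (- \<mu> n * of_real 0)) * k n)"
      unfolding set_lebesgue_integral_def
    proof (rule integral_FTC_atLeastAtMost[where F = "\<lambda>s. - (\<Sum>n\<in>I. (a n * exp (- \<mu> n * of_real s)) * k n)"])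
      fix s :: real
      have "((\<lambda>s::real. exp (- \<mu> n * s)) has_vector_derivative - \<mu> n * exp (- \<mu> n * s)) (at s)" for n
      proof -
        have "((\<lambda>z. exp (- \<mu> n * z)) has_field_derivative - \<mu> n * exp (- \<mu> n * of_real s)) (at (complex_of_real s))"
          by (auto intro!: derivative_eq_intros)
        then show ?thesis by (rule has_vector_derivative_real_field)
      qed
      then have "((\<lambda>s::real. - (\<Sum>n\<in>I. (a n * exp (- \<mu> n * s)) * k n)) has_vector_derivative
          - (\<Sum>n\<in>I. (a n * (- \<mu> n * exp (- \<mu> n * s))) * k n)) (at s)"
        by (intro has_vector_derivative_minus has_vector_derivative_sum has_vector_derivative_mult_left has_vector_derivative_mult_right)
      also have "- (\<Sum>n\<in>I. (a n * (- \<mu> n * exp (- \<mu> n * s))) * k n) = (\<Sum>n\<in>I. (a n * exp (- \<mu> n * s)) * (\<mu> n * k n))"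
        by (simp add: sum_negf mult_ac)
      finally show "((\<lambda>s::real. - (\<Sum>n\<in>I. (a n * exp (- \<mu> n * s)) * k n)) has_vector_derivative
          (\<Sum>n\<in>I. (a n * exp (- \<mu> n * s)) * (\<mu> n * k n))) (at s within {0..t})"
        by (rule has_vector_derivative_at_within)
    next
      show "continuous_on {0..t} (\<lambda>s. \<Sum>n\<in>I. (a n * exp (- \<mu> n * s)) * (\<mu> n * k n))"
        by (intro continuous_intros)
    qed (use t in auto)
    also have "\<dots> = - (l2inner Omega (F v t) \<phi> - l2inner Omega (F v 0) \<phi>)"
      unfolding k_def using inner[OF cv T(1), where s = t] inner[OF cv T(1), where s = 0] by simp
    finally show ?thesis by simp
  qed
  show "grushin_solution T (F v 0) (F v)"
    unfolding grushin_solution_def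
    by (intro conjI ballI exI[of _ "F v'"] exI[of _ "F ?vy"] AE_I2 impI L2 tcont sq cv cv' cvy V weak refl)
qed

section \<open>Blow-up\<close>

text \<open>For \<open>n \<noteq> m\<close> the integrand is the \<open>y\<close>-derivative of a
  periodic function. The test function is constant in \<open>x\<close>, so the coefficient is seen
  through its integral, and no norm of an eigenfunction has to be computed.\<close>

lemma l2inner_fourier_sum_cis:
  assumes I: "finite I" "m \<in> I" and w: "\<And>n. n \<in> I \<Longrightarrow> continuous_on UNIV (w n)"
  shows "l2inner Omega (fourier_sum I w) (\<lambda>p. cis (real m * snd p)) = (LINT p:Omega|lborel. w m (of_real (fst p)))"
proof -
  have basic: "l2inner Omega (fourier_mode n (w n)) (\<lambda>p. cis (real m * snd p))
      = (if n = m then LINT p:Omega|lborel. w m (of_real (fst p)) else 0)" if n: "n \<in> I" for n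
  proof -
    define d where "d = real n - real m"
    have eq: "fourier_mode n (w n) p * cnj (cis (real m * snd p)) = w n (of_real (fst p)) * cis (d * snd p)" for p
      by (simp add: fourier_mode_def cis_cnj cis_mult d_def algebra_simps)
    show ?thesis
    proof (cases "n = m")
      case True
      then show ?thesis unfolding l2inner_def eq by (simp add: d_def)
    next
      case False
      then have d: "d \<noteq> 0" by (simp add: d_def)
      have "(LINT p:Omega|lborel. w n (of_real (fst p)) * cis (d * snd p)) = 0"
      proof (rule integral_Omega_derivative_y[where H = "\<lambda>p. w n (of_real (fst p)) / (\<i> * of_real d) * cis (d * snd p)"])
        show "continuous_on UNIV (\<lambda>p::real \<times> real. w n (of_real (fst p)) * cis (d * snd p))"
          by (intro continuous_on_mult continuous_on_cis continuous_on_snd continuous_on_const continuous_on_id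
            continuous_on_compose2[OF w[OF n] continuous_on_of_real[OF continuous_on_fst[OF continuous_on_id]]]) auto
        fix x y :: real
        have "((\<lambda>s. w n (of_real x) / (\<i> * of_real d) * cis (d * s)) has_vector_derivative
            w n (of_real x) / (\<i> * of_real d) * (\<i> * of_real d * cis (d * y))) (at y)"
          by (intro has_vector_derivative_mult_right cis_has_vector_derivative)
        then show "((\<lambda>s. w n (of_real (fst (x, s))) / (\<i> * of_real d) * cis (d * snd (x, s))) has_vector_derivative
            w n (of_real (fst (x, y))) * cis (d * snd (x, y))) (at y)"
          using d by simp
      next
        fix x :: real
        have "cis (d * (2 * pi)) = cis (2 * pi * real n) * cnj (cis (2 * pi * real m))"
          by (simp add: d_def cis_cnj cis_mult algebra_simps)
        also have "\<dots> = 1" using cis_multiple_2pi[of "real n"] cis_multiple_2pi[of "real m"] by simp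
        finally show "w n (of_real (fst (x, 2 * pi))) / (\<i> * of_real d) * cis (d * snd (x, 2 * pi))
            = w n (of_real (fst (x, 0::real))) / (\<i> * of_real d) * cis (d * snd (x, 0))"
          by simp
      qed
      with False show ?thesis unfolding l2inner_def eq by simp
    qed
  qed
  have "continuous_on UNIV (\<lambda>p::real \<times> real. cis (real m * snd p))"
    by (intro continuous_on_cis continuous_on_mult continuous_on_snd continuous_on_const continuous_on_id)
  then have "l2inner Omega (fourier_sum I w) (\<lambda>p. cis (real m * snd p))
      = (\<Sum>n\<in>I. if n = m then LINT p:Omega|lborel. w m (of_real (fst p)) else 0)"
    using I w basic by (subst l2inner_fourier_sum) (auto intro!: sum.cong)
  then show ?thesis using I by simp
qed

text \<open>Integrate \<open>2 * t \<le> t^2 + 1\<close> at \<open>t = norm (f p)\<close>. This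
  stands in for the Cauchy-Schwarz inequality: to show divergence of the norm, a quadratic bound is
  as good as a linear one.\<close>

lemma norm_l2inner_le:
  assumes f: "continuous_on UNIV f" and \<psi>: "continuous_on UNIV \<psi>" "\<And>p. norm (\<psi> p) = 1"
  shows "2 * norm (l2inner Omega f \<psi>) \<le> (l2norm Omega f)\<^sup>2 + measure lborel Omega"
proof -
  have i: "set_integrable lborel Omega (\<lambda>p. norm (f p))" "set_integrable lborel Omega (\<lambda>p. (norm (f p))\<^sup>2)"
    "set_integrable lborel Omega (\<lambda>p. 1::real)"
    by (intro set_integrable_continuous continuous_intros f Omega_borel bounded_Omega)+
  have "norm (l2inner Omega f \<psi>) \<le> (\<integral>p. norm (indicator Omega p *\<^sub>R (f p * cnj (\<psi> p))) \<partial>lborel)"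
    unfolding l2inner_def set_lebesgue_integral_def by (rule integral_norm_bound)
  also have "\<dots> = (LINT p:Omega|lborel. norm (f p))"
    unfolding set_lebesgue_integral_def by (intro Bochner_Integration.integral_cong) (auto simp: norm_mult \<psi>(2))
  finally have 1: "norm (l2inner Omega f \<psi>) \<le> (LINT p:Omega|lborel. norm (f p))" .
  have "2 * (LINT p:Omega|lborel. norm (f p)) = (LINT p:Omega|lborel. 2 * norm (f p))" by simp
  also have "\<dots> \<le> (LINT p:Omega|lborel. (norm (f p))\<^sup>2 + 1)"
  proof (rule set_integral_mono)
    show "2 * norm (f p) \<le> (norm (f p))\<^sup>2 + 1" for p
      using zero_le_power2[of "norm (f p) - 1"] by (simp add: power2_eq_square algebra_simps)
  qed (intro set_integrable_mult_right set_integral_add i)+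
  also have "\<dots> = (LINT p:Omega|lborel. (norm (f p))\<^sup>2) + (LINT p:Omega|lborel. 1)"
    by (rule set_integral_add[OF i(2,3)])
  also have "(LINT p:Omega|lborel. (norm (f p))\<^sup>2) = (l2norm Omega f)\<^sup>2"
    unfolding l2norm_def by (subst real_sqrt_pow2) (auto simp: set_lebesgue_integral_def intro!: integral_nonneg_AE)
  also have "(LINT p:Omega|lborel. (1::real)) = measure lborel Omega"
    by (simp add: set_lebesgue_integral_def)
  finally show ?thesis using 1 by linarith
qed

text \<open>The eigenfunction is exponentially close to a positive Gaussian, whose integral is
  bounded below crudely; polynomial losses are harmless against the exponential growth of the
  coefficients.\<close>

lemma norm_integral_mode_ge:
  fixes n :: nat and r :: complex
  assumes n: "n \<ge> 1" "8 * (real n)\<^sup>2 \<le> exp (real n)" and r: "norm r \<le> 2 * (real n)\<^sup>2 * exp (- real n)"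
  shows "norm (LINT p:Omega|lborel. mode n r (of_real (fst p)))
    \<ge> exp (- 1 / 2) / n - 2 * n * exp (- n / 2) * measure lborel Omega"
proof -
  let ?e = "\<lambda>p::real \<times> real. exp (- real n * (fst p)\<^sup>2 / 2)"
  let ?d = "\<lambda>p::real \<times> real. mode n r (of_real (fst p)) - of_real (?e p)"
  have cm: "continuous_on UNIV (mode n r)"
    using mode_has_field_derivative by (auto intro!: continuous_at_imp_continuous_on DERIV_isCont)
  have ce: "continuous_on UNIV ?e" "continuous_on UNIV (\<lambda>p. complex_of_real (?e p))"
    by (intro continuous_intros; simp)+
  have cM: "continuous_on UNIV (\<lambda>p::real \<times> real. mode n r (of_real (fst p)))"
    by (rule continuous_on_compose2[OF cm continuous_on_of_real[OF continuous_on_fst[OF continuous_on_id]]]) auto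
  have i: "set_integrable lborel Omega ?e" "set_integrable lborel Omega (\<lambda>p. complex_of_real (?e p))"
    "set_integrable lborel Omega ?d"
    by (intro set_integrable_continuous continuous_on_diff ce cM Omega_borel bounded_Omega)+
  have "norm (LINT p:Omega|lborel. ?d p) \<le> (\<integral>p. norm (indicator Omega p *\<^sub>R ?d p) \<partial>lborel)"
    unfolding set_lebesgue_integral_def by (rule integral_norm_bound)
  also have "\<dots> \<le> (\<integral>p. indicator Omega p *\<^sub>R (2 * n * exp (- n / 2)) \<partial>lborel)"
  proof (rule integral_mono')
    show "integrable lborel (\<lambda>p. indicator Omega p *\<^sub>R (2 * n * exp (- n / 2)))"
      using emeasure_bounded_finite[OF bounded_Omega] Omega_borel by (intro integrable_indicator) auto
    fix p :: "real \<times> real"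
    have "norm (?d p) \<le> 2 * n * exp (- n / 2)" if "p \<in> Omega"
    proof -
      have "\<bar>fst p\<bar> \<le> 1" using that by (auto simp: Omega_def)
      then have "norm (mode n r (of_real (fst p)) - exp (- of_nat n * (of_real (fst p))\<^sup>2 / 2)) \<le> 2 * n * exp (- n / 2)"
        using norm_mode_le(2)[of "of_nat n" r "fst p"] n r by simp
      then show ?thesis by (simp flip: exp_of_real)
    qed
    then show "norm (indicator Omega p *\<^sub>R ?d p) \<le> indicator Omega p *\<^sub>R (2 * n * exp (- n / 2))"
      by (auto simp: indicator_def)
  qed auto
  also have "\<dots> = 2 * n * exp (- n / 2) * measure lborel Omega" by simp
  finally have 1: "norm (LINT p:Omega|lborel. ?d p) \<le> 2 * n * exp (- n / 2) * measure lborel Omega" .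
  \<comment> \<open>A rectangle of area \<open>1 / n\<close> on which
    \<open>n * x^2 \<le> 1\<close>, so that the Gaussian is at least
    \<open>exp (- 1 / 2)\<close>.\<close>
  define K where "K = cbox (- 1 / (2 * real n), 0) (1 / (2 * real n), 1 :: real)"
  have K: "K \<subseteq> Omega"
  proof -
    have "1 / (2 * real n) < 1" "1 < 2 * pi" using n pi_gt3 by (auto simp: field_simps)
    then show ?thesis by (auto simp: K_def Omega_def)
  qed
  have "measure lborel K = 1 / n"
    using n unfolding K_def content_Pair by (simp add: field_simps)
  then have "exp (- 1 / 2) / n = (\<integral>p. indicator K p *\<^sub>R exp (- 1 / 2) \<partial>lborel)"
    by simp
  also have "\<dots> \<le> (LINT p:Omega|lborel. ?e p)"
    unfolding set_lebesgue_integral_def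
  proof (rule integral_mono')
    show "integrable lborel (\<lambda>p. indicator Omega p *\<^sub>R ?e p)" using i(1) by (simp add: set_integrable_def)
    fix p :: "real \<times> real"
    have "exp (- 1 / 2) \<le> ?e p" if "p \<in> K"
    proof -
      have "\<bar>fst p\<bar> \<le> 1 / (2 * n)" using that by (cases p) (auto simp: K_def abs_le_iff)
      then have "(fst p)\<^sup>2 \<le> (1 / (2 * n))\<^sup>2" by (metis abs_ge_zero power2_abs power_mono)
      then have "n * (fst p)\<^sup>2 \<le> n * (1 / (2 * n))\<^sup>2" by (intro mult_left_mono) auto
      also have "\<dots> \<le> 1" using n by (simp add: power2_eq_square field_simps)
      finally show ?thesis by simp
    qed
    then show "indicator K p *\<^sub>R exp (- 1 / 2) \<le> indicator Omega p *\<^sub>R ?e p"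
      using K by (auto simp: indicator_def)
  qed auto
  also have "\<dots> = Re (LINT p:Omega|lborel. complex_of_real (?e p))"
    by (simp add: set_integral_complex_of_real)
  also have "\<dots> \<le> norm (LINT p:Omega|lborel. complex_of_real (?e p))" by (rule complex_Re_le_cmod)
  finally have 2: "exp (- 1 / 2) / n \<le> norm (LINT p:Omega|lborel. complex_of_real (?e p))" .
  have "(LINT p:Omega|lborel. complex_of_real (?e p) + ?d p)
      = (LINT p:Omega|lborel. complex_of_real (?e p)) + (LINT p:Omega|lborel. ?d p)"
    by (rule set_integral_add[OF i(2,3)])
  then have "(LINT p:Omega|lborel. mode n r (of_real (fst p)))
      = (LINT p:Omega|lborel. complex_of_real (?e p)) + (LINT p:Omega|lborel. ?d p)" by simp
  then show ?thesis
    using 1 2 norm_diff_ineq[of "LINT p:Omega|lborel. complex_of_real (?e p)" "LINT p:Omega|lborel. ?d p"] by simp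
qed

text \<open>Reduce the distance of \<open>y\<close> from the midpoint modulo \<open>2 * pi\<close>
  to \<open>0 \<le> z < 2 * pi\<close>. If \<open>z\<close> were within half the length of the
  segment from \<open>0\<close> or from \<open>2 * pi\<close>, the translate of \<open>y\<close> by
  \<open>- j\<close> or by \<open>- j - 1\<close> periods would lie in
  \<open>[a, b]\<close>.\<close>

lemma omega_shift:
  assumes "a < b" and p: "(x, y) \<in> omega a b"
  obtains j :: int where "y - (a + b) / 2 - 2 * pi * j \<in> {(b - a) / 2..2 * pi - (b - a) / 2}"
proof -
  define c where "c = (a + b) / 2"
  define j where "j = \<lfloor>(y - c) / (2 * pi)\<rfloor>"
  define z where "z = y - c - 2 * pi * j"
  have "of_int j \<le> (y - c) / (2 * pi)" "(y - c) / (2 * pi) < of_int j + 1"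
    unfolding j_def by linarith+
  then have z: "0 \<le> z" "z < 2 * pi" by (simp_all add: z_def field_simps)
  have nin: "y + 2 * pi * of_int i \<notin> {a..b}" for i :: int
    using p by (simp add: omega_def)
  have "z > (b - a) / 2"
    using nin[of "- j"] z \<open>a < b\<close> by (simp add: z_def c_def field_simps)
  moreover have "z < 2 * pi - (b - a) / 2"
    using nin[of "- j - 1"] z \<open>a < b\<close> by (simp add: z_def c_def field_simps)
  ultimately show ?thesis using that[of j] by (simp add: z_def c_def)
qed

section \<open>Choice of the data, bound on \<open>omega\<close> and blow-up\<close>

theorem theorem3:
  fixes a b T :: real
  assumes "a < b" and "T > 0"
  shows "\<exists>(f0 :: nat \<Rightarrow> real \<times> real \<Rightarrow> complex) (f :: nat \<Rightarrow> real \<Rightarrow> real \<times> real \<Rightarrow> complex).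
    (\<forall>k. f0 k \<in> L2_Omega) \<and>
    (\<forall>k. grushin_solution T (f0 k) (f k)) \<and>
    bdd_above (range (\<lambda>k. l2norm ({0..T} \<times> omega a b) (\<lambda>(t, p). f k t p))) \<and>
    filterlim (\<lambda>k. l2norm Omega (f k T)) at_top sequentially"
proof -
  define c where "c = (a + b) / 2"
  define \<delta> where "\<delta> = (b - a) / 2"
  have \<delta>: "\<delta> > 0" using assms by (simp add: \<delta>_def)
  obtain n0 :: nat and \<rho> :: "complex \<Rightarrow> complex" and M :: real where \<rho>: "\<And>n. n \<ge> n0 \<Longrightarrow> n \<ge> 1 \<and> 8 * (real n)\<^sup>2 \<le> exp (real n)
       \<and> norm (\<rho> n) \<le> 2 * (real n)\<^sup>2 * exp (- real n) \<and> \<rho> n * herm n (\<rho> n) 1 = 1"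
    and M: "\<And>\<epsilon>. \<epsilon> > 0 \<Longrightarrow> \<forall>\<^sub>F N in sequentially. \<forall>t\<in>{0..T}. \<forall>x\<in>{-1..1::real}. \<forall>y\<in>{\<delta>..2 * pi - \<delta>}.
       norm (\<Sum>n=n0..N. of_real (amplitude T \<epsilon> n) * exp (- (n + \<rho> n) * t) * mode n (\<rho> n) (of_real x) * cis (n * y)) \<le> M"
    by (rule bounded_away_from_axis[OF \<open>T > 0\<close> \<delta>]) (rule that, assumption+)
  define \<epsilon> where "\<epsilon> = (\<lambda>k. 1 / (real k + 1))"
  have \<epsilon>: "\<epsilon> k > 0" for k by (simp add: \<epsilon>_def)
  define good where "good = (\<lambda>k N. \<forall>t\<in>{0..T}. \<forall>x\<in>{-1..1::real}. \<forall>y\<in>{\<delta>..2 * pi - \<delta>}.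
       norm (\<Sum>n=n0..N. of_real (amplitude T (\<epsilon> k) n) * exp (- (n + \<rho> n) * t) * mode n (\<rho> n) (of_real x) * cis (n * y)) \<le> M)"
  have "\<forall>\<^sub>F N in sequentially. N \<ge> k \<and> good k N" for k
    using eventually_ge_at_top[of k] M[OF \<epsilon>[of k]] unfolding good_def by (rule eventually_conj)
  from eventually_happens'[OF sequentially_bot this] have "\<exists>N. N \<ge> k \<and> good k N" for k .
  \<comment> \<open>\<open>N k\<close> is good for the damping \<open>\<epsilon> k\<close>, and
    \<open>N k \<ge> k\<close> ensures that a given mode \<open>n \<ge> n0\<close> occurs in every
    sum with \<open>k \<ge> n\<close>.\<close>
  then obtain N where N: "\<And>k. N k \<ge> k" and "\<And>k. good k (N k)"
    by metis
  then have bound: "norm (\<Sum>n=n0..N k. of_real (amplitude T (\<epsilon> k) n) * exp (- (n + \<rho> n) * t) * mode n (\<rho> n) (of_real x) * cis (n * y)) \<le> M"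
    if "t \<in> {0..T}" "x \<in> {-1..1::real}" "y \<in> {\<delta>..2 * pi - \<delta>}" for k and t x y :: real
    using that unfolding good_def by blast
  define \<mu> where "\<mu> = (\<lambda>n::nat. of_nat n + \<rho> n)"
  define v where "v = (\<lambda>n::nat. mode n (\<rho> n))"
  define \<alpha> where "\<alpha> = (\<lambda>k n. of_real (amplitude T (\<epsilon> k) n) * cis (- (real n * c)))"
  define f where "f = (\<lambda>k (t::real). fourier_sum {n0..N k} (\<lambda>n z. (\<alpha> k n * exp (- \<mu> n * t)) * v n z))"
  have modes: "f k 0 \<in> L2_Omega" "grushin_solution T (f k 0) (f k)" for k
  proof -
    have d: "(v n has_field_derivative mode' n (\<rho> n) z) (at z)"
      "(mode' n (\<rho> n) has_field_derivative ((of_nat n)\<^sup>2 * z\<^sup>2 - \<mu> n) * v n z) (at z)" for n z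
      unfolding v_def \<mu>_def by (rule mode_has_field_derivative mode'_has_field_derivative)+
    have bdry: "v n 1 = 0" "v n (- 1) = 0" if "n \<in> {n0..N k}" for n
      using \<rho>[of n] that by (auto simp: v_def mode_1)
    show "f k 0 \<in> L2_Omega" unfolding f_def
      by (rule grushin_solution_modes(1)[where I = "{n0..N k}", OF \<open>T > 0\<close> finite_atLeastAtMost d bdry])
    show "grushin_solution T (f k 0) (f k)" unfolding f_def
      by (rule grushin_solution_modes(2)[where I = "{n0..N k}", OF \<open>T > 0\<close> finite_atLeastAtMost d bdry])
  qed
  have f_le: "norm (f k t (x, y)) \<le> M" if t: "t \<in> {0..T}" and p: "(x, y) \<in> omega a b" for k t x y
  proof -
    obtain j :: int where j: "y - c - 2 * pi * j \<in> {\<delta>..2 * pi - \<delta>}"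
      using omega_shift[OF \<open>a < b\<close> p] unfolding c_def \<delta>_def by blast
    have x: "x \<in> {-1..1}" using p by (auto simp: omega_def Omega_def)
    \<comment> \<open>The frequencies are integers, so moving \<open>y\<close> by whole periods
      leaves the phase unchanged; the phase built into \<open>\<alpha>\<close> recentres the sum at
      the midpoint \<open>c\<close>.\<close>
    have "cis (- (real n * c)) * cis (real n * y) = cis (real n * (y - c - 2 * pi * j))" for n :: nat
    proof -
      have "cis (- (2 * pi * (real n * j))) = 1"
        using cis_multiple_2pi[of "- (real n * of_int j)"] by (simp add: Ints_mult)
      then have "cis (- (real n * c)) * cis (real n * y) = cis (- (real n * c)) * cis (real n * y) * cis (- (2 * pi * (real n * j)))"
        by simp
      also have "\<dots> = cis (real n * (y - c - 2 * pi * j))"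
        unfolding cis_mult by (rule arg_cong[where f = cis]) (simp add: algebra_simps)
      finally show ?thesis .
    qed
    then have "f k t (x, y) = (\<Sum>n=n0..N k. of_real (amplitude T (\<epsilon> k) n) * exp (- (n + \<rho> n) * t) * mode n (\<rho> n) (of_real x)
        * cis (n * (y - c - 2 * pi * j)))"
      unfolding f_def fourier_sum_def \<alpha>_def \<mu>_def v_def by (auto intro!: sum.cong simp: mult_ac)
    with bound[OF t x j] show ?thesis by simp
  qed
  have bdd: "l2norm ({0..T} \<times> omega a b) (\<lambda>(t, p). f k t p) \<le> max M 0 * sqrt (measure lborel ({0..T} \<times> Omega))" for k
  proof (rule l2norm_le)
    show "{0..T} \<times> omega a b \<subseteq> {0..T} \<times> Omega" by (auto simp: omega_def)
    show "{0..T} \<times> Omega \<in> sets borel" by (intro borel_Times Omega_borel) auto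
    show "bounded ({0..T} \<times> Omega)" by (intro bounded_Times bounded_Omega bounded_closed_interval)
    show "norm (case q of (t, p) \<Rightarrow> f k t p) \<le> max M 0" if "q \<in> {0..T} \<times> omega a b" for q
      using that f_le by (auto intro: max.coboundedI1)
  qed simp
  define A where "A = measure lborel Omega"
  \<comment> \<open>A lower bound for the modulus of the \<open>n\<close>-th Fourier coefficient in
    the limit of vanishing damping: \<open>exp ((T + 1) * n)\<close> from the amplitude times
    \<open>exp (- (n * T) - T)\<close> from the evolution leaves \<open>exp (n - T)\<close>, and the
    bracket comes from \<open>norm_integral_mode_ge\<close>.\<close>
  define \<beta> where "\<beta> = (\<lambda>n::nat. exp (n - T) * (exp (- 1 / 2) / n - 2 * n * exp (- n / 2) * A))"
  have \<beta>_lim: "filterlim \<beta> at_top sequentially"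
    unfolding \<beta>_def by real_asymp
  have lower: "2 * (amplitude T (\<epsilon> k) n * (exp (- (n * T) - T) * (exp (- 1 / 2) / n - 2 * n * exp (- n / 2) * A)))
      \<le> (l2norm Omega (f k T))\<^sup>2 + A" if n: "n0 \<le> n" "n \<le> k" for n k
  proof -
    have nI: "n \<in> {n0..N k}" using n N[of k] by simp
    have cw: "continuous_on UNIV (\<lambda>z. (\<alpha> k n * exp (- \<mu> n * T)) * v n z)" for n
      unfolding v_def using mode_has_field_derivative
      by (intro continuous_on_mult continuous_on_const continuous_at_imp_continuous_on ballI DERIV_isCont) auto
    have r: "norm (\<rho> n) \<le> 1"
      using norm_mode_le(1)[of "of_nat n" "\<rho> n" 0] \<rho>[OF n(1)] by simp
    have "Re (\<rho> n) * T \<le> 1 * T"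
      using r assms complex_Re_le_cmod[of "\<rho> n"] by (intro mult_right_mono) auto
    then have "exp (- (n * T) - T) \<le> norm (exp (- \<mu> n * T))"
      by (simp add: \<mu>_def algebra_simps)
    moreover have "exp (- 1 / 2) / n - 2 * n * exp (- n / 2) * A \<le> norm (LINT p:Omega|lborel. v n (of_real (fst p)))"
      unfolding A_def v_def using \<rho>[OF n(1)] by (intro norm_integral_mode_ge) auto
    ultimately have "exp (- (n * T) - T) * (exp (- 1 / 2) / n - 2 * n * exp (- n / 2) * A)
        \<le> norm (exp (- \<mu> n * T)) * norm (LINT p:Omega|lborel. v n (of_real (fst p)))"
      by (meson exp_ge_zero mult_left_mono mult_right_mono norm_ge_zero order_trans)
    then have "amplitude T (\<epsilon> k) n * (exp (- (n * T) - T) * (exp (- 1 / 2) / n - 2 * n * exp (- n / 2) * A))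
        \<le> amplitude T (\<epsilon> k) n * (norm (exp (- \<mu> n * T)) * norm (LINT p:Omega|lborel. v n (of_real (fst p))))"
      by (intro mult_left_mono) (simp_all add: amplitude_def)
    also have "\<dots> = norm (l2inner Omega (f k T) (\<lambda>p. cis (real n * snd p)))"
      unfolding f_def l2inner_fourier_sum_cis[OF finite_atLeastAtMost nI cw]
      by (simp add: \<alpha>_def norm_mult amplitude_def)
    also have "2 * \<dots> \<le> (l2norm Omega (f k T))\<^sup>2 + A"
      unfolding A_def
    proof (rule norm_l2inner_le)
      show "continuous_on UNIV (f k T)" unfolding f_def by (rule continuous_fourier_sum[OF cw])
      show "continuous_on UNIV (\<lambda>p::real \<times> real. cis (real n * snd p))"
        by (intro continuous_on_cis continuous_on_mult continuous_on_snd continuous_on_const continuous_on_id)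
    qed simp
    finally show ?thesis by simp
  qed
  have blowup: "filterlim (\<lambda>k. l2norm Omega (f k T)) at_top sequentially"
    unfolding filterlim_at_top
  proof
    fix Z :: real
    have "\<forall>\<^sub>F n in sequentially. \<beta> n \<ge> Z\<^sup>2 + A \<and> n \<ge> n0"
      using \<beta>_lim eventually_ge_at_top[of n0] unfolding filterlim_at_top by (intro eventually_conj) auto
    \<comment> \<open>The order of choices matters: \<open>n\<close> is fixed according to
      \<open>Z\<close>, and only then does \<open>k\<close> tend to infinity, so that the damping of
      this one mode disappears.\<close>
    then obtain n where n: "\<beta> n \<ge> Z\<^sup>2 + A" "n \<ge> n0" using eventually_happens by force
    have "(\<lambda>k. amplitude T (\<epsilon> k) n) \<longlonglongrightarrow> exp ((T + 1) * n - 0 * (n * ln n))"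
      unfolding amplitude_def \<epsilon>_def by (intro tendsto_intros) real_asymp
    moreover have "exp ((T + 1) * n - 0 * (n * ln n)) > exp ((T + 1) * n) / 2" by simp
    ultimately have "\<forall>\<^sub>F k in sequentially. amplitude T (\<epsilon> k) n > exp ((T + 1) * n) / 2"
      by (rule order_tendstoD)
    with eventually_ge_at_top[of n] show "\<forall>\<^sub>F k in sequentially. Z \<le> l2norm Omega (f k T)"
    proof eventually_elim
      case (elim k)
      define X where "X = exp (- (n * T) - T) * (exp (- 1 / 2) / n - 2 * n * exp (- n / 2) * A)"
      have \<beta>X: "\<beta> n = exp ((T + 1) * n) * X"
        unfolding X_def \<beta>_def mult.assoc[symmetric] mult_exp_exp by (simp add: algebra_simps)
      have "A \<ge> 0" by (simp add: A_def)
      then have "\<beta> n \<ge> 0" using n(1) zero_le_power2[of Z] by linarith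
      then have "X \<ge> 0" by (simp add: \<beta>X zero_le_mult_iff)
      have "Z\<^sup>2 + A \<le> 2 * ((exp ((T + 1) * n) / 2) * X)" using n(1) \<beta>X by simp
      also have "\<dots> \<le> 2 * (amplitude T (\<epsilon> k) n * X)"
        using elim \<open>X \<ge> 0\<close> by (intro mult_left_mono mult_right_mono) auto
      also have "\<dots> \<le> (l2norm Omega (f k T))\<^sup>2 + A"
        unfolding X_def using lower[OF n(2), of k] elim by simp
      finally have "\<bar>Z\<bar> \<le> \<bar>l2norm Omega (f k T)\<bar>" unfolding abs_le_square_iff by simp
      then show ?case using l2norm_nonneg[of Omega "f k T"] by simp
    qed
  qed
  show ?thesis
    using modes bdd blowup
    by (intro exI[of _ "\<lambda>k. f k 0"] exI[of _ f] conjI allI bdd_aboveI2) auto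
qed

end
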